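(* Let $n$ be a positive integer, let $\mathcal C$ be an idempotent complete additive category, and let $\mathscr X$ be a class of $n$-exact sequences in $\mathcal C$. Then $\mathscr X$ is an $n$-exact structure on $\mathcal C$ in the sense of Jasso (Definition J) if and only if $\mathscr X$ is an $n$-exact structure on $\mathcal C$ in the sense of Definition H.
   Context: **$n$-exact sequences.** A complex $X_\bullet: X_{n+1}\xrightarrow{d^X_{n+1}}X_n\to\cdots\to X_1\xrightarrow{d^X_1}X_0$ in $\mathcal C$ is left $n$-exact if $0\to\mathcal C(Y,X_{n+1})\to\cdots\to\mathcal C(Y,X_0)$ is exact for all $Y\in\mathcal C$, right $n$-exact if $0\to\mathcal C(X_0,Y)\to\cdots\to\mathcal C(X_{n+1},Y)$ is exact for all $Y\in\mathcal C$, and $n$-exact if both. For a class $\mathscr X$ of $n$-exact sequences, its members are $\mathscr X$-conflations, and the first morphism $d^X_{n+1}$ (resp. last morphism $d^X_1$) of an $\mathscr X$-conflation is an $\mathscr X$-inflation (resp. $\mathscr X$-deflation). A weak kernel of $f$ is a morphism $g$ with $fg=0$ through which every $h$ with $fh=0$ factors, not necessarily uniquely; weak cokernels are dual. Both definitions use the axioms: (Ex0) the zero complex is in $\mathscr X$; (Ex1) $\mathscr X$-inflations are closed under composition; (Ex1$^{\mathrm{op}}$) $\mathscr X$-deflations are closed under composition. **Definition H.** $\mathscr X$ is closed under homotopy equivalence (of complexes of the form $X_{n+1}\to\cdots\to X_0$), satisfies (Ex0), (Ex1), (Ex1$^{\mathrm{op}}$), and (Ex2) for every $\mathscr X$-inflation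 $d^X_{n+1}:X_{n+1}\to X_n$ and every $f_{n+1}:X_{n+1}\to Y_{n+1}$, the morphism $\begin{bmatrix}-d^X_{n+1}\\ f_{n+1}\end{bmatrix}:X_{n+1}\to X_n\oplus Y_{n+1}$ is an $\mathscr X$-inflation admitting a weak cokernel $[f_n\ \ d^Y_{n+1}]:X_n\oplus Y_{n+1}\to Y_n$ such that $d^Y_{n+1}$ is an $\mathscr X$-inflation; (Ex2$^{\mathrm{op}}$) for every $\mathscr X$-deflation $d^X_1:X_1\to X_0$ and every $f_0:Y_0\to X_0$, the morphism $[-d^X_1\ \ f_0]:X_1\oplus Y_0\to X_0$ is an $\mathscr X$-deflation admitting a weak kernel $\begin{bmatrix}f_1\\ d^Y_1\end{bmatrix}:Y_1\to X_1\oplus Y_0$ such that $d^Y_1$ is an $\mathscr X$-deflation. **Definition J (Jasso).** A morphism of complexes $f_\bullet:Y_\bullet\to X_\bullet$ between $n$-exact sequences is a weak isomorphism if $f_k$ and $f_{k+1}$ are isomorphisms for some $0\le k\le n$, or $f_0$ and $f_{n+1}$ are isomorphisms. $\mathscr X$ is closed under weak isomorphisms (if $f_\bullet:Y_\bullet\to X_\bullet$ is a weak isomorphism of $n$-exact sequences, then $X_\bullet\in\mathscr X$ iff $Y_\bullet\in\mathscr X$), satisfies (Ex0), (Ex1), (Ex1$^{\mathrm{op}}$), and (E2) for every $X_\bullet\in\mathscr X$ and every $f_{n+1}:X_{n+1}\to Y_{n+1}$ there is an $n$-pushout diagram of $(d^X_{n+1},\dots,d^X_2)$ along $f_{n+1}$,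 i.e. a complex $Y_{n+1}\xrightarrow{d^Y_{n+1}}\cdots\xrightarrow{d^Y_2}Y_1$ and a morphism of complexes $(f_{n+1},\dots,f_1)$ from $X_{n+1}\to\cdots\to X_1$ to it, such that the mapping cone $$X_{n+1}\to X_n\oplus Y_{n+1}\to X_{n-1}\oplus Y_n\to\cdots\to X_1\oplus Y_2\to Y_1$$ with differentials $\begin{bmatrix}-d^X_{n+1}\\ f_{n+1}\end{bmatrix}$, $\begin{bmatrix}-d^X_k&0\\ f_k&d^Y_{k+1}\end{bmatrix}$ ($2\le k\le n$), $[f_1\ \ d^Y_2]$ is right $n$-exact, and such that moreover $d^Y_{n+1}$ is an $\mathscr X$-inflation; (E2$^{\mathrm{op}}$) for every $X_\bullet\in\mathscr X$ and every $f_0:Y_0\to X_0$ there is an $n$-pullback diagram of $(d^X_n,\dots,d^X_1)$ along $f_0$, i.e. a complex $Y_n\xrightarrow{d^Y_n}\cdots\xrightarrow{d^Y_1}Y_0$ and a morphism of complexes $(f_n,\dots,f_0)$ from it to $X_n\to\cdots\to X_0$, such that the mapping cone $$Y_n\to X_n\oplus Y_{n-1}\to\cdots\to X_1\oplus Y_0\to X_0$$ with differentials $\begin{bmatrix}f_n\\ d^Y_n\end{bmatrix}$, $\begin{bmatrix}-d^X_k&f_{k-1}\\ 0&d^Y_{k-1}\end{bmatrix}$ ($2\le k\le n$), $[-d^X_1\ \ f_0]$ is left $n$-exact, and such that moreover $d^Y_1$ is an $\mathscr X$-deflation. (For $n=1$ conditions (E2), (E2$^{\mathrm{op}}$) reduce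 to pushouts and pullbacks. For $n = 1$, when (E2) refers to $(d^X_{2})$ this is the single morphism $X_2\to X_1$, and similarly for (E2$^{\mathrm{op}}$).) *)

theory Defs
  imports "HOL-Algebra.Coset"
begin

section \<open>Additive categories\<close>

text \<open>
  \<open>g \<cdot>\<^bsub>C\<^esub> f\<close> is the composite of \<open>f\<close> followed by \<open>g\<close>;
  \<open>Add C\<close> is only meaningful on parallel morphisms.
\<close>

record ('o, 'm) cat =
  Obj :: "'o set"
  Arr :: "'m set"
  Dom :: "'m \<Rightarrow> 'o"
  Cod :: "'m \<Rightarrow> 'o"
  Ident :: "'o \<Rightarrow> 'm"
  Comp :: "'m \<Rightarrow> 'm \<Rightarrow> 'm" (infixl "\<cdot>\<index>" 75)
  Add :: "'m \<Rightarrow> 'm \<Rightarrow> 'm" (infixl "\<boxplus>\<index>" 65)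
  Zero :: "'o \<Rightarrow> 'o \<Rightarrow> 'm"

definition Hom :: "('o, 'm) cat \<Rightarrow> 'o \<Rightarrow> 'o \<Rightarrow> 'm set" where
  "Hom C A B = {f \<in> Arr C. Dom C f = A \<and> Cod C f = B}"

definition hom_group :: "('o, 'm) cat \<Rightarrow> 'o \<Rightarrow> 'o \<Rightarrow> 'm monoid" where
  "hom_group C A B = \<lparr>carrier = Hom C A B, mult = Add C, one = Zero C A B\<rparr>"

definition Neg :: "('o, 'm) cat \<Rightarrow> 'm \<Rightarrow> 'm" where
  "Neg C f = inv\<^bsub>hom_group C (Dom C f) (Cod C f)\<^esub> f"

locale category =
  fixes C :: "('o, 'm) cat"
  assumes Dom_in_Obj: "f \<in> Arr C \<Longrightarrow> Dom C f \<in> Obj C"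
    and Cod_in_Obj: "f \<in> Arr C \<Longrightarrow> Cod C f \<in> Obj C"
    and Ident_in_Hom: "A \<in> Obj C \<Longrightarrow> Ident C A \<in> Hom C A A"
    and Comp_in_Hom: "f \<in> Hom C A B \<Longrightarrow> g \<in> Hom C B D \<Longrightarrow> g \<cdot>\<^bsub>C\<^esub> f \<in> Hom C A D"
    and Comp_assoc: "f \<in> Hom C A B \<Longrightarrow> g \<in> Hom C B D \<Longrightarrow> h \<in> Hom C D E \<Longrightarrow>
          h \<cdot>\<^bsub>C\<^esub> g \<cdot>\<^bsub>C\<^esub> f = h \<cdot>\<^bsub>C\<^esub> (g \<cdot>\<^bsub>C\<^esub> f)"
    and Comp_Ident_right: "f \<in> Hom C A B \<Longrightarrow> f \<cdot>\<^bsub>C\<^esub> Ident C A = f"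
    and Comp_Ident_left: "f \<in> Hom C A B \<Longrightarrow> Ident C B \<cdot>\<^bsub>C\<^esub> f = f"

locale preadditive_category = category +
  assumes comm_group_hom: "A \<in> Obj C \<Longrightarrow> B \<in> Obj C \<Longrightarrow> comm_group (hom_group C A B)"
    and Comp_Add_right: "f \<in> Hom C A B \<Longrightarrow> f' \<in> Hom C A B \<Longrightarrow> g \<in> Hom C B D \<Longrightarrow>
          g \<cdot>\<^bsub>C\<^esub> (f \<boxplus>\<^bsub>C\<^esub> f') = g \<cdot>\<^bsub>C\<^esub> f \<boxplus>\<^bsub>C\<^esub> g \<cdot>\<^bsub>C\<^esub> f'"
    and Comp_Add_left: "f \<in> Hom C A B \<Longrightarrow> g \<in> Hom C B D \<Longrightarrow> g' \<in> Hom C B D \<Longrightarrow>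
          (g \<boxplus>\<^bsub>C\<^esub> g') \<cdot>\<^bsub>C\<^esub> f = g \<cdot>\<^bsub>C\<^esub> f \<boxplus>\<^bsub>C\<^esub> g' \<cdot>\<^bsub>C\<^esub> f"

definition is_zero_object :: "('o, 'm) cat \<Rightarrow> 'o \<Rightarrow> bool" where
  "is_zero_object C Z \<longleftrightarrow> Z \<in> Obj C \<and>
    (\<forall>A\<in>Obj C. (\<exists>!f. f \<in> Hom C A Z) \<and> (\<exists>!f. f \<in> Hom C Z A))"

record ('o, 'm) biproduct =
  vertex :: 'o
  in1 :: 'm
  in2 :: 'm
  pr1 :: 'm
  pr2 :: 'm

definition is_biproduct :: "('o, 'm) cat \<Rightarrow> 'o \<Rightarrow> 'o \<Rightarrow> ('o, 'm) biproduct \<Rightarrow> bool" where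
  "is_biproduct C A B S \<longleftrightarrow> vertex S \<in> Obj C \<and>
    in1 S \<in> Hom C A (vertex S) \<and> in2 S \<in> Hom C B (vertex S) \<and>
    pr1 S \<in> Hom C (vertex S) A \<and> pr2 S \<in> Hom C (vertex S) B \<and>
    pr1 S \<cdot>\<^bsub>C\<^esub> in1 S = Ident C A \<and> pr2 S \<cdot>\<^bsub>C\<^esub> in2 S = Ident C B \<and>
    pr1 S \<cdot>\<^bsub>C\<^esub> in2 S = Zero C B A \<and> pr2 S \<cdot>\<^bsub>C\<^esub> in1 S = Zero C A B \<and>
    in1 S \<cdot>\<^bsub>C\<^esub> pr1 S \<boxplus>\<^bsub>C\<^esub> in2 S \<cdot>\<^bsub>C\<^esub> pr2 S = Ident C (vertex S)"

locale additive_category = preadditive_category +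
  assumes ex_zero_object: "\<exists>Z. is_zero_object C Z"
    and ex_biproduct: "A \<in> Obj C \<Longrightarrow> B \<in> Obj C \<Longrightarrow> \<exists>S. is_biproduct C A B S"

locale idempotent_complete_additive_category = additive_category +
  assumes idempotents_split: "A \<in> Obj C \<Longrightarrow> e \<in> Hom C A A \<Longrightarrow> e \<cdot>\<^bsub>C\<^esub> e = e \<Longrightarrow>
    \<exists>B\<in>Obj C. \<exists>r\<in>Hom C A B. \<exists>s\<in>Hom C B A. r \<cdot>\<^bsub>C\<^esub> s = Ident C B \<and> s \<cdot>\<^bsub>C\<^esub> r = e"

text \<open>
  The zero object and the direct sum \<open>A \<oplus> B\<close> are fixed by choice among all zero objects and
  biproduct diagrams, which are unique up to isomorphism.
\<close>

definition zero_object :: "('o, 'm) cat \<Rightarrow> 'o" where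
  "zero_object C = (SOME Z. is_zero_object C Z)"

definition biprod :: "('o, 'm) cat \<Rightarrow> 'o \<Rightarrow> 'o \<Rightarrow> ('o, 'm) biproduct" where
  "biprod C A B = (SOME S. is_biproduct C A B S)"

definition dsum :: "('o, 'm) cat \<Rightarrow> 'o \<Rightarrow> 'o \<Rightarrow> 'o" where
  "dsum C A B = vertex (biprod C A B)"

text \<open>
  \<open>col C f g\<close> is the column with entries \<open>f, g\<close> from the common domain to the direct sum of the
  codomains, \<open>row C f g\<close> is the row \<open>[f g]\<close> out of the direct sum of the domains, and
  \<open>mat22 C a b c d\<close> is the matrix with rows \<open>[a b]\<close> and \<open>[c d]\<close>.
\<close>

definition col :: "('o, 'm) cat \<Rightarrow> 'm \<Rightarrow> 'm \<Rightarrow> 'm" where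
  "col C f g = (let S = biprod C (Cod C f) (Cod C g)
     in in1 S \<cdot>\<^bsub>C\<^esub> f \<boxplus>\<^bsub>C\<^esub> in2 S \<cdot>\<^bsub>C\<^esub> g)"

definition row :: "('o, 'm) cat \<Rightarrow> 'm \<Rightarrow> 'm \<Rightarrow> 'm" where
  "row C f g = (let S = biprod C (Dom C f) (Dom C g)
     in f \<cdot>\<^bsub>C\<^esub> pr1 S \<boxplus>\<^bsub>C\<^esub> g \<cdot>\<^bsub>C\<^esub> pr2 S)"

definition mat22 :: "('o, 'm) cat \<Rightarrow> 'm \<Rightarrow> 'm \<Rightarrow> 'm \<Rightarrow> 'm \<Rightarrow> 'm" where
  "mat22 C a b c d = col C (row C a b) (row C c d)"

definition is_iso :: "('o, 'm) cat \<Rightarrow> 'm \<Rightarrow> bool" where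
  "is_iso C f \<longleftrightarrow> f \<in> Arr C \<and> (\<exists>g\<in>Hom C (Cod C f) (Dom C f).
     g \<cdot>\<^bsub>C\<^esub> f = Ident C (Dom C f) \<and> f \<cdot>\<^bsub>C\<^esub> g = Ident C (Cod C f))"

definition is_weak_kernel :: "('o, 'm) cat \<Rightarrow> 'm \<Rightarrow> 'm \<Rightarrow> bool" where
  "is_weak_kernel C f g \<longleftrightarrow> f \<in> Arr C \<and> g \<in> Arr C \<and> Cod C g = Dom C f \<and>
    f \<cdot>\<^bsub>C\<^esub> g = Zero C (Dom C g) (Cod C f) \<and>
    (\<forall>h\<in>Arr C. Cod C h = Dom C f \<and> f \<cdot>\<^bsub>C\<^esub> h = Zero C (Dom C h) (Cod C f) \<longrightarrow>
      (\<exists>u\<in>Hom C (Dom C h) (Dom C g). g \<cdot>\<^bsub>C\<^esub> u = h))"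

definition is_weak_cokernel :: "('o, 'm) cat \<Rightarrow> 'm \<Rightarrow> 'm \<Rightarrow> bool" where
  "is_weak_cokernel C f g \<longleftrightarrow> f \<in> Arr C \<and> g \<in> Arr C \<and> Dom C g = Cod C f \<and>
    g \<cdot>\<^bsub>C\<^esub> f = Zero C (Dom C f) (Cod C g) \<and>
    (\<forall>h\<in>Arr C. Dom C h = Cod C f \<and> h \<cdot>\<^bsub>C\<^esub> f = Zero C (Dom C f) (Cod C h) \<longrightarrow>
      (\<exists>u\<in>Hom C (Cod C g) (Cod C h). u \<cdot>\<^bsub>C\<^esub> g = h))"


section \<open>Complexes\<close>

text \<open>
  A complex \<open>X\<^sub>b \<rightarrow> \<dots> \<rightarrow> X\<^sub>a\<close> has terms \<open>tm X k\<close> for \<open>a \<le> k \<le> b\<close> and differentials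
  \<open>df X k : tm X k \<rightarrow> tm X (k - 1)\<close> for \<open>a < k \<le> b\<close>.  Outside these ranges both are
  \<open>undefined\<close>, so that equality of records is equality of complexes.
\<close>

record ('o, 'm) cpx =
  tm :: "nat \<Rightarrow> 'o"
  df :: "nat \<Rightarrow> 'm"

definition is_complex :: "('o, 'm) cat \<Rightarrow> nat \<Rightarrow> nat \<Rightarrow> ('o, 'm) cpx \<Rightarrow> bool" where
  "is_complex C a b X \<longleftrightarrow>
    tm X \<in> {a..b} \<rightarrow>\<^sub>E Obj C \<and>
    df X \<in> (\<Pi>\<^sub>E k\<in>{a<..b}. Hom C (tm X k) (tm X (k - 1))) \<and>
    (\<forall>k. a < k \<and> k < b \<longrightarrow>
      df X k \<cdot>\<^bsub>C\<^esub> df X (k + 1) = Zero C (tm X (k + 1)) (tm X (k - 1)))"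

text \<open>
  Only the parts of \<open>X\<close> and \<open>Y\<close> in degrees \<open>a, \<dots>, b\<close> matter here, so this also expresses
  morphisms to and from truncations.
\<close>

definition is_cpx_morphism ::
  "('o, 'm) cat \<Rightarrow> nat \<Rightarrow> nat \<Rightarrow> ('o, 'm) cpx \<Rightarrow> ('o, 'm) cpx \<Rightarrow> (nat \<Rightarrow> 'm) \<Rightarrow> bool" where
  "is_cpx_morphism C a b X Y f \<longleftrightarrow>
    (\<forall>k\<in>{a..b}. f k \<in> Hom C (tm X k) (tm Y k)) \<and>
    (\<forall>k\<in>{a<..b}. f (k - 1) \<cdot>\<^bsub>C\<^esub> df X k = df Y k \<cdot>\<^bsub>C\<^esub> f k)"

text \<open>
  Homotopies and homotopy equivalences of complexes concentrated in degrees \<open>0, \<dots>, N\<close>;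
  the endpoints are not required to be fixed.
\<close>

definition homotopic ::
  "('o, 'm) cat \<Rightarrow> nat \<Rightarrow> ('o, 'm) cpx \<Rightarrow> ('o, 'm) cpx \<Rightarrow> (nat \<Rightarrow> 'm) \<Rightarrow> (nat \<Rightarrow> 'm) \<Rightarrow> bool" where
  "homotopic C N X Y f g \<longleftrightarrow>
    (\<exists>h. (\<forall>k<N. h k \<in> Hom C (tm X k) (tm Y (k + 1))) \<and>
      (\<forall>k\<le>N. f k = g k
         \<boxplus>\<^bsub>C\<^esub> (if k < N then df Y (k + 1) \<cdot>\<^bsub>C\<^esub> h k else Zero C (tm X k) (tm Y k))
         \<boxplus>\<^bsub>C\<^esub> (if 0 < k then h (k - 1) \<cdot>\<^bsub>C\<^esub> df X k else Zero C (tm X k) (tm Y k))))"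

definition homotopy_equivalent ::
  "('o, 'm) cat \<Rightarrow> nat \<Rightarrow> ('o, 'm) cpx \<Rightarrow> ('o, 'm) cpx \<Rightarrow> bool" where
  "homotopy_equivalent C N X Y \<longleftrightarrow>
    (\<exists>f g. is_cpx_morphism C 0 N X Y f \<and> is_cpx_morphism C 0 N Y X g \<and>
      homotopic C N X X (\<lambda>k. g k \<cdot>\<^bsub>C\<^esub> f k) (\<lambda>k. Ident C (tm X k)) \<and>
      homotopic C N Y Y (\<lambda>k. f k \<cdot>\<^bsub>C\<^esub> g k) (\<lambda>k. Ident C (tm Y k)))"

definition zero_complex :: "('o, 'm) cat \<Rightarrow> nat \<Rightarrow> ('o, 'm) cpx" where
  "zero_complex C N =
    \<lparr>tm = (\<lambda>k\<in>{0..N}. zero_object C),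
     df = (\<lambda>k\<in>{0<..N}. Zero C (zero_object C) (zero_object C))\<rparr>"


section \<open>\<open>n\<close>-exact sequences\<close>

text \<open>
  Exactness of \<open>0 \<rightarrow> C(Y, X\<^sub>n\<^sub>+\<^sub>1) \<rightarrow> \<dots> \<rightarrow> C(Y, X\<^sub>0)\<close> means exactness at \<open>C(Y, X\<^sub>k)\<close> for
  \<open>1 \<le> k \<le> n + 1\<close>, and dually; there is no condition at the last term.
\<close>

definition left_n_exact :: "('o, 'm) cat \<Rightarrow> nat \<Rightarrow> ('o, 'm) cpx \<Rightarrow> bool" where
  "left_n_exact C n X \<longleftrightarrow> is_complex C 0 (n + 1) X \<and>
    (\<forall>Y\<in>Obj C.
      kernel (hom_group C Y (tm X (n + 1))) (hom_group C Y (tm X n)) (\<lambda>h. df X (n + 1) \<cdot>\<^bsub>C\<^esub> h)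
        = {Zero C Y (tm X (n + 1))} \<and>
      (\<forall>k\<in>{1..n}.
        kernel (hom_group C Y (tm X k)) (hom_group C Y (tm X (k - 1))) (\<lambda>h. df X k \<cdot>\<^bsub>C\<^esub> h)
          = (\<lambda>h. df X (k + 1) \<cdot>\<^bsub>C\<^esub> h) ` Hom C Y (tm X (k + 1))))"

definition right_n_exact :: "('o, 'm) cat \<Rightarrow> nat \<Rightarrow> ('o, 'm) cpx \<Rightarrow> bool" where
  "right_n_exact C n X \<longleftrightarrow> is_complex C 0 (n + 1) X \<and>
    (\<forall>Y\<in>Obj C.
      kernel (hom_group C (tm X 0) Y) (hom_group C (tm X 1) Y) (\<lambda>h. h \<cdot>\<^bsub>C\<^esub> df X 1)
        = {Zero C (tm X 0) Y} \<and>
      (\<forall>k\<in>{1..n}.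
        kernel (hom_group C (tm X k) Y) (hom_group C (tm X (k + 1)) Y) (\<lambda>h. h \<cdot>\<^bsub>C\<^esub> df X (k + 1))
          = (\<lambda>h. h \<cdot>\<^bsub>C\<^esub> df X k) ` Hom C (tm X (k - 1)) Y))"

definition n_exact :: "('o, 'm) cat \<Rightarrow> nat \<Rightarrow> ('o, 'm) cpx \<Rightarrow> bool" where
  "n_exact C n X \<longleftrightarrow> left_n_exact C n X \<and> right_n_exact C n X"

definition inflations :: "nat \<Rightarrow> ('o, 'm) cpx set \<Rightarrow> 'm set" where
  "inflations n \<X> = (\<lambda>X. df X (n + 1)) ` \<X>"

definition deflations :: "('o, 'm) cpx set \<Rightarrow> 'm set" where
  "deflations \<X> = (\<lambda>X. df X 1) ` \<X>"

definition closed_under_composition :: "('o, 'm) cat \<Rightarrow> 'm set \<Rightarrow> bool" where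
  "closed_under_composition C M \<longleftrightarrow>
    (\<forall>f\<in>M. \<forall>g\<in>M. Cod C f = Dom C g \<longrightarrow> g \<cdot>\<^bsub>C\<^esub> f \<in> M)"


section \<open>\<open>n\<close>-exact structures via homotopy equivalences\<close>

definition axiom_Ex2 :: "('o, 'm) cat \<Rightarrow> nat \<Rightarrow> ('o, 'm) cpx set \<Rightarrow> bool" where
  "axiom_Ex2 C n \<X> \<longleftrightarrow>
    (\<forall>dX\<in>inflations n \<X>. \<forall>f\<in>Arr C. Dom C f = Dom C dX \<longrightarrow>
      col C (Neg C dX) f \<in> inflations n \<X> \<and>
      (\<exists>Yn\<in>Obj C. \<exists>f'\<in>Hom C (Cod C dX) Yn. \<exists>dY\<in>Hom C (Cod C f) Yn.
        is_weak_cokernel C (col C (Neg C dX) f) (row C f' dY) \<and> dY \<in> inflations n \<X>))"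

definition axiom_Ex2_op :: "('o, 'm) cat \<Rightarrow> ('o, 'm) cpx set \<Rightarrow> bool" where
  "axiom_Ex2_op C \<X> \<longleftrightarrow>
    (\<forall>dX\<in>deflations \<X>. \<forall>f\<in>Arr C. Cod C f = Cod C dX \<longrightarrow>
      row C (Neg C dX) f \<in> deflations \<X> \<and>
      (\<exists>Y1\<in>Obj C. \<exists>f'\<in>Hom C Y1 (Dom C dX). \<exists>dY\<in>Hom C Y1 (Dom C f).
        is_weak_kernel C (row C (Neg C dX) f) (col C f' dY) \<and> dY \<in> deflations \<X>))"

definition n_exact_structure_H :: "('o, 'm) cat \<Rightarrow> nat \<Rightarrow> ('o, 'm) cpx set \<Rightarrow> bool" where
  "n_exact_structure_H C n \<X> \<longleftrightarrow>
    (\<forall>X\<in>\<X>. \<forall>Y. is_complex C 0 (n + 1) Y \<and> homotopy_equivalent C (n + 1) X Y \<longrightarrow> Y \<in> \<X>) \<and>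
    zero_complex C (n + 1) \<in> \<X> \<and>
    closed_under_composition C (inflations n \<X>) \<and>
    closed_under_composition C (deflations \<X>) \<and>
    axiom_Ex2 C n \<X> \<and>
    axiom_Ex2_op C \<X>"


section \<open>\<open>n\<close>-exact structures in the sense of Jasso\<close>

definition is_weak_isomorphism ::
  "('o, 'm) cat \<Rightarrow> nat \<Rightarrow> ('o, 'm) cpx \<Rightarrow> ('o, 'm) cpx \<Rightarrow> (nat \<Rightarrow> 'm) \<Rightarrow> bool" where
  "is_weak_isomorphism C n Y X f \<longleftrightarrow>
    n_exact C n Y \<and> n_exact C n X \<and> is_cpx_morphism C 0 (n + 1) Y X f \<and>
    ((\<exists>k\<le>n. is_iso C (f k) \<and> is_iso C (f (k + 1))) \<or> is_iso C (f 0) \<and> is_iso C (f (n + 1)))"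

text \<open>
  The mapping cone of \<open>f\<close> between complexes in degrees \<open>1, \<dots>, n + 1\<close>, with
  \<open>X\<^sub>n\<^sub>+\<^sub>1\<close> in degree \<open>n + 1\<close>, \<open>X\<^sub>k \<oplus> Y\<^sub>k\<^sub>+\<^sub>1\<close> in degrees \<open>1 \<le> k \<le> n\<close> and \<open>Y\<^sub>1\<close> in degree 0.
\<close>

definition pushout_cone ::
  "('o, 'm) cat \<Rightarrow> nat \<Rightarrow> ('o, 'm) cpx \<Rightarrow> ('o, 'm) cpx \<Rightarrow> (nat \<Rightarrow> 'm) \<Rightarrow> ('o, 'm) cpx" where
  "pushout_cone C n X Y f =
    \<lparr>tm = (\<lambda>k\<in>{0..n + 1}.
       if k = n + 1 then tm X (n + 1)
       else if k = 0 then tm Y 1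
       else dsum C (tm X k) (tm Y (k + 1))),
     df = (\<lambda>k\<in>{0<..n + 1}.
       if k = n + 1 then col C (Neg C (df X (n + 1))) (f (n + 1))
       else if k = 1 then row C (f 1) (df Y 2)
       else mat22 C (Neg C (df X k)) (Zero C (tm Y (k + 1)) (tm X (k - 1)))
                    (f k)            (df Y (k + 1)))\<rparr>"

definition is_n_pushout ::
  "('o, 'm) cat \<Rightarrow> nat \<Rightarrow> ('o, 'm) cpx \<Rightarrow> ('o, 'm) cpx \<Rightarrow> (nat \<Rightarrow> 'm) \<Rightarrow> bool" where
  "is_n_pushout C n X Y f \<longleftrightarrow>
    is_complex C 1 (n + 1) Y \<and> is_cpx_morphism C 1 (n + 1) X Y f \<and>
    right_n_exact C n (pushout_cone C n X Y f)"

text \<open>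
  Dually, the mapping cone of \<open>f\<close> from \<open>Y\<close> to \<open>X\<close> between complexes in degrees \<open>0, \<dots>, n\<close>, with
  \<open>Y\<^sub>n\<close> in degree \<open>n + 1\<close>, \<open>X\<^sub>k \<oplus> Y\<^sub>k\<^sub>-\<^sub>1\<close> in degrees \<open>1 \<le> k \<le> n\<close> and \<open>X\<^sub>0\<close> in degree 0.
\<close>

definition pullback_cone ::
  "('o, 'm) cat \<Rightarrow> nat \<Rightarrow> ('o, 'm) cpx \<Rightarrow> ('o, 'm) cpx \<Rightarrow> (nat \<Rightarrow> 'm) \<Rightarrow> ('o, 'm) cpx" where
  "pullback_cone C n Y X f =
    \<lparr>tm = (\<lambda>k\<in>{0..n + 1}.
       if k = n + 1 then tm Y n
       else if k = 0 then tm X 0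
       else dsum C (tm X k) (tm Y (k - 1))),
     df = (\<lambda>k\<in>{0<..n + 1}.
       if k = n + 1 then col C (f n) (df Y n)
       else if k = 1 then row C (Neg C (df X 1)) (f 0)
       else mat22 C (Neg C (df X k))                      (f (k - 1))
                    (Zero C (tm X k) (tm Y (k - 2)))      (df Y (k - 1)))\<rparr>"

definition is_n_pullback ::
  "('o, 'm) cat \<Rightarrow> nat \<Rightarrow> ('o, 'm) cpx \<Rightarrow> ('o, 'm) cpx \<Rightarrow> (nat \<Rightarrow> 'm) \<Rightarrow> bool" where
  "is_n_pullback C n Y X f \<longleftrightarrow>
    is_complex C 0 n Y \<and> is_cpx_morphism C 0 n Y X f \<and>
    left_n_exact C n (pullback_cone C n Y X f)"

definition axiom_E2 :: "('o, 'm) cat \<Rightarrow> nat \<Rightarrow> ('o, 'm) cpx set \<Rightarrow> bool" where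
  "axiom_E2 C n \<X> \<longleftrightarrow>
    (\<forall>X\<in>\<X>. \<forall>g\<in>Arr C. Dom C g = tm X (n + 1) \<longrightarrow>
      (\<exists>Y f. f (n + 1) = g \<and> is_n_pushout C n X Y f \<and> df Y (n + 1) \<in> inflations n \<X>))"

definition axiom_E2_op :: "('o, 'm) cat \<Rightarrow> nat \<Rightarrow> ('o, 'm) cpx set \<Rightarrow> bool" where
  "axiom_E2_op C n \<X> \<longleftrightarrow>
    (\<forall>X\<in>\<X>. \<forall>g\<in>Arr C. Cod C g = tm X 0 \<longrightarrow>
      (\<exists>Y f. f 0 = g \<and> is_n_pullback C n Y X f \<and> df Y 1 \<in> deflations \<X>))"

definition n_exact_structure_J :: "('o, 'm) cat \<Rightarrow> nat \<Rightarrow> ('o, 'm) cpx set \<Rightarrow> bool" where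
  "n_exact_structure_J C n \<X> \<longleftrightarrow>
    (\<forall>X Y f. is_weak_isomorphism C n Y X f \<longrightarrow> (X \<in> \<X> \<longleftrightarrow> Y \<in> \<X>)) \<and>
    zero_complex C (n + 1) \<in> \<X> \<and>
    closed_under_composition C (inflations n \<X>) \<and>
    closed_under_composition C (deflations \<X>) \<and>
    axiom_E2 C n \<X> \<and>
    axiom_E2_op C n \<X>"

end

theory Submission
  imports Defs
begin

text \<open>
  Both definitions are equivalent to a third, elementary and self-dual one: closure under homotopy
  equivalence and composition, together with the existence, for a deflation \<open>d\<close> and a morphism \<open>g\<close>
  with the same target, of some commutative square \<open>d p = g q\<close> with \<open>q\<close> a deflation, and dually.

  Homotopy equivalence allows adding contractible summands, so that \<open>[v  p]\<close> is a deflation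
  whenever \<open>v\<close> is; as idempotents split, it follows that \<open>p\<close> is a deflation if \<open>p q\<close> is one.
  Since left \<open>n\<close>-exact sequences with isomorphic last morphisms are homotopy equivalent, this gives
  closure under weak isomorphisms.  If \<open>Z\<close> is a conflation ending in \<open>[-d\<^sub>1  g]\<close>, the
  \<open>n\<close>-pullback of \<open>X\<close> along \<open>g\<close> has the terms \<open>Z\<^sub>2\<close> in degree 1 and
  \<open>Z\<^sub>k\<^sub>+\<^sub>1 \<oplus> X\<^sub>k\<close> in the degrees \<open>k \<ge> 2\<close>.

  Conversely, under Definition J contractible summands can be added and removed, since this is a
  weak isomorphism for \<open>n \<ge> 2\<close> and a strict pullback or pushout for \<open>n = 1\<close>.  If \<open>Y\<close> is homotopy
  equivalent to a conflation \<open>X\<close>, pulling back the last morphism of \<open>X\<close> along \<open>Y\<^sub>0 \<rightarrow> X\<^sub>0\<close> gives a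
  deflation that factors through the last morphism of \<open>Y\<close>, which is therefore a deflation as well.
\<close>

section \<open>Calculus in preadditive categories\<close>

text \<open>The obstacle is that exactness yields factorizations, not deflations: lifting through a
  differential shows that a known deflation \<open>q\<close> has the form \<open>p u\<close>, while
  the conclusion wanted concerns \<open>p\<close>. Cancelling \<open>u\<close>, as in Quillen's
  obscure axiom, bridges this gap each time, and it is the reason why a bare commutative square can
  replace the weak kernels and mapping cones of the two definitions. The row \<open>[v p]\<close>
  from which cancellation starts is the composite of the sum of \<open>v\<close> and an identity
  with the row \<open>[1 p]\<close>, and \<open>[1 p]\<close> is a projection \<open>[1 0]\<close>
  seen through an elementary change of coordinates. Duality is delicate because direct sums are
  chosen: the choice made in the opposite category is unrelated to the one made in the category
  itself. Constructions that are to be dualised are therefore carried out for arbitrary biproduct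
  diagrams and specialised to the chosen ones at the end.\<close>

locale pcat = preadditive_category C for C :: "('o, 'm) cat" (structure)

locale icat = idempotent_complete_additive_category C for C :: "('o, 'm) cat" (structure)

sublocale icat \<subseteq> pcat by unfold_locales

context pcat
begin

text \<open>Membership in \<open>Hom\<close> is broken up into facts about \<open>Arr\<close>,
  \<open>Dom\<close> and \<open>Cod\<close>, so that typing side conditions become plain
  rewriting.\<close>

lemma Hom_iff [simp]: "f \<in> Hom C A B \<longleftrightarrow> f \<in> Arr C \<and> Dom C f = A \<and> Cod C f = B"
  by (auto simp: Hom_def)

lemma dom_obj [simp]: "f \<in> Arr C \<Longrightarrow> Dom C f \<in> Obj C" by (rule Dom_in_Obj)
lemma cod_obj [simp]: "f \<in> Arr C \<Longrightarrow> Cod C f \<in> Obj C" by (rule Cod_in_Obj)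

lemma ident_typing [simp]:
  "A \<in> Obj C \<Longrightarrow> Ident C A \<in> Arr C"
  "A \<in> Obj C \<Longrightarrow> Dom C (Ident C A) = A"
  "A \<in> Obj C \<Longrightarrow> Cod C (Ident C A) = A"
  using Ident_in_Hom[of A] by auto

lemma comp_typing [simp]:
  assumes "f \<in> Arr C" "g \<in> Arr C" "Dom C g = Cod C f"
  shows "g \<cdot> f \<in> Arr C" "Dom C (g \<cdot> f) = Dom C f" "Cod C (g \<cdot> f) = Cod C g"
  using Comp_in_Hom[of f "Dom C f" "Cod C f" g "Cod C g"] assms by auto

lemma comp_assoc [simp]:
  assumes "f \<in> Arr C" "g \<in> Arr C" "h \<in> Arr C" "Dom C g = Cod C f" "Dom C h = Cod C g"
  shows "h \<cdot> g \<cdot> f = h \<cdot> (g \<cdot> f)"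
  using Comp_assoc[of f "Dom C f" "Cod C f" g "Cod C g" h "Cod C h"] assms by auto

lemma comp_ident [simp]:
  "f \<in> Arr C \<Longrightarrow> Dom C f = A \<Longrightarrow> f \<cdot> Ident C A = f"
  "f \<in> Arr C \<Longrightarrow> Cod C f = A \<Longrightarrow> Ident C A \<cdot> f = f"
  using Comp_Ident_right[of f] Comp_Ident_left[of f] by auto

lemma comp_ident_left [simp]:
  "f \<in> Arr C \<Longrightarrow> Cod C f = A \<Longrightarrow> Ident C A \<cdot> (f \<cdot> g) = f \<cdot> g" if
  "g \<in> Arr C" "Dom C f = Cod C g"
  using that by simp

text \<open>Composites are normalised to nest to the right, so an equation for a composite of two
  arrows no longer matches once a third arrow is applied first. This rule supplies the missing
  version, which recurs below in the facts with an extra argument \<open>x\<close>.\<close>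

lemma comp_eq_reassoc:
  assumes "g \<cdot> f = k" "x \<in> Arr C" "f \<in> Arr C" "g \<in> Arr C" "Dom C f = Cod C x" "Dom C g = Cod C f"
  shows "g \<cdot> (f \<cdot> x) = k \<cdot> x"
  using assms comp_assoc by metis

lemma add_typing [simp]:
  assumes "f \<in> Arr C" "g \<in> Arr C" "Dom C g = Dom C f" "Cod C g = Cod C f"
  shows "f \<boxplus> g \<in> Arr C" "Dom C (f \<boxplus> g) = Dom C f" "Cod C (f \<boxplus> g) = Cod C f"
proof -
  interpret G: comm_group "hom_group C (Dom C f) (Cod C f)"
    using assms by (intro comm_group_hom) auto
  show "f \<boxplus> g \<in> Arr C" "Dom C (f \<boxplus> g) = Dom C f" "Cod C (f \<boxplus> g) = Cod C f"
    using G.m_closed[of f g] assms by (auto simp: hom_group_def)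
qed

lemma zero_typing [simp]:
  assumes "A \<in> Obj C" "B \<in> Obj C"
  shows "Zero C A B \<in> Arr C" "Dom C (Zero C A B) = A" "Cod C (Zero C A B) = B"
proof -
  interpret G: comm_group "hom_group C A B" using assms by (rule comm_group_hom)
  show "Zero C A B \<in> Arr C" "Dom C (Zero C A B) = A" "Cod C (Zero C A B) = B"
    using G.one_closed by (auto simp: hom_group_def)
qed

lemma add_assoc [simp]:
  assumes "f \<in> Arr C" "g \<in> Arr C" "h \<in> Arr C"
    "Dom C g = Dom C f" "Cod C g = Cod C f" "Dom C h = Dom C f" "Cod C h = Cod C f"
  shows "(f \<boxplus> g) \<boxplus> h = f \<boxplus> (g \<boxplus> h)"
proof -
  interpret G: comm_group "hom_group C (Dom C f) (Cod C f)"
    using assms by (intro comm_group_hom) auto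
  show ?thesis using G.m_assoc[of f g h] assms by (auto simp: hom_group_def)
qed

lemma add_comm:
  assumes "f \<in> Arr C" "g \<in> Arr C" "Dom C g = Dom C f" "Cod C g = Cod C f"
  shows "f \<boxplus> g = g \<boxplus> f"
proof -
  interpret G: comm_group "hom_group C (Dom C f) (Cod C f)"
    using assms by (intro comm_group_hom) auto
  show ?thesis using G.m_comm[of f g] assms by (auto simp: hom_group_def)
qed

lemma add_left_comm:
  assumes "f \<in> Arr C" "g \<in> Arr C" "h \<in> Arr C"
    "Dom C g = Dom C f" "Cod C g = Cod C f" "Dom C h = Dom C f" "Cod C h = Cod C f"
  shows "f \<boxplus> (g \<boxplus> h) = g \<boxplus> (f \<boxplus> h)"
  using assms add_assoc[of f g h] add_assoc[of g f h] add_comm[of f g] by simp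

lemmas add_ac = add_comm add_left_comm

lemma add_zero [simp]:
  assumes "f \<in> Arr C" "Dom C f = A" "Cod C f = B"
  shows "f \<boxplus> Zero C A B = f" "Zero C A B \<boxplus> f = f"
proof -
  interpret G: comm_group "hom_group C (Dom C f) (Cod C f)"
    using assms by (intro comm_group_hom) auto
  show "f \<boxplus> Zero C A B = f" "Zero C A B \<boxplus> f = f"
    using G.r_one[of f] G.l_one[of f] assms by (auto simp: hom_group_def)
qed

lemma neg_typing [simp]:
  assumes "f \<in> Arr C"
  shows "Neg C f \<in> Arr C" "Dom C (Neg C f) = Dom C f" "Cod C (Neg C f) = Cod C f"
proof -
  interpret G: comm_group "hom_group C (Dom C f) (Cod C f)"
    using assms by (intro comm_group_hom) auto
  have "Neg C f \<in> Hom C (Dom C f) (Cod C f)"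
    using G.inv_closed[of f] assms by (simp add: hom_group_def Neg_def)
  then show "Neg C f \<in> Arr C" "Dom C (Neg C f) = Dom C f" "Cod C (Neg C f) = Cod C f"
    by auto
qed

lemma add_neg [simp]:
  assumes "f \<in> Arr C"
  shows "f \<boxplus> Neg C f = Zero C (Dom C f) (Cod C f)" "Neg C f \<boxplus> f = Zero C (Dom C f) (Cod C f)"
proof -
  interpret G: comm_group "hom_group C (Dom C f) (Cod C f)"
    using assms by (intro comm_group_hom) auto
  show "f \<boxplus> Neg C f = Zero C (Dom C f) (Cod C f)" "Neg C f \<boxplus> f = Zero C (Dom C f) (Cod C f)"
    using G.r_inv[of f] G.l_inv[of f] assms by (auto simp: hom_group_def Neg_def)
qed

lemma add_neg_cancel [simp]:
  assumes "f \<in> Arr C" "g \<in> Arr C" "Dom C g = Dom C f" "Cod C g = Cod C f"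
  shows "f \<boxplus> (Neg C f \<boxplus> g) = g" "Neg C f \<boxplus> (f \<boxplus> g) = g"
  using assms add_assoc[of f "Neg C f" g] add_assoc[of "Neg C f" f g] by simp_all

lemma add_left_cancel:
  assumes "f \<in> Arr C" "g \<in> Arr C" "h \<in> Arr C"
    "Dom C g = Dom C f" "Cod C g = Cod C f" "Dom C h = Dom C f" "Cod C h = Cod C f"
  shows "f \<boxplus> g = f \<boxplus> h \<longleftrightarrow> g = h"
  using assms add_neg_cancel(2)[of f g] add_neg_cancel(2)[of f h] by metis

lemma neg_unique:
  assumes "f \<in> Arr C" "g \<in> Arr C" "Dom C g = Dom C f" "Cod C g = Cod C f"
    "f \<boxplus> g = Zero C (Dom C f) (Cod C f)"
  shows "g = Neg C f"
  using assms add_left_cancel[of f g "Neg C f"] by simp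

lemma neg_neg [simp]: "f \<in> Arr C \<Longrightarrow> Neg C (Neg C f) = f"
  using neg_unique[of "Neg C f" f] by simp

lemma neg_zero [simp]: "A \<in> Obj C \<Longrightarrow> B \<in> Obj C \<Longrightarrow> Neg C (Zero C A B) = Zero C A B"
  using neg_unique[of "Zero C A B" "Zero C A B"] by simp

lemma neg_add [simp]:
  assumes "f \<in> Arr C" "g \<in> Arr C" "Dom C g = Dom C f" "Cod C g = Cod C f"
  shows "Neg C (f \<boxplus> g) = Neg C f \<boxplus> Neg C g"
proof -
  have "(f \<boxplus> g) \<boxplus> (Neg C f \<boxplus> Neg C g) = Zero C (Dom C f) (Cod C f)"
    using assms by (simp add: add_left_comm[of g "Neg C f"])
  then show ?thesis using neg_unique[of "f \<boxplus> g" "Neg C f \<boxplus> Neg C g"] assms by simp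
qed

lemma neg_inj: "f \<in> Arr C \<Longrightarrow> g \<in> Arr C \<Longrightarrow> Neg C f = Neg C g \<longleftrightarrow> f = g"
  using neg_neg by metis

lemma comp_add [simp]:
  assumes "f \<in> Arr C" "f' \<in> Arr C" "g \<in> Arr C" "Dom C f' = Dom C f" "Cod C f' = Cod C f"
    "Dom C g = Cod C f"
  shows "g \<cdot> (f \<boxplus> f') = g \<cdot> f \<boxplus> g \<cdot> f'"
  using assms Comp_Add_right[of f "Dom C f" "Cod C f" f' g "Cod C g"] by simp

lemma add_comp [simp]:
  assumes "f \<in> Arr C" "g' \<in> Arr C" "g \<in> Arr C" "Dom C g' = Dom C g" "Cod C g' = Cod C g"
    "Dom C g = Cod C f"
  shows "(g \<boxplus> g') \<cdot> f = g \<cdot> f \<boxplus> g' \<cdot> f"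
  using assms Comp_Add_left[of f "Dom C f" "Cod C f" g "Cod C g" g'] by simp

lemma add_idem_zero:
  assumes "f \<in> Arr C" "f \<boxplus> f = f" shows "f = Zero C (Dom C f) (Cod C f)"
  using assms add_left_cancel[of f f "Zero C (Dom C f) (Cod C f)"] by simp

lemma comp_zero [simp]:
  assumes "g \<in> Arr C" "Dom C g = B" "A \<in> Obj C"
  shows "g \<cdot> Zero C A B = Zero C A (Cod C g)"
proof -
  have B: "B \<in> Obj C" using assms dom_obj[of g] by simp
  have "g \<cdot> (Zero C A B \<boxplus> Zero C A B) = g \<cdot> Zero C A B \<boxplus> g \<cdot> Zero C A B"
    using assms B by (intro comp_add) auto
  then have "g \<cdot> Zero C A B \<boxplus> g \<cdot> Zero C A B = g \<cdot> Zero C A B" using assms B by simp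
  from add_idem_zero[OF _ this] show ?thesis using assms B by simp
qed

lemma zero_comp [simp]:
  assumes "f \<in> Arr C" "Cod C f = B" "D \<in> Obj C"
  shows "Zero C B D \<cdot> f = Zero C (Dom C f) D"
proof -
  have B: "B \<in> Obj C" using assms cod_obj[of f] by simp
  have "(Zero C B D \<boxplus> Zero C B D) \<cdot> f = Zero C B D \<cdot> f \<boxplus> Zero C B D \<cdot> f"
    using assms B by (intro add_comp) auto
  then have "Zero C B D \<cdot> f \<boxplus> Zero C B D \<cdot> f = Zero C B D \<cdot> f" using assms B by simp
  from add_idem_zero[OF _ this] show ?thesis using assms B by simp
qed

lemma comp_neg [simp]:
  assumes "f \<in> Arr C" "g \<in> Arr C" "Dom C g = Cod C f"
  shows "g \<cdot> Neg C f = Neg C (g \<cdot> f)"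
proof (rule neg_unique)
  have "g \<cdot> f \<boxplus> g \<cdot> Neg C f = g \<cdot> (f \<boxplus> Neg C f)" by (subst comp_add) (use assms in auto)
  then show "g \<cdot> f \<boxplus> g \<cdot> Neg C f = Zero C (Dom C (g \<cdot> f)) (Cod C (g \<cdot> f))"
    using assms by simp
qed (use assms in auto)

lemma neg_comp [simp]:
  assumes "f \<in> Arr C" "g \<in> Arr C" "Dom C g = Cod C f"
  shows "Neg C g \<cdot> f = Neg C (g \<cdot> f)"
proof (rule neg_unique)
  have "g \<cdot> f \<boxplus> Neg C g \<cdot> f = (g \<boxplus> Neg C g) \<cdot> f" by (subst add_comp) (use assms in auto)
  then show "g \<cdot> f \<boxplus> Neg C g \<cdot> f = Zero C (Dom C (g \<cdot> f)) (Cod C (g \<cdot> f))"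
    using assms by simp
qed (use assms in auto)

lemma diff_eq_zero_iff:
  assumes "f \<in> Arr C" "g \<in> Arr C" "Dom C g = Dom C f" "Cod C g = Cod C f"
  shows "f \<boxplus> Neg C g = Zero C (Dom C f) (Cod C f) \<longleftrightarrow> f = g"
proof
  assume "f \<boxplus> Neg C g = Zero C (Dom C f) (Cod C f)"
  then have "Neg C g = Neg C f" using neg_unique[of f "Neg C g"] assms by simp
  then show "f = g" using neg_inj assms by metis
qed (use assms in auto)

end

section \<open>Duality\<close>

definition opc :: "('o, 'm) cat \<Rightarrow> ('o, 'm) cat" where
  "opc C = \<lparr>Obj = Obj C, Arr = Arr C, Dom = Cod C, Cod = Dom C, Ident = Ident C,
     Comp = (\<lambda>g f. f \<cdot>\<^bsub>C\<^esub> g), Add = Add C, Zero = (\<lambda>A B. Zero C B A)\<rparr>"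

lemma opc_simps [simp]:
  "Obj (opc C) = Obj C" "Arr (opc C) = Arr C" "Dom (opc C) = Cod C" "Cod (opc C) = Dom C"
  "Ident (opc C) = Ident C" "g \<cdot>\<^bsub>opc C\<^esub> f = f \<cdot>\<^bsub>C\<^esub> g" "Add (opc C) = Add C"
  "Zero (opc C) A B = Zero C B A"
  by (simp_all add: opc_def)

lemma opc_opc [simp]: "opc (opc C) = C"
  by (simp add: opc_def)

lemma Hom_opc: "Hom (opc C) A B = Hom C B A"
  by (auto simp: Hom_def)

lemma hom_group_opc: "hom_group (opc C) A B = hom_group C B A"
  by (simp add: hom_group_def Hom_opc)

lemma Neg_opc [simp]: "Neg (opc C) = Neg C"
  by (rule ext) (simp add: Neg_def hom_group_opc)

lemma is_zero_object_opc: "is_zero_object (opc C) = is_zero_object C"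
  by (rule ext) (auto simp: is_zero_object_def Hom_opc)

lemma zero_object_opc [simp]: "zero_object (opc C) = zero_object C"
  by (simp add: zero_object_def is_zero_object_opc)

text \<open>Needed because \<open>biprod\<close> is a choice: nothing relates the biproduct chosen
  in \<open>opc C\<close> to the one chosen in \<open>C\<close>, whereas the reversed diagram always
  is a biproduct in \<open>opc C\<close>.\<close>

definition opb :: "('o, 'm) biproduct \<Rightarrow> ('o, 'm) biproduct" where
  "opb S = \<lparr>vertex = vertex S, in1 = pr1 S, in2 = pr2 S, pr1 = in1 S, pr2 = in2 S\<rparr>"

lemma opb_simps [simp]:
  "vertex (opb S) = vertex S" "in1 (opb S) = pr1 S" "in2 (opb S) = pr2 S"
  "pr1 (opb S) = in1 S" "pr2 (opb S) = in2 S"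
  by (simp_all add: opb_def)

lemma is_biproduct_opc: "is_biproduct C A B S \<Longrightarrow> is_biproduct (opc C) A B (opb S)"
  by (simp add: is_biproduct_def Hom_opc)

lemma (in pcat) pcat_opc: "pcat (opc C)"
proof (intro pcat.intro preadditive_category.intro category.intro
    preadditive_category_axioms.intro, goal_cases)
  case (8 A B)
  then show ?case using comm_group_hom[of B A] by (simp add: hom_group_opc)
qed (auto simp: Hom_opc)

lemma (in icat) icat_opc: "icat (opc C)"
proof -
  have "additive_category (opc C)"
  proof (intro additive_category.intro additive_category_axioms.intro)
    show "preadditive_category (opc C)" using pcat_opc by (rule pcat.axioms)
    show "\<exists>Z. is_zero_object (opc C) Z" using ex_zero_object by (simp add: is_zero_object_opc)
    show "\<exists>S. is_biproduct (opc C) A B S" if "A \<in> Obj (opc C)" "B \<in> Obj (opc C)" for A B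
    proof -
      from that obtain S where "is_biproduct C A B S" using ex_biproduct by auto
      from is_biproduct_opc[OF this] show ?thesis by blast
    qed
  qed
  moreover have "\<exists>B\<in>Obj (opc C). \<exists>r\<in>Hom (opc C) A B. \<exists>s\<in>Hom (opc C) B A.
      r \<cdot>\<^bsub>opc C\<^esub> s = Ident (opc C) B \<and> s \<cdot>\<^bsub>opc C\<^esub> r = e"
    if e: "A \<in> Obj (opc C)" "e \<in> Hom (opc C) A A" "e \<cdot>\<^bsub>opc C\<^esub> e = e" for A e
  proof -
    obtain B r s where "B \<in> Obj C" "r \<in> Hom C A B" "s \<in> Hom C B A"
      "r \<cdot> s = Ident C B" "s \<cdot> r = e"
      using idempotents_split[of A e] e unfolding Hom_opc opc_simps by blast
    then show ?thesis unfolding Hom_opc opc_simps by blast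
  qed
  ultimately show ?thesis
    by (intro icat.intro idempotent_complete_additive_category.intro
        idempotent_complete_additive_category_axioms.intro)
qed

section \<open>Complexes\<close>

text \<open>Indexing by \<open>Suc\<close> removes the truncated \<open>k - 1\<close>, and
  extensionality of the function spaces becomes explicit equations with
  \<open>undefined\<close>.\<close>

lemma is_complex_iff:
  "is_complex C 0 N X \<longleftrightarrow>
    (\<forall>k\<le>N. tm X k \<in> Obj C) \<and> (\<forall>k>N. tm X k = undefined) \<and>
    (\<forall>k<N. df X (Suc k) \<in> Hom C (tm X (Suc k)) (tm X k)) \<and>
    (\<forall>k. k = 0 \<or> k > N \<longrightarrow> df X k = undefined) \<and>
    (\<forall>k. Suc k < N \<longrightarrow>
      df X (Suc k) \<cdot>\<^bsub>C\<^esub> df X (Suc (Suc k)) = Zero C (tm X (Suc (Suc k))) (tm X k))"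
    (is "?L \<longleftrightarrow> ?A \<and> ?B \<and> ?D \<and> ?E \<and> ?F")
proof
  assume L: ?L
  show "?A \<and> ?B \<and> ?D \<and> ?E \<and> ?F"
  proof (intro conjI)
    show ?A using L by (auto simp: is_complex_def PiE_iff)
    show ?B using L by (auto simp: is_complex_def PiE_iff extensional_def)
    show ?D
    proof (intro allI impI)
      fix k assume "k < N"
      then have "Suc k \<in> {0<..N}" by auto
      then have "df X (Suc k) \<in> Hom C (tm X (Suc k)) (tm X (Suc k - 1))"
        using L unfolding is_complex_def PiE_iff by blast
      then show "df X (Suc k) \<in> Hom C (tm X (Suc k)) (tm X k)" by simp
    qed
    show ?E using L by (auto simp: is_complex_def PiE_iff extensional_def)
    show ?F
    proof (intro allI impI)
      fix k assume "Suc k < N"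
      then have "0 < Suc k \<and> Suc k < N" by auto
      with L have "df X (Suc k) \<cdot>\<^bsub>C\<^esub> df X (Suc k + 1) = Zero C (tm X (Suc k + 1)) (tm X (Suc k - 1))"
        unfolding is_complex_def by blast
      then show "df X (Suc k) \<cdot>\<^bsub>C\<^esub> df X (Suc (Suc k)) = Zero C (tm X (Suc (Suc k))) (tm X k)"
        by simp
    qed
  qed
next
  assume R: "?A \<and> ?B \<and> ?D \<and> ?E \<and> ?F"
  have 1: "df X k \<in> Hom C (tm X k) (tm X (k - 1))" if "k \<in> {0<..N}" for k
    using R that by (cases k) (auto simp: Suc_le_eq)
  have 2: "df X k \<cdot>\<^bsub>C\<^esub> df X (k + 1) = Zero C (tm X (k + 1)) (tm X (k - 1))" if "0 < k \<and> k < N" for k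
    using R that by (cases k) auto
  have "tm X \<in> {0..N} \<rightarrow>\<^sub>E Obj C"
    using R unfolding PiE_iff extensional_def by simp
  moreover have "df X \<in> (\<Pi>\<^sub>E k\<in>{0<..N}. Hom C (tm X k) (tm X (k - 1)))"
    using R 1 unfolding PiE_iff extensional_def by (auto simp del: One_nat_def)
  ultimately show ?L unfolding is_complex_def using 2 by blast
qed

lemma is_cpx_morphism_iff:
  "is_cpx_morphism C 0 N X Y f \<longleftrightarrow>
    (\<forall>k\<le>N. f k \<in> Hom C (tm X k) (tm Y k)) \<and>
    (\<forall>k<N. f k \<cdot>\<^bsub>C\<^esub> df X (Suc k) = df Y (Suc k) \<cdot>\<^bsub>C\<^esub> f (Suc k))"
proof -
  have "(\<forall>k\<in>{0<..N}. f (k - 1) \<cdot>\<^bsub>C\<^esub> df X k = df Y k \<cdot>\<^bsub>C\<^esub> f k) \<longleftrightarrow>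
    (\<forall>k<N. f k \<cdot>\<^bsub>C\<^esub> df X (Suc k) = df Y (Suc k) \<cdot>\<^bsub>C\<^esub> f (Suc k))" (is "?l = ?r")
  proof
    assume l: ?l
    show ?r
    proof (intro allI impI)
      fix k assume "k < N"
      then have "Suc k \<in> {0<..N}" by auto
      with l have "f (Suc k - 1) \<cdot>\<^bsub>C\<^esub> df X (Suc k) = df Y (Suc k) \<cdot>\<^bsub>C\<^esub> f (Suc k)" by blast
      then show "f k \<cdot>\<^bsub>C\<^esub> df X (Suc k) = df Y (Suc k) \<cdot>\<^bsub>C\<^esub> f (Suc k)" by simp
    qed
  next
    assume r: ?r
    show ?l
    proof
      fix k assume k: "k \<in> {0<..N}"
      then show "f (k - 1) \<cdot>\<^bsub>C\<^esub> df X k = df Y k \<cdot>\<^bsub>C\<^esub> f k" using r by (cases k) auto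
    qed
  qed
  then show ?thesis unfolding is_cpx_morphism_def by auto
qed

context pcat
begin

lemma cpxD:
  assumes "is_complex C 0 N X"
  shows "\<And>k. k \<le> N \<Longrightarrow> tm X k \<in> Obj C"
    "\<And>k. k < N \<Longrightarrow> df X (Suc k) \<in> Arr C"
    "\<And>k. k < N \<Longrightarrow> Dom C (df X (Suc k)) = tm X (Suc k)"
    "\<And>k. k < N \<Longrightarrow> Cod C (df X (Suc k)) = tm X k"
    "\<And>k. Suc k < N \<Longrightarrow> df X (Suc k) \<cdot> df X (Suc (Suc k)) = Zero C (tm X (Suc (Suc k))) (tm X k)"
    "\<And>k x. Suc k < N \<Longrightarrow> x \<in> Arr C \<Longrightarrow> Cod C x = tm X (Suc (Suc k)) \<Longrightarrow>
       df X (Suc k) \<cdot> (df X (Suc (Suc k)) \<cdot> x) = Zero C (Dom C x) (tm X k)"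
proof -
  note * = assms[unfolded is_complex_iff Hom_iff]
  show 1: "\<And>k. k \<le> N \<Longrightarrow> tm X k \<in> Obj C"
    and 2: "\<And>k. k < N \<Longrightarrow> df X (Suc k) \<in> Arr C"
    and 3: "\<And>k. k < N \<Longrightarrow> Dom C (df X (Suc k)) = tm X (Suc k)"
    and 4: "\<And>k. k < N \<Longrightarrow> Cod C (df X (Suc k)) = tm X k"
    and 5: "\<And>k. Suc k < N \<Longrightarrow> df X (Suc k) \<cdot> df X (Suc (Suc k)) = Zero C (tm X (Suc (Suc k))) (tm X k)"
    using * by blast+
  show "df X (Suc k) \<cdot> (df X (Suc (Suc k)) \<cdot> x) = Zero C (Dom C x) (tm X k)"
    if "Suc k < N" "x \<in> Arr C" "Cod C x = tm X (Suc (Suc k))" for k x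
    using comp_eq_reassoc[OF 5[OF that(1)], of x] that 1 2 3 4 by simp
qed

lemma morD:
  assumes "is_cpx_morphism C 0 N X Y f"
  shows "\<And>k. k \<le> N \<Longrightarrow> f k \<in> Arr C"
    "\<And>k. k \<le> N \<Longrightarrow> Dom C (f k) = tm X k"
    "\<And>k. k \<le> N \<Longrightarrow> Cod C (f k) = tm Y k"
  using assms by (auto simp: is_cpx_morphism_iff)

lemma mor_comm:
  assumes "is_cpx_morphism C 0 N X Y f" "k < N"
  shows "f k \<cdot> df X (Suc k) = df Y (Suc k) \<cdot> f (Suc k)"
  using assms by (simp add: is_cpx_morphism_iff)

lemma mor_comm_comp:
  assumes "is_complex C 0 N X" "is_complex C 0 N Y" "is_cpx_morphism C 0 N X Y f" "k < N"
    "x \<in> Arr C" "Cod C x = tm X (Suc k)"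
  shows "f k \<cdot> (df X (Suc k) \<cdot> x) = df Y (Suc k) \<cdot> (f (Suc k) \<cdot> x)"
proof -
  note [simp] = cpxD[OF assms(1)] cpxD[OF assms(2)] morD[OF assms(3)]
  show ?thesis using comp_eq_reassoc[OF mor_comm[OF assms(3,4)], of x] assms(4-) by simp
qed

text \<open>Taking the domain of a generalized element \<open>h\<close> as test object replaces the
  Hom groups by statements about single arrows. In a complex images lie in kernels, so exactness
  comes down to lifting \<open>h\<close> and, at the top, to its vanishing.\<close>

lemma left_n_exact_iff:
  "left_n_exact C n X \<longleftrightarrow> is_complex C 0 (Suc n) X \<and>
    (\<forall>h\<in>Arr C. Cod C h = tm X (Suc n) \<and> df X (Suc n) \<cdot> h = Zero C (Dom C h) (tm X n) \<longrightarrow>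
       h = Zero C (Dom C h) (tm X (Suc n))) \<and>
    (\<forall>k<n. \<forall>h\<in>Arr C. Cod C h = tm X (Suc k) \<and> df X (Suc k) \<cdot> h = Zero C (Dom C h) (tm X k) \<longrightarrow>
       (\<exists>u\<in>Hom C (Dom C h) (tm X (Suc (Suc k))). df X (Suc (Suc k)) \<cdot> u = h))"
    (is "_ \<longleftrightarrow> _ \<and> ?T \<and> ?M")
proof (cases "is_complex C 0 (Suc n) X")
  case X: True
  note [simp] = cpxD[OF X]
  have T: "(\<forall>Y\<in>Obj C. kernel (hom_group C Y (tm X (n + 1))) (hom_group C Y (tm X n)) (\<lambda>h. df X (n + 1) \<cdot> h)
        = {Zero C Y (tm X (n + 1))}) \<longleftrightarrow> ?T" (is "?l \<longleftrightarrow> _")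
  proof
    assume l: ?l
    show ?T
    proof (intro ballI impI)
      fix h assume h: "h \<in> Arr C" "Cod C h = tm X (Suc n) \<and> df X (Suc n) \<cdot> h = Zero C (Dom C h) (tm X n)"
      then have "h \<in> kernel (hom_group C (Dom C h) (tm X (n + 1))) (hom_group C (Dom C h) (tm X n)) (\<lambda>h. df X (n + 1) \<cdot> h)"
        by (simp add: kernel_def hom_group_def)
      then show "h = Zero C (Dom C h) (tm X (Suc n))" using l h by auto
    qed
  next
    assume T: ?T
    show ?l
    proof
      fix Y assume "Y \<in> Obj C"
      then show "kernel (hom_group C Y (tm X (n + 1))) (hom_group C Y (tm X n)) (\<lambda>h. df X (n + 1) \<cdot> h)
        = {Zero C Y (tm X (n + 1))}"
        using T by (auto simp: kernel_def hom_group_def)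
    qed
  qed
  have M: "(\<forall>Y\<in>Obj C. \<forall>k\<in>{1..n}.
        kernel (hom_group C Y (tm X k)) (hom_group C Y (tm X (k - 1))) (\<lambda>h. df X k \<cdot> h)
          = (\<lambda>h. df X (k + 1) \<cdot> h) ` Hom C Y (tm X (k + 1))) \<longleftrightarrow> ?M" (is "?l \<longleftrightarrow> _")
  proof
    assume l: ?l
    show ?M
    proof (intro allI ballI impI)
      fix k h assume h: "k < n" "h \<in> Arr C"
        "Cod C h = tm X (Suc k) \<and> df X (Suc k) \<cdot> h = Zero C (Dom C h) (tm X k)"
      then have "h \<in> kernel (hom_group C (Dom C h) (tm X (Suc k))) (hom_group C (Dom C h) (tm X (Suc k - 1))) (\<lambda>h. df X (Suc k) \<cdot> h)"
        by (simp add: kernel_def hom_group_def)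
      moreover have "Suc k \<in> {1..n}" "Dom C h \<in> Obj C" using h by auto
      ultimately have "h \<in> (\<lambda>h. df X (Suc k + 1) \<cdot> h) ` Hom C (Dom C h) (tm X (Suc k + 1))"
        using l by blast
      then show "\<exists>u\<in>Hom C (Dom C h) (tm X (Suc (Suc k))). df X (Suc (Suc k)) \<cdot> u = h"
        by (auto simp del: Hom_iff)
    qed
  next
    assume M: ?M
    show ?l
    proof (intro ballI)
      fix Y k assume Y: "Y \<in> Obj C" and k: "k \<in> {1..n}"
      then obtain j where j: "k = Suc j" "j < n" by (cases k) auto
      show "kernel (hom_group C Y (tm X k)) (hom_group C Y (tm X (k - 1))) (\<lambda>h. df X k \<cdot> h)
          = (\<lambda>h. df X (k + 1) \<cdot> h) ` Hom C Y (tm X (k + 1))" (is "?K = ?I")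
      proof
        show "?K \<subseteq> ?I"
        proof
          fix h assume "h \<in> ?K"
          then have h: "h \<in> Arr C" "Dom C h = Y" "Cod C h = tm X (Suc j)"
             "df X (Suc j) \<cdot> h = Zero C Y (tm X j)"
            by (auto simp: kernel_def hom_group_def j)
          then obtain u where "u \<in> Hom C Y (tm X (Suc (Suc j)))" "df X (Suc (Suc j)) \<cdot> u = h"
            using M j by blast
          then show "h \<in> ?I" by (auto simp: j)
        qed
        show "?I \<subseteq> ?K" using j by (auto simp: kernel_def hom_group_def)
      qed
    qed
  qed
  show ?thesis unfolding left_n_exact_def ball_conj_distrib T M by (simp only: Suc_eq_plus1)
qed (simp add: left_n_exact_def)

lemma lex_complex: "left_n_exact C n X \<Longrightarrow> is_complex C 0 (Suc n) X"
  by (simp add: left_n_exact_iff)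

lemma lex_top:
  assumes "left_n_exact C n X" "h \<in> Arr C" "Cod C h = tm X (Suc n)"
    "df X (Suc n) \<cdot> h = Zero C (Dom C h) (tm X n)"
  shows "h = Zero C (Dom C h) (tm X (Suc n))"
  using assms(1)[unfolded left_n_exact_iff, THEN conjunct2, THEN conjunct1, rule_format, of h] assms by simp

lemma lex_lift:
  assumes "left_n_exact C n X" "k < n" "h \<in> Arr C" "Cod C h = tm X (Suc k)"
    "df X (Suc k) \<cdot> h = Zero C (Dom C h) (tm X k)"
  shows "\<exists>u. u \<in> Arr C \<and> Dom C u = Dom C h \<and> Cod C u = tm X (Suc (Suc k)) \<and>
    df X (Suc (Suc k)) \<cdot> u = h"
  using assms(1)[unfolded left_n_exact_iff, THEN conjunct2, THEN conjunct2, rule_format, of k h] assms(2-)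
  by auto

end

section \<open>Reversal of complexes; right exactness as left exactness in the opposite
  category\<close>

definition revc :: "nat \<Rightarrow> ('o, 'm) cpx \<Rightarrow> ('o, 'm) cpx" where
  "revc N X = \<lparr>tm = (\<lambda>k\<in>{0..N}. tm X (N - k)), df = (\<lambda>k\<in>{0<..N}. df X (Suc N - k))\<rparr>"

lemma revc_simps:
  "k \<le> N \<Longrightarrow> tm (revc N X) k = tm X (N - k)"
  "k < N \<Longrightarrow> df (revc N X) (Suc k) = df X (N - k)"
  "N < k \<Longrightarrow> tm (revc N X) k = undefined"
  "k = 0 \<or> N < k \<Longrightarrow> df (revc N X) k = undefined"
  by (auto simp: revc_def)

lemma is_complex_revc:
  assumes "is_complex C 0 N X"
  shows "is_complex (opc C) 0 N (revc N X)"
  unfolding is_complex_iff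
proof (intro conjI allI impI)
  note X = assms[unfolded is_complex_iff Hom_def mem_Collect_eq]
  fix k
  show "k \<le> N \<Longrightarrow> tm (revc N X) k \<in> Obj (opc C)" using X by (simp add: revc_simps)
  show "N < k \<Longrightarrow> tm (revc N X) k = undefined" by (simp add: revc_simps)
  show "k = 0 \<or> N < k \<Longrightarrow> df (revc N X) k = undefined" by (simp add: revc_simps)
  show "df (revc N X) (Suc k) \<in> Hom (opc C) (tm (revc N X) (Suc k)) (tm (revc N X) k)" if k: "k < N"
  proof -
    \<comment> \<open>Writing \<open>N\<close> as \<open>Suc (k + j)\<close> lets the simplifier
      evaluate truncated differences of indices; the same device recurs below.\<close>
    obtain j where "N = Suc (k + j)" using less_imp_Suc_add[OF k] by blast
    then show ?thesis using X by (simp add: revc_simps Hom_def)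
  qed
  show "df (revc N X) (Suc k) \<cdot>\<^bsub>opc C\<^esub> df (revc N X) (Suc (Suc k)) =
         Zero (opc C) (tm (revc N X) (Suc (Suc k))) (tm (revc N X) k)" if k: "Suc k < N"
  proof -
    obtain j where "N = Suc (Suc k + j)" using less_imp_Suc_add[OF k] by blast
    then show ?thesis using X by (simp add: revc_simps)
  qed
qed

lemma revc_revc:
  assumes "is_complex C 0 N X" shows "revc N (revc N X) = X"
proof (rule cpx.equality)
  note X = assms[unfolded is_complex_iff]
  show "tm (revc N (revc N X)) = tm X"
  proof
    fix k show "tm (revc N (revc N X)) k = tm X k"
      using X by (cases "k \<le> N") (auto simp: revc_simps)
  qed
  show "df (revc N (revc N X)) = df X"
  proof
    fix k show "df (revc N (revc N X)) k = df X k"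
    proof (cases "k = 0 \<or> N < k")
      case False
      then obtain i where i: "k = Suc i" "i < N" by (cases k) auto
      then obtain j where "N = Suc (i + j)" using less_imp_Suc_add by blast
      then show ?thesis using i by (simp add: revc_simps)
    qed (use X in \<open>auto simp: revc_simps\<close>)
  qed
qed simp

lemma ball_reflect: "(\<forall>k\<in>{1..n}. P (Suc n - k)) \<longleftrightarrow> (\<forall>k\<in>{1..n}. P k)"
proof (intro iffI ballI)
  fix k assume "\<forall>k\<in>{1..n}. P (Suc n - k)" "k \<in> {1..n}"
  moreover from this have "Suc n - k \<in> {1..n}" by auto
  ultimately have "P (Suc n - (Suc n - k))" by blast
  then show "P k" using \<open>k \<in> {1..n}\<close> by simp
next
  fix k assume "\<forall>k\<in>{1..n}. P k" "k \<in> {1..n}"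
  moreover from this have "Suc n - k \<in> {1..n}" by auto
  ultimately show "P (Suc n - k)" by blast
qed

text \<open>That \<open>X\<close> is a complex has to be stated separately, since reversal discards
  the values outside the range and cannot see whether they are \<open>undefined\<close>. Reversal
  exchanges the degrees \<open>k\<close> and \<open>Suc n - k\<close>, which permutes the inner
  degrees 1 to \<open>n\<close>.\<close>

lemma right_n_exact_iff:
  "right_n_exact C n X \<longleftrightarrow> is_complex C 0 (Suc n) X \<and> left_n_exact (opc C) n (revc (Suc n) X)"
proof (cases "is_complex C 0 (Suc n) X")
  case X: True
  have 1: "kernel (hom_group (opc C) Y (tm (revc (Suc n) X) (n + 1))) (hom_group (opc C) Y (tm (revc (Suc n) X) n))
      (\<lambda>h. df (revc (Suc n) X) (n + 1) \<cdot>\<^bsub>opc C\<^esub> h)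
    = kernel (hom_group C (tm X 0) Y) (hom_group C (tm X 1) Y) (\<lambda>h. h \<cdot>\<^bsub>C\<^esub> df X 1)" for Y
    by (simp add: hom_group_opc revc_simps)
  have 2: "(\<forall>k\<in>{1..n}. kernel (hom_group (opc C) Y (tm (revc (Suc n) X) k))
          (hom_group (opc C) Y (tm (revc (Suc n) X) (k - 1))) (\<lambda>h. df (revc (Suc n) X) k \<cdot>\<^bsub>opc C\<^esub> h)
      = (\<lambda>h. df (revc (Suc n) X) (k + 1) \<cdot>\<^bsub>opc C\<^esub> h) ` Hom (opc C) Y (tm (revc (Suc n) X) (k + 1))) \<longleftrightarrow>
    (\<forall>k\<in>{1..n}. kernel (hom_group C (tm X k) Y) (hom_group C (tm X (k + 1)) Y) (\<lambda>h. h \<cdot>\<^bsub>C\<^esub> df X (k + 1))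
          = (\<lambda>h. h \<cdot>\<^bsub>C\<^esub> df X k) ` Hom C (tm X (k - 1)) Y)" (is "(\<forall>k\<in>_. ?l k) \<longleftrightarrow> (\<forall>k\<in>_. ?r k)") for Y
  proof -
    have lr: "?l k \<longleftrightarrow> ?r (Suc n - k)" if k: "k \<in> {1..n}" for k
    proof -
      obtain i where i: "k = Suc i" "i < n" using k by (cases k) auto
      then obtain j where "n = Suc (i + j)" using less_imp_Suc_add by blast
      then show ?thesis using i by (simp add: hom_group_opc Hom_opc revc_simps)
    qed
    then have "(\<forall>k\<in>{1..n}. ?l k) \<longleftrightarrow> (\<forall>k\<in>{1..n}. ?r (Suc n - k))" by (rule ball_cong[OF refl])
    also have "\<dots> \<longleftrightarrow> (\<forall>k\<in>{1..n}. ?r k)" by (rule ball_reflect)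
    finally show ?thesis .
  qed
  have 3: "Zero (opc C) Y (tm (revc (Suc n) X) (n + 1)) = Zero C (tm X 0) Y" for Y
    by (simp add: revc_simps)
  have 4: "left_n_exact (opc C) n (revc (Suc n) X) \<longleftrightarrow> (\<forall>Y\<in>Obj C.
      kernel (hom_group C (tm X 0) Y) (hom_group C (tm X 1) Y) (\<lambda>h. h \<cdot>\<^bsub>C\<^esub> df X 1) = {Zero C (tm X 0) Y} \<and>
      (\<forall>k\<in>{1..n}. kernel (hom_group C (tm X k) Y) (hom_group C (tm X (k + 1)) Y) (\<lambda>h. h \<cdot>\<^bsub>C\<^esub> df X (k + 1))
          = (\<lambda>h. h \<cdot>\<^bsub>C\<^esub> df X k) ` Hom C (tm X (k - 1)) Y))"
    unfolding left_n_exact_def 1 2 3 using is_complex_revc[OF X] by simp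
  show ?thesis unfolding 4 right_n_exact_def using X by simp
qed (simp add: right_n_exact_def)

lemma left_n_exact_opc:
  assumes "left_n_exact C n X" shows "right_n_exact (opc C) n (revc (Suc n) X)"
proof -
  have X: "is_complex C 0 (Suc n) X" using assms by (simp add: left_n_exact_def)
  then show ?thesis unfolding right_n_exact_iff using assms is_complex_revc[OF X] revc_revc[OF X] by simp
qed

lemma right_n_exact_opc:
  "right_n_exact C n X \<Longrightarrow> left_n_exact (opc C) n (revc (Suc n) X)"
  by (simp add: right_n_exact_iff)

lemma n_exact_opc: "n_exact C n X \<Longrightarrow> n_exact (opc C) n (revc (Suc n) X)"
  by (simp add: n_exact_def left_n_exact_opc right_n_exact_opc)

lemma n_exact_complex: "n_exact C n X \<Longrightarrow> is_complex C 0 (Suc n) X"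
  by (simp add: n_exact_def left_n_exact_def)

lemma is_cpx_morphism_opc:
  assumes "is_cpx_morphism C 0 N X Y f"
  shows "is_cpx_morphism (opc C) 0 N (revc N Y) (revc N X) (\<lambda>k. f (N - k))"
  unfolding is_cpx_morphism_iff
proof (intro conjI allI impI)
  note f = assms[unfolded is_cpx_morphism_iff]
  fix k
  show "k \<le> N \<Longrightarrow> f (N - k) \<in> Hom (opc C) (tm (revc N Y) k) (tm (revc N X) k)"
    using f by (auto simp: revc_simps Hom_opc)
  show "f (N - k) \<cdot>\<^bsub>opc C\<^esub> df (revc N Y) (Suc k) = df (revc N X) (Suc k) \<cdot>\<^bsub>opc C\<^esub> f (N - Suc k)" if k: "k < N"
  proof -
    obtain j where "N = Suc (k + j)" using less_imp_Suc_add[OF k] by blast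
    then show ?thesis using f by (simp add: revc_simps)
  qed
qed

section \<open>Homotopy\<close>

context pcat
begin

lemma all_le_Suc_split:
  "(\<forall>k\<le>Suc n. Q k) \<longleftrightarrow> Q 0 \<and> (\<forall>k<n. Q (Suc k)) \<and> Q (Suc n)"
proof (intro iffI allI impI; (elim conjE)?)
  fix k assume *: "Q 0" "\<forall>k<n. Q (Suc k)" "Q (Suc n)" "k \<le> Suc n"
  show "Q k"
  proof (cases k)
    case (Suc j) then show ?thesis using * by (cases "j = n") auto
  qed (use * in simp)
qed auto

lemma diff_zeroD:
  assumes "f \<boxplus> Neg C g = Zero C A B" "f \<in> Arr C" "g \<in> Arr C" "Dom C f = A" "Cod C f = B"
    "Dom C g = A" "Cod C g = B"
  shows "f = g"
  using diff_eq_zero_iff[of f g] assms by auto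

lemma diff_eqI:
  assumes "a = b \<boxplus> c" "b \<in> Arr C" "c \<in> Arr C" "Dom C b = Dom C c" "Cod C b = Cod C c"
  shows "a \<boxplus> Neg C c = b"
  using assms by simp

text \<open>The conditional zero terms disappear once bottom, inner and top degrees are separated.
  This is the form in which lifting builds a homotopy degree by degree.\<close>

lemma homotopic_iff:
  assumes X: "is_complex C 0 (Suc n) X" and Y: "is_complex C 0 (Suc n) Y"
    and g: "\<forall>k\<le>Suc n. g k \<in> Hom C (tm X k) (tm Y k)"
  shows "homotopic C (Suc n) X Y f g \<longleftrightarrow>
    (\<exists>h. (\<forall>k\<le>n. h k \<in> Hom C (tm X k) (tm Y (Suc k))) \<and>
      f 0 = g 0 \<boxplus> df Y (Suc 0) \<cdot> h 0 \<and>
      (\<forall>k<n. f (Suc k) = g (Suc k) \<boxplus>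
         (df Y (Suc (Suc k)) \<cdot> h (Suc k) \<boxplus> h k \<cdot> df X (Suc k))) \<and>
      f (Suc n) = g (Suc n) \<boxplus> h n \<cdot> df X (Suc n))"
proof -
  note [simp] = cpxD[OF X] cpxD[OF Y]
  have g' [simp]: "k \<le> Suc n \<Longrightarrow> g k \<in> Arr C" "k \<le> Suc n \<Longrightarrow> Dom C (g k) = tm X k"
    "k \<le> Suc n \<Longrightarrow> Cod C (g k) = tm Y k" for k using g by auto
  let ?P = "\<lambda>h k. f k = g k
         \<boxplus> (if k < Suc n then df Y (k + 1) \<cdot> h k else Zero C (tm X k) (tm Y k))
         \<boxplus> (if 0 < k then h (k - 1) \<cdot> df X k else Zero C (tm X k) (tm Y k))"
  have "(\<forall>k\<le>Suc n. ?P h k) \<longleftrightarrow> f 0 = g 0 \<boxplus> df Y (Suc 0) \<cdot> h 0 \<and>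
      (\<forall>k<n. f (Suc k) = g (Suc k) \<boxplus>
         (df Y (Suc (Suc k)) \<cdot> h (Suc k) \<boxplus> h k \<cdot> df X (Suc k))) \<and>
      f (Suc n) = g (Suc n) \<boxplus> h n \<cdot> df X (Suc n)"
    if h: "\<forall>k\<le>n. h k \<in> Hom C (tm X k) (tm Y (Suc k))" for h
  proof -
    have h' [simp]: "k \<le> n \<Longrightarrow> h k \<in> Arr C" "k \<le> n \<Longrightarrow> Dom C (h k) = tm X k"
      "k \<le> n \<Longrightarrow> Cod C (h k) = tm Y (Suc k)" for k using h by auto
    have 0: "?P h 0 \<longleftrightarrow> f 0 = g 0 \<boxplus> df Y (Suc 0) \<cdot> h 0" by simp
    have 1: "?P h (Suc k) \<longleftrightarrow> f (Suc k) = g (Suc k) \<boxplus>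
         (df Y (Suc (Suc k)) \<cdot> h (Suc k) \<boxplus> h k \<cdot> df X (Suc k))" if "k < n" for k
      using that by simp
    have 2: "?P h (Suc n) \<longleftrightarrow> f (Suc n) = g (Suc n) \<boxplus> h n \<cdot> df X (Suc n)" by simp
    have 3: "(\<forall>k<n. ?P h (Suc k)) \<longleftrightarrow> (\<forall>k<n. f (Suc k) = g (Suc k) \<boxplus>
         (df Y (Suc (Suc k)) \<cdot> h (Suc k) \<boxplus> h k \<cdot> df X (Suc k)))"
      using 1 by blast
    show ?thesis unfolding all_le_Suc_split[where Q = "?P h"] 0 2 3 ..
  qed
  then show ?thesis unfolding homotopic_def less_Suc_eq_le[symmetric] Suc_eq_plus1 by blast
qed

text \<open>The comparison argument of homological algebra: the latest component composed with the
  next differential of \<open>X\<close> is killed by the differential of \<open>Y\<close>, so left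
  exactness of \<open>Y\<close> supplies the next component.\<close>

lemma lift_chain:
  assumes X: "is_complex C 0 (Suc n) X" and Y: "left_n_exact C n Y"
    and a: "a0 \<in> Hom C (tm X 0) (tm Y 0)" "a1 \<in> Hom C (tm X (Suc 0)) (tm Y (Suc 0))"
    and sq: "a0 \<cdot> df X (Suc 0) = df Y (Suc 0) \<cdot> a1"
  shows "\<exists>f. is_cpx_morphism C 0 (Suc n) X Y f \<and> f 0 = a0 \<and> f (Suc 0) = a1"
proof -
  note [simp] = cpxD[OF X] cpxD[OF lex_complex[OF Y]]
  have "m \<le> n \<Longrightarrow> \<exists>f. is_cpx_morphism C 0 (Suc m) X Y f \<and> f 0 = a0 \<and> f (Suc 0) = a1" for m
  proof (induction m)
    case 0
    show ?case using a sq
      by (intro exI[of _ "\<lambda>k. if k = 0 then a0 else a1"]) (auto simp: is_cpx_morphism_iff le_Suc_eq)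
  next
    case (Suc m)
    then obtain f where f: "is_cpx_morphism C 0 (Suc m) X Y f" "f 0 = a0" "f (Suc 0) = a1" by auto
    note [simp] = morD[OF f(1)]
    have sq': "df Y (Suc m) \<cdot> f (Suc m) = f m \<cdot> df X (Suc m)"
      using mor_comm[OF f(1), of m] by simp
    have "df Y (Suc m) \<cdot> (f (Suc m) \<cdot> df X (Suc (Suc m))) = f m \<cdot> df X (Suc m) \<cdot> df X (Suc (Suc m))"
      by (rule comp_eq_reassoc[OF sq']) (use Suc.prems in simp_all)
    then have "df Y (Suc m) \<cdot> (f (Suc m) \<cdot> df X (Suc (Suc m))) = Zero C (tm X (Suc (Suc m))) (tm Y m)"
      using Suc.prems by simp
    then obtain u where u: "u \<in> Arr C" "Dom C u = tm X (Suc (Suc m))" "Cod C u = tm Y (Suc (Suc m))"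
      "df Y (Suc (Suc m)) \<cdot> u = f (Suc m) \<cdot> df X (Suc (Suc m))"
      using lex_lift[OF Y, of m "f (Suc m) \<cdot> df X (Suc (Suc m))"] Suc.prems by auto
    have "is_cpx_morphism C 0 (Suc (Suc m)) X Y (f(Suc (Suc m) := u))"
      using u mor_comm[OF f(1)] by (auto simp: is_cpx_morphism_iff less_Suc_eq le_Suc_eq)
    then show ?case using f by (intro exI[of _ "f(Suc (Suc m) := u)"]) (auto simp del: fun_upd_apply simp: fun_upd_other)
  qed
  then show ?thesis by blast
qed

text \<open>The difference of \<open>f\<close> and \<open>g\<close>, corrected by the homotopy built
  so far, is a cycle, and a lift of it is the next component. In the top degree there is no further
  component, but there the differential of \<open>Y\<close> is monic and the corrected difference
  vanishes.\<close>

lemma lift_homotopy: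
  assumes X: "is_complex C 0 (Suc n) X" and Y: "left_n_exact C n Y"
    and f: "is_cpx_morphism C 0 (Suc n) X Y f" and g: "is_cpx_morphism C 0 (Suc n) X Y g"
    and h0: "h0 \<in> Hom C (tm X 0) (tm Y (Suc 0))" "f 0 = g 0 \<boxplus> df Y (Suc 0) \<cdot> h0"
  shows "homotopic C (Suc n) X Y f g"
proof -
  note [simp] = cpxD[OF X] cpxD[OF lex_complex[OF Y]] morD[OF f] morD[OF g]
  let ?P = "\<lambda>m h. (\<forall>k\<le>m. h k \<in> Hom C (tm X k) (tm Y (Suc k))) \<and>
      f 0 = g 0 \<boxplus> df Y (Suc 0) \<cdot> h 0 \<and>
      (\<forall>k<m. f (Suc k) = g (Suc k) \<boxplus>
         (df Y (Suc (Suc k)) \<cdot> h (Suc k) \<boxplus> h k \<cdot> df X (Suc k)))"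
  have defect: "df Y (Suc m) \<cdot> (f (Suc m) \<boxplus> Neg C (g (Suc m) \<boxplus> h m \<cdot> df X (Suc m))) =
      Zero C (tm X (Suc m)) (tm Y m)" if P: "?P m h" and m: "m \<le> n" for m h
  proof -
    have [simp]: "k \<le> m \<Longrightarrow> h k \<in> Arr C" "k \<le> m \<Longrightarrow> Dom C (h k) = tm X k"
      "k \<le> m \<Longrightarrow> Cod C (h k) = tm Y (Suc k)" for k using P by auto
    \<comment> \<open>In degree 0 this is the homotopy formula itself; in higher degrees its extra
      term contains two consecutive differentials of \<open>X\<close>.\<close>
    have fm: "f m \<cdot> df X (Suc m) = (g m \<boxplus> df Y (Suc m) \<cdot> h m) \<cdot> df X (Suc m)"
    proof (cases m)
      case 0 then show ?thesis using P by simp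
    next
      case (Suc j)
      then have "f m = g m \<boxplus> (df Y (Suc m) \<cdot> h m \<boxplus> h j \<cdot> df X m)" using P by auto
      then show ?thesis using m Suc by simp
    qed
    have 1: "df Y (Suc m) \<cdot> f (Suc m) = f m \<cdot> df X (Suc m)"
      "df Y (Suc m) \<cdot> g (Suc m) = g m \<cdot> df X (Suc m)"
      using mor_comm[OF f, of m] mor_comm[OF g, of m] m by auto
    show ?thesis using m by (simp add: 1 fm diff_eq_zero_iff flip: neg_add)
  qed
  have "m \<le> n \<Longrightarrow> \<exists>h. ?P m h" for m
  proof (induction m)
    case 0
    then show ?case using h0 by (intro exI[of _ "\<lambda>k. h0"]) auto
  next
    case (Suc m)
    then obtain h where h: "?P m h" by auto
    have [simp]: "k \<le> m \<Longrightarrow> h k \<in> Arr C" "k \<le> m \<Longrightarrow> Dom C (h k) = tm X k"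
      "k \<le> m \<Longrightarrow> Cod C (h k) = tm Y (Suc k)" for k using h by auto
    let ?e = "f (Suc m) \<boxplus> Neg C (g (Suc m) \<boxplus> h m \<cdot> df X (Suc m))"
    have e: "?e \<in> Arr C" "Dom C ?e = tm X (Suc m)" "Cod C ?e = tm Y (Suc m)" using Suc.prems by auto
    have "\<exists>u. u \<in> Arr C \<and> Dom C u = Dom C ?e \<and> Cod C u = tm Y (Suc (Suc m)) \<and> df Y (Suc (Suc m)) \<cdot> u = ?e"
      by (rule lex_lift[OF Y _ e(1,3)]) (use Suc.prems defect[OF h] e in simp_all)
    then obtain u where u: "u \<in> Arr C" "Dom C u = tm X (Suc m)" "Cod C u = tm Y (Suc (Suc m))"
      "df Y (Suc (Suc m)) \<cdot> u = ?e" using e by auto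
    have fS: "f (Suc m) = g (Suc m) \<boxplus> (df Y (Suc (Suc m)) \<cdot> u \<boxplus> h m \<cdot> df X (Suc m))"
      unfolding u(4) using Suc.prems by (simp add: add_ac)
    have "?P (Suc m) (h(Suc m := u))"
      using h u fS by (auto simp: less_Suc_eq le_Suc_eq)
    then show ?case by blast
  qed
  then obtain h where h: "?P n h" by blast
  have [simp]: "k \<le> n \<Longrightarrow> h k \<in> Arr C" "k \<le> n \<Longrightarrow> Dom C (h k) = tm X k"
      "k \<le> n \<Longrightarrow> Cod C (h k) = tm Y (Suc k)" for k using h by auto
  let ?e = "f (Suc n) \<boxplus> Neg C (g (Suc n) \<boxplus> h n \<cdot> df X (Suc n))"
  have e: "?e \<in> Arr C" "Dom C ?e = tm X (Suc n)" "Cod C ?e = tm Y (Suc n)" by auto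
  have "?e = Zero C (Dom C ?e) (tm Y (Suc n))"
    by (rule lex_top[OF Y e(1,3)]) (use defect[OF h] e in simp)
  then have 1: "?e = Zero C (tm X (Suc n)) (tm Y (Suc n))" unfolding e(2) .
  have "f (Suc n) = g (Suc n) \<boxplus> h n \<cdot> df X (Suc n)"
    by (rule diff_zeroD[OF 1]) simp_all
  with h show ?thesis
    unfolding homotopic_iff[OF X lex_complex[OF Y] g[unfolded is_cpx_morphism_iff, THEN conjunct1]]
    by (intro exI[of _ h]) (elim conjE, intro conjI)
qed

section \<open>Homotopy equivalence of left n-exact sequences\<close>

lemma homotopy_equivalent_sym: "homotopy_equivalent C N X Y \<Longrightarrow> homotopy_equivalent C N Y X"
  unfolding homotopy_equivalent_def by blast

lemma mor_comp:
  assumes X: "is_complex C 0 N X" and Y: "is_complex C 0 N Y" and Z: "is_complex C 0 N Z"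
    and f: "is_cpx_morphism C 0 N X Y f" and g: "is_cpx_morphism C 0 N Y Z g"
  shows "is_cpx_morphism C 0 N X Z (\<lambda>k. g k \<cdot> f k)"
proof -
  note [simp] = cpxD[OF X] cpxD[OF Y] cpxD[OF Z] morD[OF f] morD[OF g]
  have "g k \<cdot> (f k \<cdot> df X (Suc k)) = df Z (Suc k) \<cdot> (g (Suc k) \<cdot> f (Suc k))" if "k < N" for k
    using mor_comm[OF f that] mor_comm_comp[OF Y Z g that, of "f (Suc k)"] that by simp
  then show ?thesis by (auto simp: is_cpx_morphism_iff)
qed

lemma mor_ident: "is_complex C 0 N X \<Longrightarrow> is_cpx_morphism C 0 N X X (\<lambda>k. Ident C (tm X k))"
  using cpxD[of N X] by (auto simp: is_cpx_morphism_iff)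

text \<open>Both composites of the lifted chain maps are the identity in degree 0, so a homotopy to
  the identity can start with zero there and lifting produces the rest. In particular a left n-exact
  sequence is determined up to homotopy equivalence by its last morphism.\<close>

lemma homotopy_equivalent_if_iso_square:
  assumes X: "left_n_exact C n X" and Y: "left_n_exact C n Y"
    and a: "a0 \<in> Hom C (tm X 0) (tm Y 0)" "a1 \<in> Hom C (tm X (Suc 0)) (tm Y (Suc 0))"
      "a0 \<cdot> df X (Suc 0) = df Y (Suc 0) \<cdot> a1"
    and b: "b0 \<in> Hom C (tm Y 0) (tm X 0)" "b1 \<in> Hom C (tm Y (Suc 0)) (tm X (Suc 0))"
      "b0 \<cdot> df Y (Suc 0) = df X (Suc 0) \<cdot> b1"
    and iso: "b0 \<cdot> a0 = Ident C (tm X 0)" "a0 \<cdot> b0 = Ident C (tm Y 0)"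
  shows "homotopy_equivalent C (Suc n) X Y"
proof -
  note Xc = lex_complex[OF X] and Yc = lex_complex[OF Y]
  note [simp] = cpxD[OF Xc] cpxD[OF Yc]
  obtain f where f: "is_cpx_morphism C 0 (Suc n) X Y f" "f 0 = a0"
    using lift_chain[OF Xc Y a] by blast
  obtain g where g: "is_cpx_morphism C 0 (Suc n) Y X g" "g 0 = b0"
    using lift_chain[OF Yc X b] by blast
  have "homotopic C (Suc n) X X (\<lambda>k. g k \<cdot> f k) (\<lambda>k. Ident C (tm X k))"
    by (rule lift_homotopy[OF Xc X mor_comp[OF Xc Yc Xc f(1) g(1)] mor_ident[OF Xc],
          of "Zero C (tm X 0) (tm X (Suc 0))"]) (use iso f g in auto)
  moreover have "homotopic C (Suc n) Y Y (\<lambda>k. f k \<cdot> g k) (\<lambda>k. Ident C (tm Y k))"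
    by (rule lift_homotopy[OF Yc Y mor_comp[OF Yc Xc Yc g(1) f(1)] mor_ident[OF Yc],
          of "Zero C (tm Y 0) (tm Y (Suc 0))"]) (use iso f g in auto)
  ultimately show ?thesis unfolding homotopy_equivalent_def using f g by blast
qed

text \<open>For a cycle \<open>y\<close> the image \<open>g y\<close> has a lift \<open>x\<close> in
  \<open>X\<close>, and the homotopy between \<open>f g\<close> and the identity exhibits
  \<open>y\<close> as the boundary of \<open>f x - h y\<close>.\<close>

lemma left_n_exact_homotopy_equivalent:
  assumes X: "left_n_exact C n X" and Y: "is_complex C 0 (Suc n) Y"
    and e: "homotopy_equivalent C (Suc n) X Y"
  shows "left_n_exact C n Y"
proof -
  note Xc = lex_complex[OF X]
  obtain f g where f: "is_cpx_morphism C 0 (Suc n) X Y f" and g: "is_cpx_morphism C 0 (Suc n) Y X g"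
    and hom: "homotopic C (Suc n) Y Y (\<lambda>k. f k \<cdot> g k) (\<lambda>k. Ident C (tm Y k))"
    using e unfolding homotopy_equivalent_def by blast
  note [simp] = cpxD[OF Xc] cpxD[OF Y] morD[OF f] morD[OF g]
  obtain h where h: "\<And>k. k \<le> n \<Longrightarrow> h k \<in> Hom C (tm Y k) (tm Y (Suc k))"
      "\<And>k. k < n \<Longrightarrow> f (Suc k) \<cdot> g (Suc k) = Ident C (tm Y (Suc k)) \<boxplus>
         (df Y (Suc (Suc k)) \<cdot> h (Suc k) \<boxplus> h k \<cdot> df Y (Suc k))"
      "f (Suc n) \<cdot> g (Suc n) = Ident C (tm Y (Suc n)) \<boxplus> h n \<cdot> df Y (Suc n)"
    using hom[unfolded homotopic_iff[OF Y Y mor_ident[OF Y, unfolded is_cpx_morphism_iff, THEN conjunct1]]]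
    by blast
  have [simp]: "k \<le> n \<Longrightarrow> h k \<in> Arr C" "k \<le> n \<Longrightarrow> Dom C (h k) = tm Y k"
      "k \<le> n \<Longrightarrow> Cod C (h k) = tm Y (Suc k)" for k using h(1) by auto
  have gy: "df X (Suc k) \<cdot> (g (Suc k) \<cdot> y) = Zero C (Dom C y) (tm X k)"
    if "k \<le> n" "y \<in> Arr C" "Cod C y = tm Y (Suc k)" "df Y (Suc k) \<cdot> y = Zero C (Dom C y) (tm Y k)" for k y
    using mor_comm_comp[OF Y Xc g, of k y] that by simp
  show ?thesis unfolding left_n_exact_iff
  proof (intro conjI Y ballI allI impI; (elim conjE)?)
    fix y assume y: "y \<in> Arr C" "Cod C y = tm Y (Suc n)" "df Y (Suc n) \<cdot> y = Zero C (Dom C y) (tm Y n)"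
    have "g (Suc n) \<cdot> y = Zero C (Dom C (g (Suc n) \<cdot> y)) (tm X (Suc n))"
      by (rule lex_top[OF X]) (use y gy in simp_all)
    moreover have "Dom C (g (Suc n) \<cdot> y) = Dom C y" using y by simp
    ultimately have gz: "g (Suc n) \<cdot> y = Zero C (Dom C y) (tm X (Suc n))" by metis
    have "f (Suc n) \<cdot> (g (Suc n) \<cdot> y) = (Ident C (tm Y (Suc n)) \<boxplus> h n \<cdot> df Y (Suc n)) \<cdot> y"
      by (rule comp_eq_reassoc[OF h(3)]) (use y in simp_all)
    then show "y = Zero C (Dom C y) (tm Y (Suc n))" using y by (simp add: gz)
  next
    fix k y assume k: "k < n" and y: "y \<in> Arr C" "Cod C y = tm Y (Suc k)" "df Y (Suc k) \<cdot> y = Zero C (Dom C y) (tm Y k)"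
    have "\<exists>u. u \<in> Arr C \<and> Dom C u = Dom C (g (Suc k) \<cdot> y) \<and> Cod C u = tm X (Suc (Suc k)) \<and>
        df X (Suc (Suc k)) \<cdot> u = g (Suc k) \<cdot> y"
      by (rule lex_lift[OF X k]) (use y gy k in simp_all)
    then obtain x where x: "x \<in> Arr C" "Dom C x = Dom C y" "Cod C x = tm X (Suc (Suc k))"
        "df X (Suc (Suc k)) \<cdot> x = g (Suc k) \<cdot> y" using y k by auto
    have "f (Suc k) \<cdot> (g (Suc k) \<cdot> y) = (Ident C (tm Y (Suc k)) \<boxplus>
         (df Y (Suc (Suc k)) \<cdot> h (Suc k) \<boxplus> h k \<cdot> df Y (Suc k))) \<cdot> y"
      by (rule comp_eq_reassoc[OF h(2)]) (use y k in simp_all)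
    then have 1: "f (Suc k) \<cdot> (g (Suc k) \<cdot> y) = y \<boxplus> df Y (Suc (Suc k)) \<cdot> (h (Suc k) \<cdot> y)"
      using y k by simp
    have "f (Suc k) \<cdot> (g (Suc k) \<cdot> y) = df Y (Suc (Suc k)) \<cdot> (f (Suc (Suc k)) \<cdot> x)"
      using mor_comm_comp[OF Xc Y f, of "Suc k" x] x k by simp
    with 1 have "df Y (Suc (Suc k)) \<cdot> (f (Suc (Suc k)) \<cdot> x) \<boxplus> Neg C (df Y (Suc (Suc k)) \<cdot> (h (Suc k) \<cdot> y)) = y"
      by (intro diff_eqI) (use x y k in simp_all)
    then have "df Y (Suc (Suc k)) \<cdot> (f (Suc (Suc k)) \<cdot> x \<boxplus> Neg C (h (Suc k) \<cdot> y)) = y"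
      using x(1-3) y(1,2) k by simp
    then show "\<exists>u\<in>Hom C (Dom C y) (tm Y (Suc (Suc k))). df Y (Suc (Suc k)) \<cdot> u = y"
      using x y k by (intro bexI[of _ "f (Suc (Suc k)) \<cdot> x \<boxplus> Neg C (h (Suc k) \<cdot> y)"]) auto
  qed
qed

lemma homotopic_opc:
  assumes X: "is_complex C 0 (Suc n) X" and Y: "is_complex C 0 (Suc n) Y"
    and g: "\<forall>k\<le>Suc n. g k \<in> Hom C (tm X k) (tm Y k)"
    and fg: "homotopic C (Suc n) X Y f g"
  shows "homotopic (opc C) (Suc n) (revc (Suc n) Y) (revc (Suc n) X)
    (\<lambda>k. f (Suc n - k)) (\<lambda>k. g (Suc n - k))"
proof -
  note [simp] = cpxD[OF X] cpxD[OF Y]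
  interpret O: pcat "opc C" by (rule pcat_opc)
  obtain h where h: "\<And>k. k \<le> n \<Longrightarrow> h k \<in> Hom C (tm X k) (tm Y (Suc k))"
      "f 0 = g 0 \<boxplus> df Y (Suc 0) \<cdot> h 0"
      "\<And>k. k < n \<Longrightarrow> f (Suc k) = g (Suc k) \<boxplus>
         (df Y (Suc (Suc k)) \<cdot> h (Suc k) \<boxplus> h k \<cdot> df X (Suc k))"
      "f (Suc n) = g (Suc n) \<boxplus> h n \<cdot> df X (Suc n)"
    using fg[unfolded homotopic_iff[OF X Y g]] by blast
  have [simp]: "k \<le> n \<Longrightarrow> h k \<in> Arr C" "k \<le> n \<Longrightarrow> Dom C (h k) = tm X k"
      "k \<le> n \<Longrightarrow> Cod C (h k) = tm Y (Suc k)" for k using h(1) by auto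
  show ?thesis
  proof (subst O.homotopic_iff[OF is_complex_revc[OF Y] is_complex_revc[OF X]])
    show "\<forall>k\<le>Suc n. g (Suc n - k) \<in> Hom (opc C) (tm (revc (Suc n) Y) k) (tm (revc (Suc n) X) k)"
      using g by (simp add: revc_simps)
  next
    show "\<exists>h. (\<forall>k\<le>n. h k \<in> Hom (opc C) (tm (revc (Suc n) Y) k) (tm (revc (Suc n) X) (Suc k))) \<and>
      f (Suc n - 0) = g (Suc n - 0) \<boxplus>\<^bsub>opc C\<^esub> df (revc (Suc n) X) (Suc 0) \<cdot>\<^bsub>opc C\<^esub> h 0 \<and>
      (\<forall>k<n. f (Suc n - Suc k) = g (Suc n - Suc k) \<boxplus>\<^bsub>opc C\<^esub>
         (df (revc (Suc n) X) (Suc (Suc k)) \<cdot>\<^bsub>opc C\<^esub> h (Suc k) \<boxplus>\<^bsub>opc C\<^esub>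
          h k \<cdot>\<^bsub>opc C\<^esub> df (revc (Suc n) Y) (Suc k))) \<and>
      f (Suc n - Suc n) = g (Suc n - Suc n) \<boxplus>\<^bsub>opc C\<^esub> h n \<cdot>\<^bsub>opc C\<^esub> df (revc (Suc n) Y) (Suc n)"
    \<comment> \<open>\<open>h (n - k)\<close> goes from degree \<open>n - k\<close> of
      \<open>X\<close> to degree \<open>Suc n - k\<close> of \<open>Y\<close>; in the opposite
      category it leaves degree \<open>k\<close> of the reversed \<open>Y\<close> and enters degree
      \<open>Suc k\<close> of the reversed \<open>X\<close>.\<close>
    proof (intro exI[of _ "\<lambda>k. h (n - k)"] conjI allI impI)
      fix k assume "k \<le> n"
      then show "h (n - k) \<in> Hom (opc C) (tm (revc (Suc n) Y) k) (tm (revc (Suc n) X) (Suc k))"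
        using h(1)[of "n - k"] by (simp add: revc_simps Suc_diff_le)
    next
      fix k assume k: "k < n"
      obtain j where "n = Suc (k + j)" using less_imp_Suc_add[OF k] by blast
      then show "f (Suc n - Suc k) = g (Suc n - Suc k) \<boxplus>\<^bsub>opc C\<^esub>
         (df (revc (Suc n) X) (Suc (Suc k)) \<cdot>\<^bsub>opc C\<^esub> h (n - Suc k) \<boxplus>\<^bsub>opc C\<^esub>
          h (n - k) \<cdot>\<^bsub>opc C\<^esub> df (revc (Suc n) Y) (Suc k))"
        using h(3)[of j] by (simp add: revc_simps add_comm)
    qed (use h(2,4) in \<open>simp_all add: revc_simps\<close>)
  qed
qed

text \<open>As a congruence rule this lets the terms of a reversed complex be rewritten, which is
  possible only under the range condition on \<open>k\<close>.\<close>

lemma homotopic_cong: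
  assumes "\<And>k. k \<le> N \<Longrightarrow> f k = f' k" "\<And>k. k \<le> N \<Longrightarrow> g k = g' k"
  shows "homotopic C N X Y f g \<longleftrightarrow> homotopic C N X Y f' g'"
  unfolding homotopic_def using assms by simp

lemma homotopy_equivalent_opc:
  assumes X: "is_complex C 0 (Suc n) X" and Y: "is_complex C 0 (Suc n) Y"
    and e: "homotopy_equivalent C (Suc n) X Y"
  shows "homotopy_equivalent (opc C) (Suc n) (revc (Suc n) X) (revc (Suc n) Y)"
proof -
  interpret O: pcat "opc C" by (rule pcat_opc)
  obtain f g where f: "is_cpx_morphism C 0 (Suc n) X Y f" and g: "is_cpx_morphism C 0 (Suc n) Y X g"
    and hom: "homotopic C (Suc n) X X (\<lambda>k. g k \<cdot> f k) (\<lambda>k. Ident C (tm X k))"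
     "homotopic C (Suc n) Y Y (\<lambda>k. f k \<cdot> g k) (\<lambda>k. Ident C (tm Y k))"
    using e unfolding homotopy_equivalent_def by blast
  note id = mor_ident[unfolded is_cpx_morphism_iff, THEN conjunct1]
  have "homotopic (opc C) (Suc n) (revc (Suc n) X) (revc (Suc n) X)
      (\<lambda>k. f (Suc n - k) \<cdot>\<^bsub>opc C\<^esub> g (Suc n - k)) (\<lambda>k. Ident (opc C) (tm (revc (Suc n) X) k))"
    using homotopic_opc[OF X X id[OF X] hom(1)] by (simp add: revc_simps cong: O.homotopic_cong)
  moreover have "homotopic (opc C) (Suc n) (revc (Suc n) Y) (revc (Suc n) Y)
      (\<lambda>k. g (Suc n - k) \<cdot>\<^bsub>opc C\<^esub> f (Suc n - k)) (\<lambda>k. Ident (opc C) (tm (revc (Suc n) Y) k))"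
    using homotopic_opc[OF Y Y id[OF Y] hom(2)] by (simp add: revc_simps cong: O.homotopic_cong)
  ultimately show ?thesis unfolding homotopy_equivalent_def
    using is_cpx_morphism_opc[OF f] is_cpx_morphism_opc[OF g] by blast
qed

lemma n_exact_homotopy_equivalent:
  assumes X: "n_exact C n X" and Y: "is_complex C 0 (Suc n) Y"
    and e: "homotopy_equivalent C (Suc n) X Y"
  shows "n_exact C n Y"
proof -
  interpret O: pcat "opc C" by (rule pcat_opc)
  have "left_n_exact C n Y" using X Y e left_n_exact_homotopy_equivalent by (auto simp: n_exact_def)
  moreover have "left_n_exact (opc C) n (revc (Suc n) Y)"
  proof (rule O.left_n_exact_homotopy_equivalent)
    show "left_n_exact (opc C) n (revc (Suc n) X)"
      using X by (simp add: n_exact_def right_n_exact_opc)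
    show "is_complex (opc C) 0 (Suc n) (revc (Suc n) Y)" by (rule is_complex_revc[OF Y])
    show "homotopy_equivalent (opc C) (Suc n) (revc (Suc n) X) (revc (Suc n) Y)"
      by (rule homotopy_equivalent_opc[OF n_exact_complex[OF X] Y e])
  qed
  ultimately show ?thesis using Y by (simp add: n_exact_def right_n_exact_iff)
qed

end

section \<open>Adding a contractible summand\<close>

text \<open>The biproducts are parameters rather than the chosen ones: feeding in swapped or sheared
  biproducts, or one with a zero object, makes the last morphism of the enlarged complex literally
  the arrow that is wanted.\<close>

definition contractible_in ::
  "('o, 'm) cat \<Rightarrow> ('o, 'm) cpx \<Rightarrow> nat \<Rightarrow> ('o, 'm) biproduct \<Rightarrow> ('o, 'm) biproduct \<Rightarrow> nat \<Rightarrow> 'm" where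
  "contractible_in C V k S S' j =
    (if j = k then in1 S else if j = Suc k then in1 S' else Ident C (tm V j))"

definition contractible_pr ::
  "('o, 'm) cat \<Rightarrow> ('o, 'm) cpx \<Rightarrow> nat \<Rightarrow> ('o, 'm) biproduct \<Rightarrow> ('o, 'm) biproduct \<Rightarrow> nat \<Rightarrow> 'm" where
  "contractible_pr C V k S S' j =
    (if j = k then pr1 S else if j = Suc k then pr1 S' else Ident C (tm V j))"

definition contractible_tm ::
  "('o, 'm) cpx \<Rightarrow> nat \<Rightarrow> ('o, 'm) biproduct \<Rightarrow> ('o, 'm) biproduct \<Rightarrow> nat \<Rightarrow> 'o" where
  "contractible_tm V k S S' j =
    (if j = k then vertex S else if j = Suc k then vertex S' else tm V j)"

text \<open>
  \<open>add_contractible C N V k S S'\<close> is the direct sum of \<open>V\<close> with the complex \<open>A = A\<close> in degrees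
  \<open>k + 1\<close> and \<open>k\<close>, where \<open>S\<close> and \<open>S'\<close> are biproducts of \<open>tm V k\<close> and \<open>tm V (k + 1)\<close> with \<open>A\<close>.
\<close>

definition add_contractible ::
  "('o, 'm) cat \<Rightarrow> nat \<Rightarrow> ('o, 'm) cpx \<Rightarrow> nat \<Rightarrow> ('o, 'm) biproduct \<Rightarrow> ('o, 'm) biproduct \<Rightarrow>
    ('o, 'm) cpx" where
  "add_contractible C N V k S S' =
    \<lparr>tm = (\<lambda>j\<in>{0..N}. contractible_tm V k S S' j),
     df = (\<lambda>j\<in>{0<..N}. contractible_in C V k S S' (j - 1) \<cdot>\<^bsub>C\<^esub>
         (df V j \<cdot>\<^bsub>C\<^esub> contractible_pr C V k S S' j) \<boxplus>\<^bsub>C\<^esub>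
       (if j = Suc k then in2 S \<cdot>\<^bsub>C\<^esub> pr2 S'
        else Zero C (contractible_tm V k S S' j) (contractible_tm V k S S' (j - 1))))\<rparr>"

lemma add_contractible_simps:
  "j \<le> N \<Longrightarrow> tm (add_contractible C N V k S S') j = contractible_tm V k S S' j"
  "j < N \<Longrightarrow> df (add_contractible C N V k S S') (Suc j) = contractible_in C V k S S' j \<cdot>\<^bsub>C\<^esub>
         (df V (Suc j) \<cdot>\<^bsub>C\<^esub> contractible_pr C V k S S' (Suc j)) \<boxplus>\<^bsub>C\<^esub>
       (if j = k then in2 S \<cdot>\<^bsub>C\<^esub> pr2 S'
        else Zero C (contractible_tm V k S S' (Suc j)) (contractible_tm V k S S' j))"
  "N < j \<Longrightarrow> tm (add_contractible C N V k S S') j = undefined"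
  "j = 0 \<or> N < j \<Longrightarrow> df (add_contractible C N V k S S') j = undefined"
  by (auto simp: add_contractible_def)

context pcat
begin

section \<open>Calculus of biproducts; the enlarged complex is homotopy equivalent to the
  original\<close>

lemma biprodD:
  assumes "is_biproduct C A B S"
  shows "A \<in> Obj C" "B \<in> Obj C" "vertex S \<in> Obj C"
    "in1 S \<in> Arr C" "Dom C (in1 S) = A" "Cod C (in1 S) = vertex S"
    "in2 S \<in> Arr C" "Dom C (in2 S) = B" "Cod C (in2 S) = vertex S"
    "pr1 S \<in> Arr C" "Dom C (pr1 S) = vertex S" "Cod C (pr1 S) = A"
    "pr2 S \<in> Arr C" "Dom C (pr2 S) = vertex S" "Cod C (pr2 S) = B"
    "pr1 S \<cdot> in1 S = Ident C A" "pr2 S \<cdot> in2 S = Ident C B"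
    "pr1 S \<cdot> in2 S = Zero C B A" "pr2 S \<cdot> in1 S = Zero C A B"
    "in1 S \<cdot> pr1 S \<boxplus> in2 S \<cdot> pr2 S = Ident C (vertex S)"
    "\<And>x. x \<in> Arr C \<Longrightarrow> Cod C x = A \<Longrightarrow> pr1 S \<cdot> (in1 S \<cdot> x) = x"
    "\<And>x. x \<in> Arr C \<Longrightarrow> Cod C x = B \<Longrightarrow> pr2 S \<cdot> (in2 S \<cdot> x) = x"
    "\<And>x. x \<in> Arr C \<Longrightarrow> Cod C x = B \<Longrightarrow> pr1 S \<cdot> (in2 S \<cdot> x) = Zero C (Dom C x) A"
    "\<And>x. x \<in> Arr C \<Longrightarrow> Cod C x = A \<Longrightarrow> pr2 S \<cdot> (in1 S \<cdot> x) = Zero C (Dom C x) B"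
proof -
  note * = assms[unfolded is_biproduct_def Hom_iff]
  show A: "A \<in> Obj C" and B: "B \<in> Obj C" and V: "vertex S \<in> Obj C"
    and i1: "in1 S \<in> Arr C" "Dom C (in1 S) = A" "Cod C (in1 S) = vertex S"
    and i2: "in2 S \<in> Arr C" "Dom C (in2 S) = B" "Cod C (in2 S) = vertex S"
    and p1: "pr1 S \<in> Arr C" "Dom C (pr1 S) = vertex S" "Cod C (pr1 S) = A"
    and p2: "pr2 S \<in> Arr C" "Dom C (pr2 S) = vertex S" "Cod C (pr2 S) = B"
    and e: "pr1 S \<cdot> in1 S = Ident C A" "pr2 S \<cdot> in2 S = Ident C B"
      "pr1 S \<cdot> in2 S = Zero C B A" "pr2 S \<cdot> in1 S = Zero C A B"
      "in1 S \<cdot> pr1 S \<boxplus> in2 S \<cdot> pr2 S = Ident C (vertex S)"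
    using * dom_obj[of "in1 S"] dom_obj[of "in2 S"] by auto
  note [simp] = A B i1 i2 p1 p2
  fix x assume x: "x \<in> Arr C"
  show "Cod C x = A \<Longrightarrow> pr1 S \<cdot> (in1 S \<cdot> x) = x" using comp_eq_reassoc[OF e(1) x] x by simp
  show "Cod C x = B \<Longrightarrow> pr2 S \<cdot> (in2 S \<cdot> x) = x" using comp_eq_reassoc[OF e(2) x] x by simp
  show "Cod C x = B \<Longrightarrow> pr1 S \<cdot> (in2 S \<cdot> x) = Zero C (Dom C x) A" using comp_eq_reassoc[OF e(3) x] x by simp
  show "Cod C x = A \<Longrightarrow> pr2 S \<cdot> (in1 S \<cdot> x) = Zero C (Dom C x) B" using comp_eq_reassoc[OF e(4) x] x by simp
qed

lemma biprod_expand: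
  assumes "is_biproduct C A B S" "x \<in> Arr C" "Cod C x = vertex S"
  shows "x = in1 S \<cdot> (pr1 S \<cdot> x) \<boxplus> in2 S \<cdot> (pr2 S \<cdot> x)"
proof -
  note [simp] = biprodD(1-15)[OF assms(1)]
  have "x = (in1 S \<cdot> pr1 S \<boxplus> in2 S \<cdot> pr2 S) \<cdot> x" using assms biprodD(20)[OF assms(1)] by simp
  then show ?thesis using assms(2,3) by simp
qed

lemma biprod_ext:
  assumes "is_biproduct C A B S" "x \<in> Arr C" "Cod C x = vertex S" "y \<in> Arr C" "Cod C y = vertex S"
    "pr1 S \<cdot> x = pr1 S \<cdot> y" "pr2 S \<cdot> x = pr2 S \<cdot> y"
  shows "x = y"
  using biprod_expand[OF assms(1-3)] biprod_expand[OF assms(1,4,5)] assms(6,7) by metis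

lemma add_contractible:
  assumes V: "is_complex C 0 N V" and k: "k < N"
    and S: "is_biproduct C (tm V k) A S" and S': "is_biproduct C (tm V (Suc k)) A S'"
  shows is_complex_add_contractible: "is_complex C 0 N (add_contractible C N V k S S')"
    and contractible_in_morphism: "is_cpx_morphism C 0 N V (add_contractible C N V k S S')
      (contractible_in C V k S S')"
    and contractible_pr_morphism: "is_cpx_morphism C 0 N (add_contractible C N V k S S') V
      (contractible_pr C V k S S')"
    and homotopy_equivalent_add_contractible:
      "homotopy_equivalent C N V (add_contractible C N V k S S')"
proof -
  note [simp] = cpxD[OF V] biprodD[OF S] biprodD[OF S']
  define \<iota> where "\<iota> = contractible_in C V k S S'"
  define \<pi> where "\<pi> = contractible_pr C V k S S'"
  define W where "W = add_contractible C N V k S S'"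
  \<comment> \<open>\<open>R\<close> is the new part of the differential, the identity of
    \<open>A\<close> between the two added summands.\<close>
  define R where "R j = (if j = k then in2 S \<cdot> pr2 S' else Zero C (tm W (Suc j)) (tm W j))" for j
  \<comment> \<open>The homotopy inverts \<open>R\<close>. Its sign arises because \<iota>\<pi> is
    the identity minus the idempotents belonging to the added summands.\<close>
  define h where "h j = (if j = k then Neg C (in2 S' \<cdot> pr2 S) else Zero C (tm W j) (tm W (Suc j)))" for j
  note defs = \<iota>_def \<pi>_def W_def contractible_in_def contractible_pr_def contractible_tm_def
    add_contractible_simps
  have tmW [simp]: "j \<le> N \<Longrightarrow> tm W j \<in> Obj C" for j by (simp add: defs)
  have \<iota> [simp]: "\<iota> j \<in> Arr C" "Dom C (\<iota> j) = tm V j" "Cod C (\<iota> j) = tm W j" if "j \<le> N" for j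
    using that by (simp_all add: defs)
  have \<pi> [simp]: "\<pi> j \<in> Arr C" "Cod C (\<pi> j) = tm V j" "Dom C (\<pi> j) = tm W j" if "j \<le> N" for j
    using that by (simp_all add: defs)
  have R [simp]: "R j \<in> Arr C" "Cod C (R j) = tm W j" "Dom C (R j) = tm W (Suc j)" if "j < N" for j
    using that by (simp_all add: R_def) (simp_all add: defs)
  have h [simp]: "h j \<in> Arr C" "Dom C (h j) = tm W j" "Cod C (h j) = tm W (Suc j)" if "j < N" for j
    using that by (simp_all add: h_def) (simp_all add: defs)
  have \<pi>\<iota>: "\<pi> j \<cdot> \<iota> j = Ident C (tm V j)" if "j \<le> N" for j
    using that by (simp add: defs)
  have \<pi>\<iota>x [simp]: "\<pi> j \<cdot> (\<iota> j \<cdot> x) = x" if "j \<le> N" "x \<in> Arr C" "Cod C x = tm V j" for j x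
    using comp_eq_reassoc[OF \<pi>\<iota>[OF that(1)] that(2)] that by simp
  have \<pi>R: "\<pi> j \<cdot> R j = Zero C (tm W (Suc j)) (tm V j)" if "j < N" for j
    using that tmW[of "Suc j"] by (cases "j = k") (simp_all add: R_def, simp add: defs)
  have \<pi>Rx [simp]: "\<pi> j \<cdot> (R j \<cdot> x) = Zero C (Dom C x) (tm V j)"
    if "j < N" "x \<in> Arr C" "Cod C x = tm W (Suc j)" for j x
    using comp_eq_reassoc[OF \<pi>R[OF that(1)] that(2)] that by simp
  have R\<iota>: "R j \<cdot> \<iota> (Suc j) = Zero C (tm V (Suc j)) (tm W j)" if "j < N" for j
    using that tmW[of j] by (cases "j = k") (simp_all add: R_def, simp add: defs)
  have R\<iota>x [simp]: "R j \<cdot> (\<iota> (Suc j) \<cdot> x) = Zero C (Dom C x) (tm W j)"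
    if "j < N" "x \<in> Arr C" "Cod C x = tm V (Suc j)" for j x
    using comp_eq_reassoc[OF R\<iota>[OF that(1)] that(2)] that by simp
  have RR: "R j \<cdot> R (Suc j) = Zero C (tm W (Suc (Suc j))) (tm W j)" if "Suc j < N" for j
    using that R[of j] R[of "Suc j"] by (cases "j = k") (auto simp: R_def[of j], simp add: R_def[of "Suc k"])
  have dfW: "df W (Suc j) = \<iota> j \<cdot> (df V (Suc j) \<cdot> \<pi> (Suc j)) \<boxplus> R j" if "j < N" for j
    using that by (simp add: R_def) (simp add: defs)
  show W: "is_complex C 0 N (add_contractible C N V k S S')"
    unfolding W_def[symmetric] is_complex_iff
  proof (intro conjI allI impI)
    fix j
    show "j \<le> N \<Longrightarrow> tm W j \<in> Obj C" by simp
    show "N < j \<Longrightarrow> tm W j = undefined" "j = 0 \<or> N < j \<Longrightarrow> df W j = undefined"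
      by (simp_all add: W_def add_contractible_simps)
    show "j < N \<Longrightarrow> df W (Suc j) \<in> Hom C (tm W (Suc j)) (tm W j)" by (simp add: dfW)
    show "Suc j < N \<Longrightarrow> df W (Suc j) \<cdot> df W (Suc (Suc j)) = Zero C (tm W (Suc (Suc j))) (tm W j)"
      by (simp add: dfW RR \<pi>R)
  qed
  then have W': "is_complex C 0 N W" by (simp add: W_def)
  show in_mor: "is_cpx_morphism C 0 N V (add_contractible C N V k S S') (contractible_in C V k S S')"
    unfolding W_def[symmetric] \<iota>_def[symmetric] is_cpx_morphism_iff
    by (simp add: dfW \<pi>\<iota> R\<iota>)
  show pr_mor: "is_cpx_morphism C 0 N (add_contractible C N V k S S') V (contractible_pr C V k S S')"
    unfolding W_def[symmetric] \<pi>_def[symmetric] is_cpx_morphism_iff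
    by (simp add: dfW \<pi>R)
  have hom1: "homotopic C N V V (\<lambda>j. \<pi> j \<cdot> \<iota> j) (\<lambda>j. Ident C (tm V j))"
    unfolding homotopic_def
    by (intro exI[of _ "\<lambda>j. Zero C (tm V j) (tm V (Suc j))"]) (auto simp: \<pi>\<iota> gr0_conv_Suc)
  have ip: "\<iota> j \<cdot> \<pi> j = Ident C (tm W j)" if "j \<noteq> k" "j \<noteq> Suc k" "j \<le> N" for j
    using that by (simp add: defs)
  have ipk: "\<iota> k \<cdot> \<pi> k = Ident C (tm W k) \<boxplus> Neg C (in2 S \<cdot> pr2 S)"
    "\<iota> (Suc k) \<cdot> \<pi> (Suc k) = Ident C (tm W (Suc k)) \<boxplus> Neg C (in2 S' \<cdot> pr2 S')"
    using k diff_eqI[OF biprodD(20)[OF S, symmetric]] diff_eqI[OF biprodD(20)[OF S', symmetric]]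
    by (simp_all add: defs)
  have dh: "df W (Suc j) \<cdot> h j = (if j = k then Neg C (in2 S \<cdot> pr2 S) else Zero C (tm W j) (tm W j))"
    if "j < N" for j
  proof (cases "j = k")
    case True
    have "tm W k = vertex S" "tm W (Suc k) = vertex S'" "\<pi> (Suc k) = pr1 S'" "\<iota> k = in1 S"
      using k by (simp_all add: defs)
    then show ?thesis using True k by (simp add: dfW h_def R_def)
  next
    case False
    then show ?thesis using that by (simp add: h_def cpxD[OF W'])
  qed
  have hd: "h j \<cdot> df W (Suc j) = (if j = k then Neg C (in2 S' \<cdot> pr2 S') else Zero C (tm W (Suc j)) (tm W (Suc j)))"
    if "j < N" for j
  proof (cases "j = k")
    case True
    have "tm W k = vertex S" "tm W (Suc k) = vertex S'" "\<pi> (Suc k) = pr1 S'" "\<iota> k = in1 S"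
      using k by (simp_all add: defs)
    then show ?thesis using True k by (simp add: dfW h_def R_def)
  next
    case False
    then show ?thesis using that by (simp add: h_def cpxD[OF W'])
  qed
  have Wk: "tm W k = vertex S" "tm W (Suc k) = vertex S'" using k by (simp_all add: defs)
  have hom2: "homotopic C N W W (\<lambda>j. \<iota> j \<cdot> \<pi> j) (\<lambda>j. Ident C (tm W j))"
    unfolding homotopic_def
  proof (intro exI[of _ h] conjI allI impI)
    fix j assume "j < N" then show "h j \<in> Hom C (tm W j) (tm W (j + 1))" by simp
  next
    fix j assume j: "j \<le> N"
    consider "j = k" | "j = Suc k" | "j \<noteq> k" "j \<noteq> Suc k" by blast
    then show "\<iota> j \<cdot> \<pi> j = Ident C (tm W j) \<boxplus>
        (if j < N then df W (j + 1) \<cdot> h j else Zero C (tm W j) (tm W j)) \<boxplus>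
        (if 0 < j then h (j - 1) \<cdot> df W j else Zero C (tm W j) (tm W j))"
    proof cases
      case 1
      have "(if 0 < k then h (k - 1) \<cdot> df W k else Zero C (tm W k) (tm W k)) = Zero C (tm W k) (tm W k)"
        using k hd[of "k - 1"] by (cases k) auto
      then show ?thesis using k unfolding 1 by (simp add: dh hd ipk) (simp add: Wk)
    next
      case 2
      then show ?thesis using k by (simp add: dh hd ipk Wk)
    next
      case 3
      then show ?thesis using j by (cases j) (simp_all add: dh hd ip)
    qed
  qed
  show "homotopy_equivalent C N V (add_contractible C N V k S S')"
    unfolding homotopy_equivalent_def
    using in_mor pr_mor hom1 hom2 unfolding \<iota>_def \<pi>_def W_def by blast
qed

end

section \<open>The last morphism of an enlarged complex; changes of biproduct\<close>

context pcat
begin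

text \<open>These two cases are the source of new deflations: the first adds an identity to the last
  morphism, the second a summand on which it vanishes.\<close>

lemma add_contractible_df1:
  assumes V: "is_complex C 0 N V"
  shows "0 < N \<Longrightarrow> is_biproduct C (tm V 0) A S \<Longrightarrow> is_biproduct C (tm V (Suc 0)) A S' \<Longrightarrow>
      df (add_contractible C N V 0 S S') (Suc 0) =
        in1 S \<cdot> (df V (Suc 0) \<cdot> pr1 S') \<boxplus> in2 S \<cdot> pr2 S'"
    and "Suc 0 < N \<Longrightarrow> is_biproduct C (tm V (Suc 0)) A S \<Longrightarrow>
      is_biproduct C (tm V (Suc (Suc 0))) A S' \<Longrightarrow>
      df (add_contractible C N V (Suc 0) S S') (Suc 0) = df V (Suc 0) \<cdot> pr1 S"
proof -
  note [simp] = cpxD[OF V] add_contractible_simps contractible_in_def contractible_pr_def contractible_tm_def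
  show "df (add_contractible C N V 0 S S') (Suc 0) =
        in1 S \<cdot> (df V (Suc 0) \<cdot> pr1 S') \<boxplus> in2 S \<cdot> pr2 S'"
    if "0 < N" "is_biproduct C (tm V 0) A S" "is_biproduct C (tm V (Suc 0)) A S'"
    using that biprodD[OF that(2)] biprodD[OF that(3)] by simp
  show "df (add_contractible C N V (Suc 0) S S') (Suc 0) = df V (Suc 0) \<cdot> pr1 S"
    if "Suc 0 < N" "is_biproduct C (tm V (Suc 0)) A S" "is_biproduct C (tm V (Suc (Suc 0))) A S'"
    using that biprodD[OF that(2)] biprodD[OF that(3)] by simp
qed

text \<open>An elementary matrix, used as a change of coordinates on the same vertex. The new first
  projection is the row \<open>[1 p]\<close> in the old coordinates, and the new second inclusion is
  annihilated by it.\<close>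

definition shear :: "('o, 'm) biproduct \<Rightarrow> 'm \<Rightarrow> ('o, 'm) biproduct" where
  "shear S p = S\<lparr>in2 := in2 S \<boxplus> Neg C (in1 S \<cdot> p), pr1 := pr1 S \<boxplus> p \<cdot> pr2 S\<rparr>"

lemma shear_simps [simp]:
  "vertex (shear S p) = vertex S" "in1 (shear S p) = in1 S" "pr2 (shear S p) = pr2 S"
  "in2 (shear S p) = in2 S \<boxplus> Neg C (in1 S \<cdot> p)" "pr1 (shear S p) = pr1 S \<boxplus> p \<cdot> pr2 S"
  by (simp_all add: shear_def)

lemma is_biproduct_shear:
  assumes S: "is_biproduct C A B S" and p: "p \<in> Hom C B A"
  shows "is_biproduct C A B (shear S p)"
proof -
  note [simp] = biprodD[OF S]
  have [simp]: "p \<in> Arr C" "Dom C p = B" "Cod C p = A" using p by auto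
  have "in1 S \<cdot> pr1 S \<boxplus> (in1 S \<cdot> (p \<cdot> pr2 S) \<boxplus> (in2 S \<cdot> pr2 S \<boxplus> Neg C (in1 S \<cdot> (p \<cdot> pr2 S)))) =
    Ident C (vertex S)"
    by (subst add_comm[of "in2 S \<cdot> pr2 S"]) simp_all
  then show ?thesis by (simp add: is_biproduct_def)
qed

definition swap_biproduct :: "('o, 'm) biproduct \<Rightarrow> ('o, 'm) biproduct" where
  "swap_biproduct S = \<lparr>vertex = vertex S, in1 = in2 S, in2 = in1 S, pr1 = pr2 S, pr2 = pr1 S\<rparr>"

lemma is_biproduct_swap:
  assumes S: "is_biproduct C A B S" shows "is_biproduct C B A (swap_biproduct S)"
proof -
  note [simp] = biprodD[OF S]
  have "in2 S \<cdot> pr2 S \<boxplus> in1 S \<cdot> pr1 S = Ident C (vertex S)"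
    by (subst add_comm) simp_all
  then show ?thesis by (simp add: is_biproduct_def swap_biproduct_def)
qed

lemma zero_object_hom:
  assumes "is_zero_object C z" "f \<in> Arr C" "g \<in> Arr C" "Dom C f = Dom C g" "Cod C f = Cod C g"
    "Dom C f = z \<or> Cod C f = z"
  shows "f = g"
proof -
  have *: "\<exists>!f. f \<in> Hom C A z" "\<exists>!f. f \<in> Hom C z A" if "A \<in> Obj C" for A
    using assms(1) that unfolding is_zero_object_def by blast+
  from assms(6) show ?thesis
  proof
    assume "Dom C f = z" then show ?thesis using *(2)[of "Cod C f"] assms by auto
  next
    assume "Cod C f = z" then show ?thesis using *(1)[of "Dom C f"] assms by auto
  qed
qed

lemma zero_object_obj: "is_zero_object C z \<Longrightarrow> z \<in> Obj C"
  by (simp add: is_zero_object_def)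

text \<open>An isomorphism \<open>u\<close> makes its target a biproduct of the zero object and its
  source. Taken as the target of the sum of a zero morphism and an identity, this biproduct turns
  the sum into \<open>u\<close>.\<close>

definition iso_biproduct :: "'o \<Rightarrow> 'm \<Rightarrow> 'm \<Rightarrow> ('o, 'm) biproduct" where
  "iso_biproduct z u v = \<lparr>vertex = Cod C u, in1 = Zero C z (Cod C u), in2 = u,
     pr1 = Zero C (Cod C u) z, pr2 = v\<rparr>"

lemma is_biproduct_iso_biproduct:
  assumes z: "is_zero_object C z" and "u \<in> Hom C A B" "v \<in> Hom C B A"
    "v \<cdot> u = Ident C A" "u \<cdot> v = Ident C B"
  shows "is_biproduct C z A (iso_biproduct z u v)"
proof -
  note [simp] = zero_object_obj[OF z]
  have AB [simp]: "u \<in> Arr C" "v \<in> Arr C" "Dom C u = A" "Cod C u = B" "Dom C v = B" "Cod C v = A"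
    using assms by auto
  then have [simp]: "A \<in> Obj C" "B \<in> Obj C" using dom_obj cod_obj by metis+
  have "Zero C z z = Ident C z" by (rule zero_object_hom[OF z]) simp_all
  then show ?thesis using assms(4,5) by (simp add: is_biproduct_def iso_biproduct_def)
qed

end

text \<open>Isolated as a predicate because its consequences are used in two settings: here the
  closure comes from homotopy invariance, there from weak isomorphisms or strict pullbacks.\<close>

definition closed_under_contractible ::
  "('o, 'm) cat \<Rightarrow> nat \<Rightarrow> nat \<Rightarrow> ('o, 'm) cpx set \<Rightarrow> bool" where
  "closed_under_contractible C N k \<X> \<longleftrightarrow> (\<forall>V\<in>\<X>. \<forall>A S S'. is_biproduct C (tm V k) A S \<and>
     is_biproduct C (tm V (Suc k)) A S' \<longrightarrow> add_contractible C N V k S S' \<in> \<X>)"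

section \<open>Deflations obtained by adding and splitting off contractible summands\<close>

context icat
begin

lemma obtain_biproduct:
  assumes "A \<in> Obj C" "B \<in> Obj C" obtains S where "is_biproduct C A B S"
  using ex_biproduct[OF assms] by blast

lemma zero_object: "is_zero_object C (zero_object C)"
  unfolding zero_object_def using ex_zero_object by (rule someI_ex)

lemma biprod: "A \<in> Obj C \<Longrightarrow> B \<in> Obj C \<Longrightarrow> is_biproduct C A B (biprod C A B)"
  unfolding biprod_def using ex_biproduct by (rule someI_ex)

lemma is_complex_zero_complex: "is_complex C 0 N (zero_complex C N)"
  using zero_object_obj[OF zero_object] by (auto simp: is_complex_iff zero_complex_def)

lemma iso_in_deflations:
  assumes zero: "zero_complex C (Suc n) \<in> \<X>" and cl: "closed_under_contractible C (Suc n) 0 \<X>"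
    and u: "u \<in> Hom C A B" "v \<in> Hom C B A" "v \<cdot> u = Ident C A" "u \<cdot> v = Ident C B"
  shows "\<exists>Z\<in>\<X>. is_complex C 0 (Suc n) Z \<and> df Z (Suc 0) = u"
proof -
  have [simp]: "u \<in> Arr C" "v \<in> Arr C" "Dom C u = A" "Cod C u = B" "Dom C v = B" "Cod C v = A"
    using u by auto
  then have [simp]: "A \<in> Obj C" "B \<in> Obj C" using dom_obj cod_obj by metis+
  define z where "z = zero_object C"
  have z: "is_zero_object C z" unfolding z_def by (rule zero_object)
  note [simp] = zero_object_obj[OF z]
  let ?S = "iso_biproduct z u v" and ?S' = "iso_biproduct z (Ident C A) (Ident C A)"
  have S: "is_biproduct C z A ?S" by (rule is_biproduct_iso_biproduct[OF z u])
  have S': "is_biproduct C z A ?S'" by (rule is_biproduct_iso_biproduct[OF z]) auto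
  note Z = is_complex_zero_complex[of "Suc n"]
  have [simp]: "tm (zero_complex C (Suc n)) 0 = z" "tm (zero_complex C (Suc n)) (Suc 0) = z"
    "df (zero_complex C (Suc n)) (Suc 0) = Zero C z z"
    by (simp_all add: zero_complex_def z_def)
  let ?W = "add_contractible C (Suc n) (zero_complex C (Suc n)) 0 ?S ?S'"
  have "?W \<in> \<X>" using cl zero S S' unfolding closed_under_contractible_def by auto
  moreover have "is_complex C 0 (Suc n) ?W"
    by (rule is_complex_add_contractible[OF Z]) (use S S' in auto)
  moreover have "df ?W (Suc 0) = u"
    by (subst add_contractible_df1(1)[OF Z, of A]) (use S S' in \<open>auto simp: iso_biproduct_def\<close>)
  ultimately show ?thesis by blast
qed

text \<open>The row \<open>[v p]\<close> is the sum of \<open>v\<close> and an identity, followed by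
  \<open>[1 p]\<close>. The first factor arises from a contractible summand in degrees 1 and 0, the
  second from one in degrees 2 and 1.\<close>

lemma deflation_row:
  assumes n: "0 < n" and cpx: "\<And>X. X \<in> \<X> \<Longrightarrow> is_complex C 0 (Suc n) X"
    and zero: "zero_complex C (Suc n) \<in> \<X>" and comp: "closed_under_composition C (deflations \<X>)"
    and cl0: "closed_under_contractible C (Suc n) 0 \<X>"
    and cl1: "closed_under_contractible C (Suc n) (Suc 0) \<X>"
    and v: "v \<in> deflations \<X>" and p: "p \<in> Arr C" "Cod C p = Cod C v"
    and S: "is_biproduct C (Dom C v) (Dom C p) S"
  shows "v \<cdot> pr1 S \<boxplus> p \<cdot> pr2 S \<in> deflations \<X>"
proof -
  obtain X where X: "X \<in> \<X>" "v = df X (Suc 0)" using v by (auto simp: deflations_def)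
  note Xc = cpx[OF X(1)]
  note [simp] = cpxD[OF Xc] biprodD[OF S]
  have vt [simp]: "v \<in> Arr C" "Dom C v = tm X (Suc 0)" "Cod C v = tm X 0" "Cod C p = tm X 0"
    using X(2) p by auto
  note [simp] = p(1)
  define A where "A = tm X 0"
  define B where "B = Dom C p"
  have AB: "A \<in> Obj C" "B \<in> Obj C" by (simp_all add: A_def B_def)
  obtain T where T: "is_biproduct C A B T" using obtain_biproduct[OF AB] .
  note [simp] = biprodD[OF T]
  let ?X' = "add_contractible C (Suc n) X 0 T S"
  have "?X' \<in> \<X>" using cl0 X(1) T S unfolding closed_under_contractible_def A_def B_def by auto
  moreover have "df ?X' (Suc 0) = in1 T \<cdot> (v \<cdot> pr1 S) \<boxplus> in2 T \<cdot> pr2 S"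
    unfolding X(2) by (rule add_contractible_df1(1)[OF Xc, of B]) (use T S in \<open>auto simp: A_def B_def\<close>)
  ultimately have 1: "in1 T \<cdot> (v \<cdot> pr1 S) \<boxplus> in2 T \<cdot> pr2 S \<in> deflations \<X>"
    unfolding deflations_def by force
  \<comment> \<open>A conflation ending in the identity of \<open>A\<close>: adding
    \<open>B = B\<close> in degrees 2 and 1, with the sheared biproduct in degree 1, makes its last
    morphism \<open>[1 p]\<close>.\<close>
  obtain Z where Z: "Z \<in> \<X>" "is_complex C 0 (Suc n) Z" "df Z (Suc 0) = Ident C A"
    using iso_in_deflations[OF zero cl0, of "Ident C A" A A "Ident C A"] AB by auto
  have Z1: "tm Z (Suc 0) = A" using cpxD(3)[OF Z(2), of 0] Z(3) AB by simp
  have "tm Z (Suc (Suc 0)) \<in> Obj C" using cpxD(1)[OF Z(2)] n by auto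
  from obtain_biproduct[OF this AB(2)] obtain T2 where T2: "is_biproduct C (tm Z (Suc (Suc 0))) B T2" .
  have T1: "is_biproduct C (tm Z (Suc 0)) B (shear T p)" unfolding Z1
    by (rule is_biproduct_shear[OF T]) (simp add: A_def B_def)
  let ?Z' = "add_contractible C (Suc n) Z (Suc 0) (shear T p) T2"
  have "?Z' \<in> \<X>" using cl1 Z(1) T1 T2 unfolding closed_under_contractible_def by blast
  moreover have "df ?Z' (Suc 0) = pr1 T \<boxplus> p \<cdot> pr2 T"
    by (subst add_contractible_df1(2)[OF Z(2) _ T1 T2]) (use n Z in \<open>auto simp: A_def B_def\<close>)
  ultimately have 2: "pr1 T \<boxplus> p \<cdot> pr2 T \<in> deflations \<X>"
    unfolding deflations_def by force
  have "(pr1 T \<boxplus> p \<cdot> pr2 T) \<cdot> (in1 T \<cdot> (v \<cdot> pr1 S) \<boxplus> in2 T \<cdot> pr2 S) \<in> deflations \<X>"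
    using comp[unfolded closed_under_composition_def, rule_format, OF 1 2]
    by (simp add: A_def B_def)
  then show ?thesis by (simp add: A_def B_def)
qed

text \<open>Being killed by the last differential, \<open>K\<close> lifts to degree 2 and is a
  direct summand there as well. Removing both copies of \<open>K\<close> undoes the addition of a
  contractible summand.\<close>

lemma split_off_kernel:
  assumes W: "left_n_exact C n W" and n: "0 < n"
    and S: "is_biproduct C A K S" and v: "vertex S = tm W (Suc 0)"
    and ker: "df W (Suc 0) \<cdot> in2 S = Zero C K (tm W 0)"
  shows "\<exists>V. is_complex C 0 (Suc n) V \<and> homotopy_equivalent C (Suc n) W V \<and>
    df V (Suc 0) = df W (Suc 0) \<cdot> in1 S"
proof -
  note Wc = lex_complex[OF W]
  note [simp] = cpxD[OF Wc] biprodD(1-19,21-)[OF S]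
  note [simp] = v
  define d1 where "d1 = df W (Suc 0)"
  define d2 where "d2 = df W (Suc (Suc 0))"
  define d3 where "d3 = df W (Suc (Suc (Suc 0)))"
  have d1 [simp]: "d1 \<in> Arr C" "Dom C d1 = tm W (Suc 0)" "Cod C d1 = tm W 0" by (simp_all add: d1_def)
  have d2 [simp]: "d2 \<in> Arr C" "Dom C d2 = tm W (Suc (Suc 0))" "Cod C d2 = tm W (Suc 0)"
    using n by (simp_all add: d2_def)
  have [simp]: "tm W (Suc (Suc 0)) \<in> Obj C" using n by simp
  have d12: "d1 \<cdot> d2 = Zero C (tm W (Suc (Suc 0))) (tm W 0)"
    using n by (simp add: d1_def d2_def)
  have d12x [simp]: "d1 \<cdot> (d2 \<cdot> x) = Zero C (Dom C x) (tm W 0)"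
    if "x \<in> Arr C" "Cod C x = tm W (Suc (Suc 0))" for x
    using comp_eq_reassoc[OF d12 that(1)] that by simp
  have ker': "d1 \<cdot> in2 S = Zero C K (tm W 0)" using ker by (simp add: d1_def)
  have ker'x [simp]: "d1 \<cdot> (in2 S \<cdot> x) = Zero C (Dom C x) (tm W 0)"
    if "x \<in> Arr C" "Cod C x = K" for x
    using comp_eq_reassoc[OF ker' that(1)] that by simp
  obtain s where s [simp]: "s \<in> Arr C" "Dom C s = K" "Cod C s = tm W (Suc (Suc 0))" and d2s: "d2 \<cdot> s = in2 S"
    using lex_lift[OF W n, of "in2 S"] ker by (auto simp: d2_def)
  have d2sx [simp]: "d2 \<cdot> (s \<cdot> x) = in2 S \<cdot> x" if "x \<in> Arr C" "Cod C x = K" for x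
    using comp_eq_reassoc[OF d2s that(1)] that by simp
  let ?q = "pr2 S \<cdot> d2"
  \<comment> \<open>\<open>pr2 S \<cdot> d2 \<cdot> s\<close> is the identity of \<open>K\<close>,
    hence \<open>s \<cdot> pr2 S \<cdot> d2\<close> is idempotent. Splitting its complement
    \<open>?e\<close> yields the part \<open>L\<close> of degree 2 that is kept.\<close>
  let ?e = "Ident C (tm W (Suc (Suc 0))) \<boxplus> Neg C (s \<cdot> (pr2 S \<cdot> d2))"
  have "?e \<cdot> ?e = ?e" by simp
  then obtain L r t where L: "L \<in> Obj C" and r: "r \<in> Hom C (tm W (Suc (Suc 0))) L"
    and t: "t \<in> Hom C L (tm W (Suc (Suc 0)))" and rt: "r \<cdot> t = Ident C L" and tr: "t \<cdot> r = ?e"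
    using idempotents_split[of "tm W (Suc (Suc 0))" ?e] by auto
  have r' [simp]: "r \<in> Arr C" "Dom C r = tm W (Suc (Suc 0))" "Cod C r = L" using r by auto
  have t' [simp]: "t \<in> Arr C" "Dom C t = L" "Cod C t = tm W (Suc (Suc 0))" using t by auto
  note [simp] = L
  have rtx [simp]: "r \<cdot> (t \<cdot> x) = x" if "x \<in> Arr C" "Cod C x = L" for x
    using comp_eq_reassoc[OF rt that(1)] that by simp
  have trx: "t \<cdot> (r \<cdot> x) = x \<boxplus> Neg C (s \<cdot> (pr2 S \<cdot> (d2 \<cdot> x)))"
    if "x \<in> Arr C" "Cod C x = tm W (Suc (Suc 0))" for x
    using comp_eq_reassoc[OF tr that(1)] that by simp
  have "r \<cdot> s = r \<cdot> (t \<cdot> (r \<cdot> s))" by simp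
  also have "t \<cdot> (r \<cdot> s) = Zero C K (tm W (Suc (Suc 0)))" by (subst trx) (simp_all add: d2s)
  finally have rs: "r \<cdot> s = Zero C K L" by simp
  have "?q \<cdot> t = ?q \<cdot> (t \<cdot> r \<cdot> t)" by (simp add: rt)
  also have "t \<cdot> r \<cdot> t = ?e \<cdot> t" by (simp only: tr)
  also have "?q \<cdot> (?e \<cdot> t) = Zero C L K" by simp
  finally have qt: "pr2 S \<cdot> (d2 \<cdot> t) = Zero C L K" by simp
  define S' where "S' = \<lparr>vertex = tm W (Suc (Suc 0)), in1 = t, in2 = s, pr1 = r, pr2 = ?q\<rparr>"
  have S': "is_biproduct C L K S'"
    unfolding is_biproduct_def S'_def using rs qt rt by (simp add: tr d2s)
  \<comment> \<open>The differentials are compressed to the complements \<open>A\<close> and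
    \<open>L\<close>; the third differential changes in its target alone.\<close>
  define V where "V = \<lparr>tm = (\<lambda>j\<in>{0..Suc n}. if j = Suc 0 then A else if j = Suc (Suc 0) then L else tm W j),
    df = (\<lambda>j\<in>{0<..Suc n}. if j = Suc 0 then d1 \<cdot> in1 S
        else if j = Suc (Suc 0) then pr1 S \<cdot> (d2 \<cdot> t)
        else if j = Suc (Suc (Suc 0)) then r \<cdot> d3 else df W j)\<rparr>"
  have V_simps: "j \<le> Suc n \<Longrightarrow> tm V j = (if j = Suc 0 then A else if j = Suc (Suc 0) then L else tm W j)"
    "0 < j \<Longrightarrow> j \<le> Suc n \<Longrightarrow> df V j = (if j = Suc 0 then d1 \<cdot> in1 S
        else if j = Suc (Suc 0) then pr1 S \<cdot> (d2 \<cdot> t)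
        else if j = Suc (Suc (Suc 0)) then r \<cdot> d3 else df W j)"
    "j > Suc n \<Longrightarrow> tm V j = undefined" "j = 0 \<or> j > Suc n \<Longrightarrow> df V j = undefined" for j
    by (auto simp: V_def)
  have d3 [simp]: "d3 \<in> Arr C" "Dom C d3 = tm W (Suc (Suc (Suc 0)))" "Cod C d3 = tm W (Suc (Suc 0))"
    if "Suc 0 < n" using that by (simp_all add: d3_def)
  have d23 [simp]: "d2 \<cdot> d3 = Zero C (tm W (Suc (Suc (Suc 0)))) (tm W (Suc 0))" if "Suc 0 < n"
    using that by (simp add: d2_def d3_def)
  have four: "j = 0 \<or> j = Suc 0 \<or> j = Suc (Suc 0) \<or> (\<exists>i. j = Suc (Suc (Suc i)))" for j
    by (metis not0_implies_Suc)
  have in1pr1: "in1 S \<cdot> (pr1 S \<cdot> x) = x \<boxplus> Neg C (in2 S \<cdot> (pr2 S \<cdot> x))"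
    if "x \<in> Arr C" "Cod C x = tm W (Suc 0)" for x
    by (rule diff_eqI[symmetric, OF biprod_expand[OF S]]) (use that v in simp_all)
  have V: "is_complex C 0 (Suc n) V"
    unfolding is_complex_iff
  proof (intro conjI allI impI)
    fix j
    show "j \<le> Suc n \<Longrightarrow> tm V j \<in> Obj C" by (simp add: V_simps)
    show "Suc n < j \<Longrightarrow> tm V j = undefined" "j = 0 \<or> Suc n < j \<Longrightarrow> df V j = undefined"
      by (simp_all add: V_simps)
    show "j < Suc n \<Longrightarrow> df V (Suc j) \<in> Hom C (tm V (Suc j)) (tm V j)"
      using four[of j] by (elim disjE exE) (simp_all add: V_simps)
    show "Suc j < Suc n \<Longrightarrow> df V (Suc j) \<cdot> df V (Suc (Suc j)) = Zero C (tm V (Suc (Suc j))) (tm V j)"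
      using four[of j]
    proof (elim disjE exE)
      assume "Suc j < Suc n" "j = 0"
      then show ?thesis by (simp add: V_simps in1pr1)
    next
      assume "Suc j < Suc n" "j = Suc 0"
      then show ?thesis by (simp add: V_simps trx)
    next
      assume "Suc j < Suc n" "j = Suc (Suc 0)"
      then show ?thesis by (simp add: V_simps d3_def)
    next
      fix i assume "Suc j < Suc n" "j = Suc (Suc (Suc i))"
      then show ?thesis by (simp add: V_simps)
    qed
  qed
  have SV: "is_biproduct C (tm V (Suc 0)) K S" "is_biproduct C (tm V (Suc (Suc 0))) K S'"
    using S S' n by (simp_all add: V_simps)
  \<comment> \<open>Equality, rather than isomorphism, allows the homotopy equivalence for added
    summands to be quoted directly.\<close>
  have eq: "add_contractible C (Suc n) V (Suc 0) S S' = W"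
  proof (rule cpx.equality)
    show "tm (add_contractible C (Suc n) V (Suc 0) S S') = tm W"
    proof
      fix j show "tm (add_contractible C (Suc n) V (Suc 0) S S') j = tm W j"
        using Wc[unfolded is_complex_iff] v
        by (cases "j \<le> Suc n") (simp_all add: add_contractible_simps contractible_tm_def V_simps S'_def)
    qed
    show "df (add_contractible C (Suc n) V (Suc 0) S S') = df W"
    proof
      fix j show "df (add_contractible C (Suc n) V (Suc 0) S S') j = df W j"
      proof (cases "j = 0 \<or> Suc n < j")
        case True
        then show ?thesis using Wc[unfolded is_complex_iff] by (auto simp: add_contractible_simps)
      next
        case False
        then obtain i where i: "j = Suc i" "i < Suc n" by (cases j) auto
        note defs = add_contractible_simps contractible_in_def contractible_pr_def contractible_tm_def V_simps
        show ?thesis using four[of i]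
        proof (elim disjE exE)
          assume "i = 0"
          moreover have "d1 \<cdot> (in1 S \<cdot> pr1 S) = d1"
          proof -
            have "in1 S \<cdot> pr1 S = Ident C (vertex S) \<boxplus> Neg C (in2 S \<cdot> pr2 S)"
              by (rule diff_eqI[symmetric, OF biprodD(20)[OF S, symmetric]]) simp_all
            then show ?thesis by (simp add: v)
          qed
          ultimately show ?thesis using n by (simp add: i defs v d1_def)
        next
          assume 1: "i = Suc 0"
          have "d2 \<cdot> (t \<cdot> r) = d2 \<boxplus> Neg C (in2 S \<cdot> (pr2 S \<cdot> d2))" unfolding tr by simp
          then have "in1 S \<cdot> (pr1 S \<cdot> (d2 \<cdot> (t \<cdot> r))) = in1 S \<cdot> (pr1 S \<cdot> d2)" by simp
          then show ?thesis using 1 n biprod_expand[OF S, of d2] v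
            by (simp add: i defs S'_def) (simp add: d2_def)
        next
          assume 2: "i = Suc (Suc 0)"
          then show ?thesis using i n by (simp add: defs S'_def trx) (simp add: d3_def)
        next
          fix l assume "i = Suc (Suc (Suc l))"
          then show ?thesis using i n by (simp add: defs)
        qed
      qed
    qed
  qed simp
  have "homotopy_equivalent C (Suc n) V W"
    using homotopy_equivalent_add_contractible[OF V _ SV] n unfolding eq by simp
  then show ?thesis using V homotopy_equivalent_sym by (auto simp: V_simps d1_def)
qed

end

section \<open>Gluing complexes along a differential\<close>

text \<open>The splice is a common comparison object for two sequences related by isomorphisms in
  adjacent degrees: it shares its lower end with one and its upper end with the other.\<close>

definition glue :: "nat \<Rightarrow> nat \<Rightarrow> 'm \<Rightarrow> ('o, 'm) cpx \<Rightarrow> ('o, 'm) cpx \<Rightarrow> ('o, 'm) cpx" where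
  "glue N k c Y X =
    \<lparr>tm = (\<lambda>j\<in>{0..N}. if j \<le> k then tm Y j else tm X j),
     df = (\<lambda>j\<in>{0<..N}. if j \<le> k then df Y j else if j = Suc k then c else df X j)\<rparr>"

lemma glue_simps:
  "j \<le> N \<Longrightarrow> tm (glue N k c Y X) j = (if j \<le> k then tm Y j else tm X j)"
  "j < N \<Longrightarrow> df (glue N k c Y X) (Suc j) =
     (if Suc j \<le> k then df Y (Suc j) else if j = k then c else df X (Suc j))"
  "N < j \<Longrightarrow> tm (glue N k c Y X) j = undefined"
  "j = 0 \<or> N < j \<Longrightarrow> df (glue N k c Y X) j = undefined"
  by (auto simp: glue_def)

text \<open>Reversal exchanges the two parts, so that comparing a splice with \<open>Y\<close> in
  the opposite category amounts to comparing it with \<open>X\<close>.\<close>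

lemma revc_glue:
  assumes "k \<le> n"
  shows "revc (Suc n) (glue (Suc n) k c Y X) = glue (Suc n) (n - k) c (revc (Suc n) X) (revc (Suc n) Y)"
proof (rule cpx.equality)
  show "tm (revc (Suc n) (glue (Suc n) k c Y X)) = tm (glue (Suc n) (n - k) c (revc (Suc n) X) (revc (Suc n) Y))"
    using assms by (auto simp: revc_def glue_def restrict_def fun_eq_iff)
  show "df (revc (Suc n) (glue (Suc n) k c Y X)) = df (glue (Suc n) (n - k) c (revc (Suc n) X) (revc (Suc n) Y))"
    using assms by (auto simp: revc_def glue_def restrict_def fun_eq_iff)
qed simp

context pcat
begin

text \<open>Exactness crosses the splice along the split arrows: \<open>u'\<close> shows that a
  cycle for \<open>c\<close> is a cycle of \<open>X\<close>, and \<open>v\<close> carries lifts in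
  \<open>Y\<close> to lifts through \<open>c\<close>.\<close>

lemma glue:
  assumes Y: "left_n_exact C n Y" and X: "left_n_exact C n X" and k: "k \<le> n"
    and u: "u \<in> Hom C (tm X k) (tm Y k)" "u' \<in> Hom C (tm Y k) (tm X k)" "u' \<cdot> u = Ident C (tm X k)"
    and v: "v \<in> Hom C (tm Y (Suc k)) (tm X (Suc k))" "v' \<in> Hom C (tm X (Suc k)) (tm Y (Suc k))"
      "v \<cdot> v' = Ident C (tm X (Suc k))"
    and c: "c = u \<cdot> df X (Suc k)" "c \<cdot> v = df Y (Suc k)"
  shows left_n_exact_glue: "left_n_exact C n (glue (Suc n) k c Y X)"
    and homotopy_equivalent_glue: "homotopy_equivalent C (Suc n) Y (glue (Suc n) k c Y X)"
proof -
  note Yc = lex_complex[OF Y] and Xc = lex_complex[OF X]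
  note [simp] = cpxD[OF Yc] cpxD[OF Xc]
  define Z where "Z = glue (Suc n) k c Y X"
  note Zs = glue_simps[where N = "Suc n" and k = k and c = c and Y = Y and X = X, folded Z_def]
  have [simp]: "u \<in> Arr C" "Dom C u = tm X k" "Cod C u = tm Y k"
    "u' \<in> Arr C" "Dom C u' = tm Y k" "Cod C u' = tm X k"
    "v \<in> Arr C" "Dom C v = tm Y (Suc k)" "Cod C v = tm X (Suc k)"
    "v' \<in> Arr C" "Dom C v' = tm X (Suc k)" "Cod C v' = tm Y (Suc k)"
    using u v by auto
  have ct [simp]: "c \<in> Arr C" "Dom C c = tm X (Suc k)" "Cod C c = tm Y k"
    using k by (simp_all add: c(1))
  have u'c: "u' \<cdot> (c \<cdot> x) = df X (Suc k) \<cdot> x" if "x \<in> Arr C" "Cod C x = tm X (Suc k)" for x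
    using comp_eq_reassoc[OF u(3), of "df X (Suc k) \<cdot> x"] that k by (simp add: c(1))
  have cv': "df Y (Suc k) \<cdot> v' = c" unfolding c(2)[symmetric] using k v(3) by simp
  have cvx: "c \<cdot> (v \<cdot> x) = df Y (Suc k) \<cdot> x" if "x \<in> Arr C" "Cod C x = tm Y (Suc k)" for x
    using comp_eq_reassoc[OF c(2), of x] that by simp
  have dc: "df Y (Suc j) \<cdot> c = Zero C (tm X (Suc k)) (tm Y j)" if "k = Suc j" for j
    unfolding cv'[symmetric] using that k by simp
  have Zc: "is_complex C 0 (Suc n) Z"
    unfolding is_complex_iff
  proof (intro conjI allI impI)
    fix j
    show "j \<le> Suc n \<Longrightarrow> tm Z j \<in> Obj C" by (simp add: Zs)
    show "Suc n < j \<Longrightarrow> tm Z j = undefined" "j = 0 \<or> Suc n < j \<Longrightarrow> df Z j = undefined"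
      by (simp_all add: Zs)
    show "j < Suc n \<Longrightarrow> df Z (Suc j) \<in> Hom C (tm Z (Suc j)) (tm Z j)"
      by (auto simp: Zs)
    assume j: "Suc j < Suc n"
    consider "Suc (Suc j) \<le> k" | "k = Suc j" | "k = j" | "k < j" by linarith
    then show "df Z (Suc j) \<cdot> df Z (Suc (Suc j)) = Zero C (tm Z (Suc (Suc j))) (tm Z j)"
    proof cases
      case 3
      then show ?thesis using j by (simp add: Zs) (simp add: c(1))
    qed (use j dc in \<open>auto simp: Zs\<close>)
  qed
  show "left_n_exact C n (glue (Suc n) k c Y X)"
    unfolding Z_def[symmetric] left_n_exact_iff
  proof (intro conjI Zc ballI allI impI; (elim conjE)?)
    fix h assume h: "h \<in> Arr C" "Cod C h = tm Z (Suc n)" "df Z (Suc n) \<cdot> h = Zero C (Dom C h) (tm Z n)"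
    have "df X (Suc n) \<cdot> h = Zero C (Dom C h) (tm X n)"
    proof (cases "k = n")
      case True
      then have "u' \<cdot> (c \<cdot> h) = u' \<cdot> Zero C (Dom C h) (tm Y k)" using h by (simp add: Zs)
      then show ?thesis using u'c[of h] h True by (simp add: Zs)
    next
      case False
      then show ?thesis using h k by (simp add: Zs)
    qed
    then have "h = Zero C (Dom C h) (tm X (Suc n))"
      using h k by (intro lex_top[OF X]) (simp_all add: Zs)
    moreover have "tm Z (Suc n) = tm X (Suc n)" using k by (simp add: Zs)
    ultimately show "h = Zero C (Dom C h) (tm Z (Suc n))" by metis
  next
    fix j h assume j: "j < n" and h: "h \<in> Arr C" "Cod C h = tm Z (Suc j)"
      "df Z (Suc j) \<cdot> h = Zero C (Dom C h) (tm Z j)"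
    consider "Suc (Suc j) \<le> k" | "k = Suc j" | "k = j" | "k < j" by linarith
    then show "\<exists>w\<in>Hom C (Dom C h) (tm Z (Suc (Suc j))). df Z (Suc (Suc j)) \<cdot> w = h"
    proof cases
      case 1
      then have "Cod C h = tm Y (Suc j)" "df Y (Suc j) \<cdot> h = Zero C (Dom C h) (tm Y j)"
        using h(2,3) j by (simp_all add: Zs)
      from lex_lift[OF Y j h(1) this] show ?thesis using 1 j by (simp add: Zs Bex_def)
    next
      case 2
      then have "\<exists>w. w \<in> Arr C \<and> Dom C w = Dom C h \<and> Cod C w = tm Y (Suc (Suc j)) \<and> df Y (Suc (Suc j)) \<cdot> w = h"
        by (intro lex_lift[OF Y j h(1)]) (use h(2,3) j in \<open>simp_all add: Zs\<close>)
      then obtain w where w: "w \<in> Arr C" "Dom C w = Dom C h" "Cod C w = tm Y (Suc k)" "df Y (Suc k) \<cdot> w = h"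
        using 2 by auto
      then have "c \<cdot> (v \<cdot> w) = h" by (simp add: cvx)
      then show ?thesis using w 2 j by (intro bexI[of _ "v \<cdot> w"]) (simp_all add: Zs)
    next
      case 3
      then have "u' \<cdot> (c \<cdot> h) = u' \<cdot> Zero C (Dom C h) (tm Y k)" using h j by (simp add: Zs)
      then have "df X (Suc j) \<cdot> h = Zero C (Dom C h) (tm X j)" using u'c[of h] h 3 j by (simp add: Zs)
      moreover have "Cod C h = tm X (Suc j)" using h(2) j 3 by (simp add: Zs)
      ultimately have "\<exists>w. w \<in> Arr C \<and> Dom C w = Dom C h \<and> Cod C w = tm X (Suc (Suc j)) \<and> df X (Suc (Suc j)) \<cdot> w = h"
        by (intro lex_lift[OF X j h(1)])
      then show ?thesis using 3 j by (simp add: Zs Bex_def)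
    next
      case 4
      then have "Cod C h = tm X (Suc j)" "df X (Suc j) \<cdot> h = Zero C (Dom C h) (tm X j)"
        using h(2,3) j by (simp_all add: Zs)
      from lex_lift[OF X j h(1) this] show ?thesis using 4 j by (simp add: Zs Bex_def)
    qed
  qed
  then have Zl: "left_n_exact C n Z" by (simp add: Z_def)
  show "homotopy_equivalent C (Suc n) Y (glue (Suc n) k c Y X)"
    unfolding Z_def[symmetric]
  \<comment> \<open>For \<open>k = 0\<close> the last morphism becomes \<open>c\<close>, compared
    with that of \<open>Y\<close> by \<open>v\<close> and \<open>v'\<close>; otherwise the last
    morphism is that of \<open>Y\<close>.\<close>
  proof (cases k)
    case 0
    show "homotopy_equivalent C (Suc n) Y Z"
      by (rule homotopy_equivalent_if_iso_square[OF Y Zl, of "Ident C (tm Y 0)" v "Ident C (tm Y 0)" v'])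
        (use 0 c(2) cv' ct in \<open>simp_all add: Zs\<close>)
  next
    case (Suc j)
    show "homotopy_equivalent C (Suc n) Y Z"
      by (rule homotopy_equivalent_if_iso_square[OF Y Zl, of "Ident C (tm Y 0)" "Ident C (tm Y (Suc 0))"
           "Ident C (tm Y 0)" "Ident C (tm Y (Suc 0))"])
        (use Suc in \<open>simp_all add: Zs\<close>)
  qed
qed

end

section \<open>An elementary self-dual form of the axioms\<close>

text \<open>Phrased for a set of arrows of any category, so that the dual condition is the same one
  for \<open>opc C\<close>.\<close>

definition pulls_back :: "('o, 'm) cat \<Rightarrow> 'm set \<Rightarrow> bool" where
  "pulls_back C D \<longleftrightarrow> (\<forall>d\<in>D. \<forall>g\<in>Arr C. Cod C g = Cod C d \<longrightarrow>
    (\<exists>q\<in>D. \<exists>p\<in>Arr C. Dom C p = Dom C q \<and> Cod C p = Dom C d \<and> Cod C q = Dom C g \<and>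
      d \<cdot>\<^bsub>C\<^esub> p = g \<cdot>\<^bsub>C\<^esub> q))"

locale elementary_structure = icat C for C :: "('o, 'm) cat" (structure) +
  fixes n :: nat and \<X> :: "('o, 'm) cpx set"
  assumes n_pos: "0 < n"
    and exact: "X \<in> \<X> \<Longrightarrow> n_exact C n X"
    and homotopy_closed: "X \<in> \<X> \<Longrightarrow> is_complex C 0 (Suc n) Y \<Longrightarrow>
          homotopy_equivalent C (Suc n) X Y \<Longrightarrow> Y \<in> \<X>"
    and zero_mem: "zero_complex C (Suc n) \<in> \<X>"
    and deflations_comp: "closed_under_composition C (deflations \<X>)"
    and inflations_comp: "closed_under_composition C (inflations n \<X>)"
    and pull: "pulls_back C (deflations \<X>)"
    and push: "pulls_back (opc C) (inflations n \<X>)"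

section \<open>Passing to the opposite structure\<close>

lemma deflations_revc: "deflations (revc (Suc n) ` \<X>) = inflations n \<X>"
  by (simp add: deflations_def inflations_def image_image revc_simps)

lemma inflations_revc: "inflations n (revc (Suc n) ` \<X>) = deflations \<X>"
  by (simp add: deflations_def inflations_def image_image revc_simps)

lemma closed_under_composition_opc:
  "closed_under_composition C M \<Longrightarrow> closed_under_composition (opc C) M"
  by (auto simp: closed_under_composition_def)

lemma zero_complex_opc: "zero_complex (opc C) N = revc N (zero_complex C N)"
  by (auto simp: zero_complex_def revc_def restrict_def fun_eq_iff)

text \<open>Reversal is injective on complexes, since their values outside the range are
  fixed.\<close>

lemma revc_mem_iff:
  assumes \<X>: "\<And>X. X \<in> \<X> \<Longrightarrow> is_complex C 0 N X" and Z: "is_complex C 0 N Z"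
  shows "revc N Z \<in> revc N ` \<X> \<longleftrightarrow> Z \<in> \<X>"
proof
  assume "revc N Z \<in> revc N ` \<X>"
  then obtain X where X: "X \<in> \<X>" "revc N Z = revc N X" by (rule imageE)
  have "Z = X"
    using revc_revc[OF Z] revc_revc[OF \<X>[OF X(1)]] unfolding X(2) by (rule subst)
  then show "Z \<in> \<X>" using X(1) by simp
qed (rule imageI)

context elementary_structure
begin

lemma mem_complex: "X \<in> \<X> \<Longrightarrow> is_complex C 0 (Suc n) X"
  using exact n_exact_complex by blast

lemma mem_left: "X \<in> \<X> \<Longrightarrow> left_n_exact C n X"
  using exact by (simp add: n_exact_def)

lemma elementary_structure_opc: "elementary_structure (opc C) n (revc (Suc n) ` \<X>)"
proof (intro elementary_structure.intro elementary_structure_axioms.intro icat_opc n_pos)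
  interpret O: icat "opc C" by (rule icat_opc)
  show "n_exact (opc C) n X" if "X \<in> revc (Suc n) ` \<X>" for X
    using that exact n_exact_opc by blast
  show "Y \<in> revc (Suc n) ` \<X>" if a: "X \<in> revc (Suc n) ` \<X>" "is_complex (opc C) 0 (Suc n) Y"
    "homotopy_equivalent (opc C) (Suc n) X Y" for X Y
  proof -
    obtain X' where X': "X' \<in> \<X>" "X = revc (Suc n) X'" using a(1) by blast
    note X'c = mem_complex[OF X'(1)]
    have "is_complex C 0 (Suc n) (revc (Suc n) Y)" using is_complex_revc[OF a(2)] by simp
    moreover have "homotopy_equivalent C (Suc n) X' (revc (Suc n) Y)"
      using O.homotopy_equivalent_opc[OF _ a(2,3)] is_complex_revc[OF X'c] revc_revc[OF X'c]
      by (simp add: X'(2))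
    ultimately have "revc (Suc n) Y \<in> \<X>" using homotopy_closed X' by blast
    then show ?thesis using revc_revc[OF a(2)] by (metis image_eqI)
  qed
  show "zero_complex (opc C) (Suc n) \<in> revc (Suc n) ` \<X>"
    using zero_mem by (simp add: zero_complex_opc)
qed (use deflations_comp inflations_comp pull push in
    \<open>simp_all add: deflations_revc inflations_revc closed_under_composition_opc\<close>)

lemma closed_contractible:
  assumes "k \<le> n" shows "closed_under_contractible C (Suc n) k \<X>"
  unfolding closed_under_contractible_def
proof (intro ballI allI impI)
  fix V A S S' assume V: "V \<in> \<X>" and S: "is_biproduct C (tm V k) A S \<and> is_biproduct C (tm V (Suc k)) A S'"
  note * = mem_complex[OF V] _ conjunct1[OF S] conjunct2[OF S]
  show "add_contractible C (Suc n) V k S S' \<in> \<X>"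
    by (rule homotopy_closed[OF V is_complex_add_contractible[OF *] homotopy_equivalent_add_contractible[OF *]])
      (use assms in auto)
qed

section \<open>Calculus of deflations, cancellation and recognition of conflations\<close>

lemma deflation_typing:
  assumes "v \<in> deflations \<X>"
  shows "v \<in> Arr C"
  using assms mem_complex cpxD(2) by (auto simp: deflations_def)

lemma deflationE:
  assumes "v \<in> deflations \<X>" obtains X where "X \<in> \<X>" "df X (Suc 0) = v"
  using assms by (auto simp: deflations_def)

lemma deflationI: "X \<in> \<X> \<Longrightarrow> df X (Suc 0) \<in> deflations \<X>"
  by (auto simp: deflations_def)

lemma deflation_comp:
  "f \<in> deflations \<X> \<Longrightarrow> g \<in> deflations \<X> \<Longrightarrow> Cod C f = Dom C g \<Longrightarrow> g \<cdot> f \<in> deflations \<X>"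
  using deflations_comp unfolding closed_under_composition_def by blast

lemma iso_deflation:
  assumes "u \<in> Hom C A B" "v \<in> Hom C B A" "v \<cdot> u = Ident C A" "u \<cdot> v = Ident C B"
  shows "u \<in> deflations \<X>"
  using iso_in_deflations[OF zero_mem closed_contractible[of 0] assms] deflationI by auto

lemma row_deflation:
  assumes "v \<in> deflations \<X>" "p \<in> Arr C" "Cod C p = Cod C v" "is_biproduct C (Dom C v) (Dom C p) S"
  shows "v \<cdot> pr1 S \<boxplus> p \<cdot> pr2 S \<in> deflations \<X>"
  by (rule deflation_row[OF n_pos mem_complex zero_mem deflations_comp closed_contractible closed_contractible assms])
    (use n_pos in auto)

lemma neg_deflation:
  assumes "d \<in> deflations \<X>" shows "Neg C d \<in> deflations \<X>"
proof -
  note [simp] = deflation_typing[OF assms]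
  have "Neg C (Ident C (Cod C d)) \<in> deflations \<X>"
    by (rule iso_deflation[of _ "Cod C d" "Cod C d" "Neg C (Ident C (Cod C d))"]) simp_all
  from deflation_comp[OF assms this] show ?thesis by simp
qed

text \<open>
  If \<open>p q\<close> is a deflation then so is \<open>[p q  p]\<close>, which an automorphism of the source turns into
  \<open>[p  0]\<close>; the summand on which it vanishes splits off because idempotents split.
\<close>

lemma obscure:
  assumes pq: "p \<cdot> q \<in> deflations \<X>" and p: "p \<in> Arr C" and q: "q \<in> Arr C" "Cod C q = Dom C p"
  shows "p \<in> deflations \<X>"
proof -
  note [simp] = p q
  obtain S where S: "is_biproduct C (Dom C q) (Dom C p) S"
    using obtain_biproduct[of "Dom C q" "Dom C p"] by auto
  note [simp] = biprodD[OF S]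
  have "(p \<cdot> q) \<cdot> pr1 S \<boxplus> p \<cdot> pr2 S \<in> deflations \<X>"
    by (rule row_deflation[OF pq]) (use S in auto)
  then obtain W where W: "W \<in> \<X>" and dW: "df W (Suc 0) = (p \<cdot> q) \<cdot> pr1 S \<boxplus> p \<cdot> pr2 S"
    by (rule deflationE)
  note Wc = mem_complex[OF W]
  have W1: "tm W (Suc 0) = vertex S" "tm W 0 = Cod C p"
    using cpxD(3,4)[OF Wc, of 0] by (simp_all add: dW)
  let ?S = "shear (swap_biproduct S) q"
  have S': "is_biproduct C (Dom C p) (Dom C q) ?S"
    by (rule is_biproduct_shear[OF is_biproduct_swap[OF S]]) simp
  have "\<exists>V. is_complex C 0 (Suc n) V \<and> homotopy_equivalent C (Suc n) W V \<and>
      df V (Suc 0) = df W (Suc 0) \<cdot> in1 ?S"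
    by (rule split_off_kernel[OF mem_left[OF W] n_pos S'])
      (simp_all add: W1 dW swap_biproduct_def)
  then obtain V where V: "is_complex C 0 (Suc n) V" "homotopy_equivalent C (Suc n) W V"
    "df V (Suc 0) = df W (Suc 0) \<cdot> in1 ?S" by blast
  have "V \<in> \<X>" by (rule homotopy_closed[OF W V(1,2)])
  from deflationI[OF this] show ?thesis by (simp add: V(3) dW swap_biproduct_def)
qed

text \<open>Some conflation has this last morphism, and left n-exact sequences with equal last
  morphisms are homotopy equivalent. Membership in \<open>\<X>\<close> can thus be read off from the
  last morphism.\<close>

lemma mem_if_same_deflation:
  assumes X: "left_n_exact C n X" and d: "df X (Suc 0) \<in> deflations \<X>"
  shows "X \<in> \<X>"
proof -
  obtain Z where Z: "Z \<in> \<X>" "df Z (Suc 0) = df X (Suc 0)" using d by (rule deflationE)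
  note Xc = lex_complex[OF X] and Zc = mem_complex[OF Z(1)]
  note [simp] = cpxD[OF Xc]
  have [simp]: "tm Z 0 = tm X 0" "tm Z (Suc 0) = tm X (Suc 0)"
    using cpxD(3,4)[OF Zc, of 0] Z(2) by simp_all
  have "homotopy_equivalent C (Suc n) Z X"
    by (rule homotopy_equivalent_if_iso_square[OF mem_left[OF Z(1)] X, of "Ident C (tm X 0)"
        "Ident C (tm X (Suc 0))" "Ident C (tm X 0)" "Ident C (tm X (Suc 0))"]) (simp_all add: Z(2))
  then show ?thesis using homotopy_closed Z(1) Xc by blast
qed

text \<open>The deflation \<open>f 0 \<cdot> df Y (Suc 0)\<close> is also
  \<open>df X (Suc 0) \<cdot> f (Suc 0)\<close>, and cancelling \<open>f (Suc 0)\<close> leaves the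
  last morphism of \<open>X\<close>.\<close>

lemma mem_if_iso_0:
  assumes Y: "Y \<in> \<X>" and X: "left_n_exact C n X" and f: "is_cpx_morphism C 0 (Suc n) Y X f"
    and g: "g \<in> Hom C (tm X 0) (tm Y 0)" "g \<cdot> f 0 = Ident C (tm Y 0)" "f 0 \<cdot> g = Ident C (tm X 0)"
  shows "X \<in> \<X>"
proof (rule mem_if_same_deflation[OF X])
  note [simp] = cpxD[OF mem_complex[OF Y]] cpxD[OF lex_complex[OF X]] morD[OF f]
  have "f 0 \<in> deflations \<X>" by (rule iso_deflation[OF _ g]) simp
  from deflation_comp[OF deflationI[OF Y] this] have "df X (Suc 0) \<cdot> f (Suc 0) \<in> deflations \<X>"
    using mor_comm[OF f, of 0] by simp
  then show "df X (Suc 0) \<in> deflations \<X>" by (rule obscure) simp_all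
qed

text \<open>The square supplied by \<open>pull\<close> is a cycle in degree 1 and lifts through the
  second differential of \<open>Z\<close>. Hence the deflation \<open>q\<close> factors through the
  component in question, and \<open>obscure\<close> applies.\<close>

lemma summand_deflation:
  assumes Z: "Z \<in> \<X>" and d: "d \<in> deflations \<X>" and g: "g \<in> Arr C" "Cod C g = Cod C d"
    and S: "is_biproduct C (Dom C d) (Dom C g) S" and dZ: "df Z (Suc 0) = Neg C d \<cdot> pr1 S \<boxplus> g \<cdot> pr2 S"
  shows "pr2 S \<cdot> df Z (Suc (Suc 0)) \<in> deflations \<X>"
proof -
  note [simp] = cpxD[OF mem_complex[OF Z]] biprodD[OF S] deflation_typing[OF d] g n_pos
  have [simp]: "tm Z (Suc 0) = vertex S" "tm Z 0 = Cod C d"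
    using cpxD(3,4)[OF mem_complex[OF Z], of 0] dZ by simp_all
  obtain q p where q: "q \<in> deflations \<X>" and p [simp]: "p \<in> Arr C" "Dom C p = Dom C q" "Cod C p = Dom C d"
    "Cod C q = Dom C g" and dp: "d \<cdot> p = g \<cdot> q"
    using pull[unfolded pulls_back_def, rule_format, OF d g(1,2)] by auto
  note [simp] = deflation_typing[OF q]
  let ?x = "in1 S \<cdot> p \<boxplus> in2 S \<cdot> q"
  have "df Z (Suc 0) \<cdot> ?x = Zero C (Dom C q) (tm Z 0)" unfolding dZ by (simp add: dp)
  then obtain u where u: "u \<in> Arr C" "Dom C u = Dom C q" "Cod C u = tm Z (Suc (Suc 0))" "df Z (Suc (Suc 0)) \<cdot> u = ?x"
    using lex_lift[OF mem_left[OF Z] n_pos, of ?x] by auto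
  have "(pr2 S \<cdot> df Z (Suc (Suc 0))) \<cdot> u = q" using u by simp
  then have "(pr2 S \<cdot> df Z (Suc (Suc 0))) \<cdot> u \<in> deflations \<X>" using q by simp
  then show ?thesis by (rule obscure) (use u in simp_all)
qed

end

section \<open>Closure under weak isomorphisms\<close>

lemma is_isoE:
  assumes "is_iso C f" obtains g where "g \<in> Hom C (Cod C f) (Dom C f)"
    "g \<cdot>\<^bsub>C\<^esub> f = Ident C (Dom C f)" "f \<cdot>\<^bsub>C\<^esub> g = Ident C (Cod C f)"
  using assms by (auto simp: is_iso_def)

context elementary_structure
begin

text \<open>Reversal moves the isomorphism to degree 0 and turns \<open>f\<close> around, which is
  why membership passes from the target to the source here.\<close>

lemma mem_if_iso_top:
  assumes X: "X \<in> \<X>" and Y: "n_exact C n Y" and f: "is_cpx_morphism C 0 (Suc n) Y X f"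
    and g: "g \<in> Hom C (tm X (Suc n)) (tm Y (Suc n))" "g \<cdot> f (Suc n) = Ident C (tm Y (Suc n))"
      "f (Suc n) \<cdot> g = Ident C (tm X (Suc n))"
  shows "Y \<in> \<X>"
proof -
  interpret O: elementary_structure "opc C" n "revc (Suc n) ` \<X>" by (rule elementary_structure_opc)
  have "revc (Suc n) Y \<in> revc (Suc n) ` \<X>"
  proof (rule O.mem_if_iso_0)
    show "is_cpx_morphism (opc C) 0 (Suc n) (revc (Suc n) X) (revc (Suc n) Y) (\<lambda>k. f (Suc n - k))"
      by (rule is_cpx_morphism_opc[OF f])
  qed (use X Y g in \<open>simp_all add: n_exact_def right_n_exact_opc revc_simps\<close>)
  then show ?thesis using revc_mem_iff[of \<X>, OF mem_complex n_exact_complex[OF Y]] by simp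
qed

text \<open>The splice of the lower part of \<open>Y\<close> with the upper part of \<open>X\<close>
  is homotopy equivalent to \<open>Y\<close> by lifting from the last morphism, and to
  \<open>X\<close> by the same argument in the opposite category.\<close>

lemma mem_iff_if_adjacent_isos:
  assumes Y: "n_exact C n Y" and X: "n_exact C n X" and k: "k \<le> n"
    and f: "is_cpx_morphism C 0 (Suc n) Y X f" and iso: "is_iso C (f k)" "is_iso C (f (Suc k))"
  shows "X \<in> \<X> \<longleftrightarrow> Y \<in> \<X>"
proof -
  interpret O: pcat "opc C" by (rule pcat_opc)
  note Yc = n_exact_complex[OF Y] and Xc = n_exact_complex[OF X]
  note [simp] = cpxD[OF Yc] cpxD[OF Xc] morD[OF f]
  obtain g where g: "g \<in> Hom C (tm X k) (tm Y k)" "g \<cdot> f k = Ident C (tm Y k)" "f k \<cdot> g = Ident C (tm X k)"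
    using iso(1) k by (auto elim!: is_isoE)
  obtain g' where g': "g' \<in> Hom C (tm X (Suc k)) (tm Y (Suc k))"
    "g' \<cdot> f (Suc k) = Ident C (tm Y (Suc k))" "f (Suc k) \<cdot> g' = Ident C (tm X (Suc k))"
    using iso(2) k by (auto elim!: is_isoE)
  have [simp]: "g \<in> Arr C" "Dom C g = tm X k" "Cod C g = tm Y k"
    "g' \<in> Arr C" "Dom C g' = tm X (Suc k)" "Cod C g' = tm Y (Suc k)" using g g' by auto
  \<comment> \<open>The differential of \<open>X\<close> with its target moved to \<open>Y\<close>;
    by the chain map condition it is equally the differential of \<open>Y\<close> with its source
    moved to \<open>X\<close>.\<close>
  define c where "c = g \<cdot> df X (Suc k)"
  have cf: "c \<cdot> f (Suc k) = df Y (Suc k)"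
    using comp_eq_reassoc[OF g(2), of "df Y (Suc k)"] mor_comm[OF f, of k] k by (simp add: c_def)
  have cg: "c = df Y (Suc k) \<cdot> g'"
    unfolding cf[symmetric] using k g'(3) by (simp add: c_def)
  have fc: "f k \<cdot> c = df X (Suc k)"
    using comp_eq_reassoc[OF g(3), of "df X (Suc k)"] k by (simp add: c_def)
  define Z where "Z = glue (Suc n) k c Y X"
  have f' [simp]: "f k \<in> Hom C (tm Y k) (tm X k)" "f (Suc k) \<in> Hom C (tm Y (Suc k)) (tm X (Suc k))"
    using k by simp_all
  have Z: "left_n_exact C n Z" "homotopy_equivalent C (Suc n) Y Z"
    unfolding Z_def
    by (rule glue[OF _ _ k g(1) f'(1) g(3) f'(2) g'(1,3) c_def cf]; use Y X in \<open>simp add: n_exact_def\<close>)+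
  have "left_n_exact (opc C) n (revc (Suc n) X)" "left_n_exact (opc C) n (revc (Suc n) Y)"
    using X Y by (simp_all add: n_exact_def right_n_exact_opc)
  then have "homotopy_equivalent (opc C) (Suc n) (revc (Suc n) X)
      (glue (Suc n) (n - k) c (revc (Suc n) X) (revc (Suc n) Y))"
    by (rule O.homotopy_equivalent_glue[where u = g' and u' = "f (Suc k)" and v = "f k" and v' = g])
     (use k g g' cg fc in \<open>simp_all add: revc_simps Suc_diff_le\<close>)
  then have op: "homotopy_equivalent (opc C) (Suc n) (revc (Suc n) X) (revc (Suc n) Z)"
    unfolding Z_def revc_glue[OF k] .
  note Zc = lex_complex[OF Z(1)]
  from O.homotopy_equivalent_opc[OF is_complex_revc[OF Xc] is_complex_revc[OF Zc] op]
  have XZ: "homotopy_equivalent C (Suc n) X Z" by (simp add: revc_revc[OF Xc] revc_revc[OF Zc])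
  show ?thesis
    using homotopy_closed[OF _ Zc XZ] homotopy_closed[OF _ Zc Z(2)]
      homotopy_closed[OF _ Xc homotopy_equivalent_sym[OF XZ]]
      homotopy_closed[OF _ Yc homotopy_equivalent_sym[OF Z(2)]] by blast
qed

lemma weak_isomorphism_closed:
  assumes "is_weak_isomorphism C n Y X f" shows "X \<in> \<X> \<longleftrightarrow> Y \<in> \<X>"
proof -
  have YX: "n_exact C n Y" "n_exact C n X" and f: "is_cpx_morphism C 0 (Suc n) Y X f"
    and iso: "(\<exists>k\<le>n. is_iso C (f k) \<and> is_iso C (f (Suc k))) \<or> is_iso C (f 0) \<and> is_iso C (f (Suc n))"
    using assms by (simp_all add: is_weak_isomorphism_def)
  note [simp] = morD[OF f]
  from iso show ?thesis
  proof (elim disjE exE conjE)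
    fix k assume "k \<le> n" "is_iso C (f k)" "is_iso C (f (Suc k))"
    then show ?thesis using mem_iff_if_adjacent_isos[OF YX _ f] by blast
  next
    assume 1: "is_iso C (f 0)" "is_iso C (f (Suc n))"
    obtain g where g: "g \<in> Hom C (tm X 0) (tm Y 0)" "g \<cdot> f 0 = Ident C (tm Y 0)" "f 0 \<cdot> g = Ident C (tm X 0)"
      using 1 by (auto elim!: is_isoE)
    obtain g' where g': "g' \<in> Hom C (tm X (Suc n)) (tm Y (Suc n))"
      "g' \<cdot> f (Suc n) = Ident C (tm Y (Suc n))" "f (Suc n) \<cdot> g' = Ident C (tm X (Suc n))"
      using 1 by (auto elim!: is_isoE)
    \<comment> \<open>Each implication uses one end: from \<open>Y\<close> to \<open>X\<close> by
      the isomorphism in degree 0, from \<open>X\<close> to \<open>Y\<close> by the one in the top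
      degree.\<close>
    show ?thesis
      using mem_if_iso_0[OF _ _ f g] mem_if_iso_top[OF _ YX(1) f g'] YX by (auto simp: n_exact_def)
  qed
qed

end

section \<open>Mapping cones\<close>

text \<open>Left exactness of the mapping cone in components, free of any choice of biproducts: the
  compatible pair \<open>(x, y)\<close> is a cycle and \<open>u\<close> lifts it. For
  \<open>k = 0\<close> there is no condition on a differential of \<open>y\<close>, since
  \<open>Y\<close> ends there.\<close>

definition pullback_exact ::
  "('o, 'm) cat \<Rightarrow> nat \<Rightarrow> ('o, 'm) cpx \<Rightarrow> ('o, 'm) cpx \<Rightarrow> (nat \<Rightarrow> 'm) \<Rightarrow> bool" where
  "pullback_exact C n Y X f \<longleftrightarrow>
    (\<forall>k<n. \<forall>x\<in>Arr C. \<forall>y\<in>Arr C. Dom C y = Dom C x \<and> Cod C x = tm X (Suc k) \<and> Cod C y = tm Y k \<and>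
       df X (Suc k) \<cdot>\<^bsub>C\<^esub> x = f k \<cdot>\<^bsub>C\<^esub> y \<and>
       (\<forall>j. k = Suc j \<longrightarrow> df Y (Suc j) \<cdot>\<^bsub>C\<^esub> y = Zero C (Dom C x) (tm Y j)) \<longrightarrow>
       (\<exists>u\<in>Arr C. Dom C u = Dom C x \<and> Cod C u = tm Y (Suc k) \<and>
          f (Suc k) \<cdot>\<^bsub>C\<^esub> u = x \<and> df Y (Suc k) \<cdot>\<^bsub>C\<^esub> u = y)) \<and>
    (\<forall>y\<in>Arr C. Cod C y = tm Y n \<and> f n \<cdot>\<^bsub>C\<^esub> y = Zero C (Dom C y) (tm X n) \<and>
       df Y n \<cdot>\<^bsub>C\<^esub> y = Zero C (Dom C y) (tm Y (n - 1)) \<longrightarrow> y = Zero C (Dom C y) (tm Y n))"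

text \<open>
  The mapping cone of a pullback diagram, formed with arbitrary biproducts \<open>S k\<close> of \<open>tm X k\<close>
  and \<open>tm Y (k - 1)\<close>; this generality makes the construction self-dual.
\<close>

definition cone ::
  "('o, 'm) cat \<Rightarrow> nat \<Rightarrow> (nat \<Rightarrow> ('o, 'm) biproduct) \<Rightarrow> ('o, 'm) cpx \<Rightarrow> ('o, 'm) cpx \<Rightarrow>
    (nat \<Rightarrow> 'm) \<Rightarrow> ('o, 'm) cpx" where
  "cone C n S Y X f =
    \<lparr>tm = (\<lambda>k\<in>{0..Suc n}. if k = Suc n then tm Y n else if k = 0 then tm X 0 else vertex (S k)),
     df = (\<lambda>k\<in>{0<..Suc n}.
       if k = Suc n then in1 (S n) \<cdot>\<^bsub>C\<^esub> f n \<boxplus>\<^bsub>C\<^esub> in2 (S n) \<cdot>\<^bsub>C\<^esub> df Y n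
       else if k = Suc 0 then Neg C (df X (Suc 0)) \<cdot>\<^bsub>C\<^esub> pr1 (S (Suc 0)) \<boxplus>\<^bsub>C\<^esub> f 0 \<cdot>\<^bsub>C\<^esub> pr2 (S (Suc 0))
       else in1 (S (k - 1)) \<cdot>\<^bsub>C\<^esub>
              (Neg C (df X k) \<cdot>\<^bsub>C\<^esub> pr1 (S k) \<boxplus>\<^bsub>C\<^esub> f (k - 1) \<cdot>\<^bsub>C\<^esub> pr2 (S k)) \<boxplus>\<^bsub>C\<^esub>
            in2 (S (k - 1)) \<cdot>\<^bsub>C\<^esub>
              (Zero C (tm X k) (tm Y (k - 2)) \<cdot>\<^bsub>C\<^esub> pr1 (S k) \<boxplus>\<^bsub>C\<^esub> df Y (k - 1) \<cdot>\<^bsub>C\<^esub> pr2 (S k)))\<rparr>"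

lemma cone_simps:
  "tm (cone C n S Y X f) 0 = tm X 0"
  "k < n \<Longrightarrow> tm (cone C n S Y X f) (Suc k) = vertex (S (Suc k))"
  "tm (cone C n S Y X f) (Suc n) = tm Y n"
  "df (cone C n S Y X f) (Suc n) = in1 (S n) \<cdot>\<^bsub>C\<^esub> f n \<boxplus>\<^bsub>C\<^esub> in2 (S n) \<cdot>\<^bsub>C\<^esub> df Y n"
  "0 < n \<Longrightarrow> df (cone C n S Y X f) (Suc 0) =
     Neg C (df X (Suc 0)) \<cdot>\<^bsub>C\<^esub> pr1 (S (Suc 0)) \<boxplus>\<^bsub>C\<^esub> f 0 \<cdot>\<^bsub>C\<^esub> pr2 (S (Suc 0))"
  "Suc k < n \<Longrightarrow> df (cone C n S Y X f) (Suc (Suc k)) =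
     in1 (S (Suc k)) \<cdot>\<^bsub>C\<^esub>
        (Neg C (df X (Suc (Suc k))) \<cdot>\<^bsub>C\<^esub> pr1 (S (Suc (Suc k))) \<boxplus>\<^bsub>C\<^esub> f (Suc k) \<cdot>\<^bsub>C\<^esub> pr2 (S (Suc (Suc k)))) \<boxplus>\<^bsub>C\<^esub>
     in2 (S (Suc k)) \<cdot>\<^bsub>C\<^esub>
        (Zero C (tm X (Suc (Suc k))) (tm Y k) \<cdot>\<^bsub>C\<^esub> pr1 (S (Suc (Suc k))) \<boxplus>\<^bsub>C\<^esub>
          df Y (Suc k) \<cdot>\<^bsub>C\<^esub> pr2 (S (Suc (Suc k))))"
  "Suc n < k \<Longrightarrow> tm (cone C n S Y X f) k = undefined"
  "k = 0 \<or> Suc n < k \<Longrightarrow> df (cone C n S Y X f) k = undefined"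
  by (auto simp: cone_def)

context pcat
begin

lemma pullback_exact_lift:
  assumes "pullback_exact C n Y X f" "k < n" "x \<in> Arr C" "y \<in> Arr C" "Dom C y = Dom C x"
    "Cod C x = tm X (Suc k)" "Cod C y = tm Y k" "df X (Suc k) \<cdot> x = f k \<cdot> y"
    "\<And>j. k = Suc j \<Longrightarrow> df Y (Suc j) \<cdot> y = Zero C (Dom C x) (tm Y j)"
  shows "\<exists>u. u \<in> Arr C \<and> Dom C u = Dom C x \<and> Cod C u = tm Y (Suc k) \<and>
    f (Suc k) \<cdot> u = x \<and> df Y (Suc k) \<cdot> u = y"
  using assms(1)[unfolded pullback_exact_def, THEN conjunct1, rule_format, of k x y] assms(2-)
  by (simp add: Bex_def)

lemma neg_add_zeroD:
  assumes "Neg C f \<boxplus> g = Zero C A B" "f \<in> Arr C" "g \<in> Arr C"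
    "Dom C f = A" "Cod C f = B" "Dom C g = A" "Cod C g = B"
  shows "f = g"
  using neg_unique[of "Neg C f" g] assms by simp

lemma cone_complex:
  assumes n: "0 < n" and X: "is_complex C 0 (Suc n) X" and Y: "is_complex C 0 n Y"
    and f: "is_cpx_morphism C 0 n Y X f"
    and S: "\<And>k. k < n \<Longrightarrow> is_biproduct C (tm X (Suc k)) (tm Y k) (S (Suc k))"
  shows "is_complex C 0 (Suc n) (cone C n S Y X f)"
  unfolding is_complex_iff
proof (intro conjI allI impI)
  note [simp] = cpxD[OF X] cpxD[OF Y] morD[OF f] biprodD[OF S]
  have fd [simp]: "f k \<cdot> df Y (Suc k) = df X (Suc k) \<cdot> f (Suc k)" if "k < n" for k
    using mor_comm[OF f that] .
  have fdx [simp]: "f k \<cdot> (df Y (Suc k) \<cdot> x) = df X (Suc k) \<cdot> (f (Suc k) \<cdot> x)"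
    if "k < n" "x \<in> Arr C" "Cod C x = tm Y (Suc k)" for k x
    using comp_eq_reassoc[OF fd[OF that(1)], of x] that by simp
  obtain m where m: "n = Suc m" using n by (cases n) auto
  fix k
  have three: "k = 0 \<or> (\<exists>i. k = Suc i)" by (cases k) auto
  show "tm (cone C n S Y X f) k \<in> Obj C" if k: "k \<le> Suc n"
  proof -
    consider "k = 0" | "k = Suc n" | i where "k = Suc i" "i < n" using k three by force
    then show ?thesis by cases (simp_all add: cone_simps)
  qed
  show "Suc n < k \<Longrightarrow> tm (cone C n S Y X f) k = undefined"
    "k = 0 \<or> Suc n < k \<Longrightarrow> df (cone C n S Y X f) k = undefined"
    by (simp_all add: cone_simps)
  show "df (cone C n S Y X f) (Suc k) \<in> Hom C (tm (cone C n S Y X f) (Suc k)) (tm (cone C n S Y X f) k)"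
    if k: "k < Suc n"
  proof -
    consider "k = n" | "k = 0" "k < n" | i where "k = Suc i" "Suc i < n" using k three by force
    then show ?thesis by cases (simp_all add: cone_simps, simp_all add: cone_simps m)
  qed
  assume k: "Suc k < Suc n"
  show "df (cone C n S Y X f) (Suc k) \<cdot> df (cone C n S Y X f) (Suc (Suc k)) =
         Zero C (tm (cone C n S Y X f) (Suc (Suc k))) (tm (cone C n S Y X f) k)"
  proof (cases "Suc k = n")
    case top: True
    show ?thesis
    proof (cases k)
      case 0
      then show ?thesis using top[symmetric] by (simp add: cone_simps)
    next
      case (Suc i)
      then show ?thesis using top[symmetric] by (simp add: cone_simps)
    qed
  next
    case False
    then have k: "Suc k < n" using k by simp
    show ?thesis
    proof (cases k)
      case 0
      then show ?thesis using k by (simp add: cone_simps)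
    next
      case (Suc i)
      then show ?thesis using k by (simp add: cone_simps)
    qed
  qed
qed

text \<open>The two components of a cycle form a pair as in \<open>pullback_exact\<close>, the sign
  in the cone turning a vanishing sum into the equation between \<open>x\<close> and
  \<open>y\<close>.\<close>

lemma cone_left_n_exact:
  assumes n: "0 < n" and X: "is_complex C 0 (Suc n) X" and Y: "is_complex C 0 n Y"
    and f: "is_cpx_morphism C 0 n Y X f"
    and S: "\<And>k. k < n \<Longrightarrow> is_biproduct C (tm X (Suc k)) (tm Y k) (S (Suc k))"
    and ex: "pullback_exact C n Y X f"
  shows "left_n_exact C n (cone C n S Y X f)"
  unfolding left_n_exact_iff
proof (intro conjI ballI allI impI; (elim conjE)?)
  note [simp] = cpxD[OF X] cpxD[OF Y] morD[OF f] biprodD[OF S]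
  obtain m where m: "n = Suc m" using n by (cases n) auto
  show "is_complex C 0 (Suc n) (cone C n S Y X f)" by (rule cone_complex[OF n X Y f S])
  {
    fix h assume h: "h \<in> Arr C" "Cod C h = tm (cone C n S Y X f) (Suc n)"
      "df (cone C n S Y X f) (Suc n) \<cdot> h = Zero C (Dom C h) (tm (cone C n S Y X f) n)"
    have [simp]: "h \<in> Arr C" "Cod C h = tm Y n" using h by (simp_all add: cone_simps)
    have Z: "in1 (S n) \<cdot> (f n \<cdot> h) \<boxplus> in2 (S n) \<cdot> (df Y n \<cdot> h) = Zero C (Dom C h) (vertex (S n))"
      using h(3) by (simp add: m cone_simps)
    have "pr1 (S n) \<cdot> (in1 (S n) \<cdot> (f n \<cdot> h) \<boxplus> in2 (S n) \<cdot> (df Y n \<cdot> h)) = Zero C (Dom C h) (tm X n)"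
      unfolding Z by (simp add: m)
    then have 1: "f n \<cdot> h = Zero C (Dom C h) (tm X n)" by (simp add: m)
    have "pr2 (S n) \<cdot> (in1 (S n) \<cdot> (f n \<cdot> h) \<boxplus> in2 (S n) \<cdot> (df Y n \<cdot> h)) = Zero C (Dom C h) (tm Y (n - 1))"
      unfolding Z by (simp add: m)
    then have 2: "df Y n \<cdot> h = Zero C (Dom C h) (tm Y (n - 1))" by (simp add: m)
    have "h = Zero C (Dom C h) (tm Y n)"
      using ex[unfolded pullback_exact_def, THEN conjunct2, rule_format, of h] 1 2 h(1) by simp
    then show "h = Zero C (Dom C h) (tm (cone C n S Y X f) (Suc n))" by (simp only: cone_simps)
  }
  fix k h assume k: "k < n" and h: "h \<in> Arr C" "Cod C h = tm (cone C n S Y X f) (Suc k)"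
    "df (cone C n S Y X f) (Suc k) \<cdot> h = Zero C (Dom C h) (tm (cone C n S Y X f) k)"
  have ht [simp]: "h \<in> Arr C" "Cod C h = vertex (S (Suc k))" using h k by (simp_all add: cone_simps)
  let ?x = "pr1 (S (Suc k)) \<cdot> h" and ?y = "pr2 (S (Suc k)) \<cdot> h"
  have dx: "df X (Suc k) \<cdot> ?x = f k \<cdot> ?y"
    and dy: "df Y (Suc j) \<cdot> ?y = Zero C (Dom C ?x) (tm Y j)" if "k = Suc j" for j
  proof -
    have j: "j < n" "Suc j < n" using that k by auto
    let ?b = "Neg C (df X (Suc k)) \<cdot> pr1 (S (Suc k)) \<boxplus> f k \<cdot> pr2 (S (Suc k))"
    let ?c = "Zero C (tm X (Suc k)) (tm Y j) \<cdot> pr1 (S (Suc k)) \<boxplus> df Y k \<cdot> pr2 (S (Suc k))"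
    have bc [simp]: "?b \<in> Arr C" "Cod C ?b = tm X k" "Dom C ?b = vertex (S (Suc k))"
      "?c \<in> Arr C" "Cod C ?c = tm Y j" "Dom C ?c = vertex (S (Suc k))"
      using j that k by simp_all
    have Z: "(in1 (S k) \<cdot> ?b \<boxplus> in2 (S k) \<cdot> ?c) \<cdot> h = Zero C (Dom C h) (vertex (S k))"
      using h(3) that j by (simp only: cone_simps)
    have "pr1 (S k) \<cdot> ((in1 (S k) \<cdot> ?b \<boxplus> in2 (S k) \<cdot> ?c) \<cdot> h) = Zero C (Dom C h) (tm X k)"
      unfolding Z using that j k by simp
    then have "Neg C (df X (Suc k) \<cdot> ?x) \<boxplus> f k \<cdot> ?y = Zero C (Dom C h) (tm X k)" using that j k by simp
    then show "df X (Suc k) \<cdot> ?x = f k \<cdot> ?y" by (rule neg_add_zeroD) (use k in simp_all)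
    have "pr2 (S k) \<cdot> ((in1 (S k) \<cdot> ?b \<boxplus> in2 (S k) \<cdot> ?c) \<cdot> h) = Zero C (Dom C h) (tm Y j)"
      unfolding Z using that j k by simp
    then show "df Y (Suc j) \<cdot> ?y = Zero C (Dom C ?x) (tm Y j)" using that j k by simp
  qed
  have dx0: "df X (Suc k) \<cdot> ?x = f k \<cdot> ?y" if "k = 0"
  proof -
    have "(Neg C (df X (Suc k)) \<cdot> pr1 (S (Suc k)) \<boxplus> f k \<cdot> pr2 (S (Suc k))) \<cdot> h = Zero C (Dom C h) (tm X k)"
      using h(3) that n by (simp only: cone_simps)
    then have "Neg C (df X (Suc k) \<cdot> ?x) \<boxplus> f k \<cdot> ?y = Zero C (Dom C h) (tm X k)" using k by simp
    then show ?thesis by (rule neg_add_zeroD) (use k in simp_all)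
  qed
  have "df X (Suc k) \<cdot> ?x = f k \<cdot> ?y" using dx dx0 by (cases k) auto
  then obtain u where u: "u \<in> Arr C" "Dom C u = Dom C h" "Cod C u = tm Y (Suc k)"
    "f (Suc k) \<cdot> u = ?x" "df Y (Suc k) \<cdot> u = ?y"
    using pullback_exact_lift[OF ex k, of ?x ?y] dy k by auto
  note [simp] = u(1-3)
  have hu: "in1 (S (Suc k)) \<cdot> (f (Suc k) \<cdot> u) \<boxplus> in2 (S (Suc k)) \<cdot> (df Y (Suc k) \<cdot> u) = h"
    unfolding u(4,5) by (rule biprod_expand[OF S[OF k] ht, symmetric])
  show "\<exists>w\<in>Hom C (Dom C h) (tm (cone C n S Y X f) (Suc (Suc k))). df (cone C n S Y X f) (Suc (Suc k)) \<cdot> w = h"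
  proof (cases "Suc k = n")
    case True
    then show ?thesis
      using hu k by (intro bexI[of _ u]) (auto simp: True[symmetric] cone_simps)
  next
    case False
    then have "Suc k < n" using k by simp
    \<comment> \<open>Below the top the lift is the pair \<open>(0, u)\<close>, whose boundary
      consists of \<open>f u\<close> and the differential of \<open>u\<close>, that is, of
      \<open>x\<close> and \<open>y\<close>.\<close>
    then show ?thesis using hu
      by (intro bexI[of _ "in2 (S (Suc (Suc k))) \<cdot> u"]) (simp_all add: cone_simps)
  qed
qed

end

section \<open>Comparison with the cones of the definitions\<close>

context icat
begin

lemma pullback_cone_eq:
  assumes n: "0 < n" and X: "is_complex C 0 (Suc n) X" and Y: "is_complex C 0 n Y"
    and f: "is_cpx_morphism C 0 n Y X f"
  shows "pullback_cone C n Y X f = cone C n (\<lambda>k. biprod C (tm X k) (tm Y (k - 1))) Y X f"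
proof (rule cpx.equality)
  note [simp] = cpxD[OF X] cpxD[OF Y] morD[OF f]
  have "is_biproduct C (tm X (Suc k)) (tm Y k) (biprod C (tm X (Suc k)) (tm Y k))" if "k < n" for k
    by (rule biprod) (use that in simp_all)
  note [simp] = biprodD[OF this]
  obtain m where m: "n = Suc m" using n by (cases n) auto
  show "tm (pullback_cone C n Y X f) = tm (cone C n (\<lambda>k. biprod C (tm X k) (tm Y (k - 1))) Y X f)"
    by (auto simp: pullback_cone_def cone_def dsum_def fun_eq_iff restrict_def)
  show "df (pullback_cone C n Y X f) = df (cone C n (\<lambda>k. biprod C (tm X k) (tm Y (k - 1))) Y X f)"
  proof
    fix k
    consider "k = 0 \<or> Suc n < k" | "k = Suc n" | "k = Suc 0" | j where "k = Suc (Suc j)" "Suc j < n"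
      by (metis Suc_lessI linorder_neqE_nat not0_implies_Suc Suc_less_eq)
    then show "df (pullback_cone C n Y X f) k = df (cone C n (\<lambda>k. biprod C (tm X k) (tm Y (k - 1))) Y X f) k"
      by cases (use n m in \<open>auto simp: pullback_cone_def cone_def col_def row_def mat22_def Let_def\<close>)
  qed
qed simp

end

text \<open>An n-pushout lives in degrees 1 to \<open>n + 1\<close>, an n-pullback in the opposite
  category in degrees 0 to \<open>n\<close>. So degree \<open>k\<close> corresponds to
  \<open>Suc n - k\<close>, and degree 0 has to remain \<open>undefined\<close>.\<close>

definition shift_revc :: "nat \<Rightarrow> ('o, 'm) cpx \<Rightarrow> ('o, 'm) cpx" where
  "shift_revc n Y = \<lparr>tm = (\<lambda>k\<in>{1..Suc n}. tm Y (Suc n - k)),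
     df = (\<lambda>k\<in>{1<..Suc n}. df Y (Suc (Suc n) - k))\<rparr>"

context icat
begin

text \<open>Built on the reversed chosen biproducts of \<open>C\<close>, the cone in the opposite
  category reverses to \<open>pushout_cone\<close> as a record, so its left exactness is the
  required right exactness.\<close>

lemma pushout_of_op:
  assumes n: "0 < n" and X: "is_complex C 0 (Suc n) X" and Y: "is_complex (opc C) 0 n Y"
    and f: "is_cpx_morphism (opc C) 0 n Y (revc (Suc n) X) f"
    and ex: "pullback_exact (opc C) n Y (revc (Suc n) X) f"
  shows "is_n_pushout C n X (shift_revc n Y) (\<lambda>k. f (Suc n - k))"
proof -
  interpret O: icat "opc C" by (rule icat_opc)
  note [simp] = cpxD[OF X]
  have Yo [simp]: "tm Y k \<in> Obj C" if "k \<le> n" for k using O.cpxD(1)[OF Y that] by simp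
  have Yd [simp]: "df Y (Suc k) \<in> Arr C" "Cod C (df Y (Suc k)) = tm Y (Suc k)" "Dom C (df Y (Suc k)) = tm Y k"
    if "k < n" for k using O.cpxD(2-4)[OF Y that] by simp_all
  have ft [simp]: "f k \<in> Arr C" "Cod C (f k) = tm Y k" "Dom C (f k) = tm X (Suc n - k)" if "k \<le> n" for k
    using O.morD[OF f that] that by (simp_all add: revc_simps)
  have fc: "df Y (Suc k) \<cdot> f k = f (Suc k) \<cdot> df X (Suc n - k)" if "k < n" for k
    using O.mor_comm[OF f that] that by (simp add: revc_simps)
  have dd: "df Y (Suc (Suc k)) \<cdot> df Y (Suc k) = Zero C (tm Y k) (tm Y (Suc (Suc k)))" if "Suc k < n" for k
    using O.cpxD(5)[OF Y that] by simp
  let ?Y = "shift_revc n Y" and ?f = "\<lambda>k. f (Suc n - k)"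
  have "is_complex C 1 (n + 1) ?Y"
    unfolding is_complex_def
  proof (intro conjI allI impI)
    show "tm ?Y \<in> {1..n + 1} \<rightarrow>\<^sub>E Obj C" by (auto simp: shift_revc_def)
    show "df ?Y \<in> (\<Pi>\<^sub>E k\<in>{1<..n + 1}. Hom C (tm ?Y k) (tm ?Y (k - 1)))"
    proof (rule PiE_I)
      fix k assume k: "k \<in> {1<..n + 1}"
      then obtain j where "n = j + (k - 1)" "j < n" by (intro that[of "n - (k - 1)"]) auto
      moreover from this k have "Suc (Suc n) - k = Suc j" "Suc n - (k - 1) = Suc j" "Suc n - k = j" by auto
      ultimately show "df ?Y k \<in> Hom C (tm ?Y k) (tm ?Y (k - 1))" using k by (auto simp: shift_revc_def)
    qed (auto simp: shift_revc_def)
    fix k assume k: "1 < k \<and> k < n + 1"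
    then obtain j where "Suc (Suc n) - k = Suc (Suc j)" "Suc j < n" by (intro that[of "n - k"]) auto
    moreover from this k have "Suc (Suc n) - (k + 1) = Suc j" "Suc n - (k + 1) = j" "Suc n - (k - 1) = Suc (Suc j)"
      "Suc 0 \<le> k - Suc 0" "k - Suc 0 \<le> Suc n" by auto
    ultimately show "df ?Y k \<cdot> df ?Y (k + 1) = Zero C (tm ?Y (k + 1)) (tm ?Y (k - 1))"
      using k dd[of j] by (simp add: shift_revc_def)
  qed
  moreover have "is_cpx_morphism C 1 (n + 1) X ?Y ?f"
    unfolding is_cpx_morphism_def
  proof (intro conjI ballI)
    fix k assume "k \<in> {1..n + 1}"
    then show "?f k \<in> Hom C (tm X k) (tm ?Y k)" by (auto simp: shift_revc_def)
  next
    fix k assume k: "k \<in> {1<..n + 1}"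
    then obtain j where "Suc (Suc n) - k = Suc j" "j < n" by (intro that[of "Suc n - k"]) auto
    moreover from this k have "Suc n - (k - 1) = Suc j" "Suc n - k = j" "Suc n - j = k" by auto
    ultimately show "?f (k - 1) \<cdot> df X k = df ?Y k \<cdot> ?f k"
      using k fc[of j] by (simp add: shift_revc_def)
  qed
  moreover have "right_n_exact C n (pushout_cone C n X ?Y ?f)"
  proof -
    define S where "S k = opb (biprod C (tm X (Suc n - k)) (tm Y (k - 1)))" for k
    have B: "is_biproduct C (tm X (n - k)) (tm Y k) (biprod C (tm X (n - k)) (tm Y k))" if "k < n" for k
      by (rule biprod) (use that in simp_all)
    note [simp] = biprodD[OF B]
    have S: "is_biproduct (opc C) (tm (revc (Suc n) X) (Suc k)) (tm Y k) (S (Suc k))" if "k < n" for k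
      unfolding S_def using is_biproduct_opc[OF B[OF that]] that by (simp add: revc_simps)
    have left: "left_n_exact (opc C) n (cone (opc C) n S Y (revc (Suc n) X) f)"
      by (rule O.cone_left_n_exact[OF n is_complex_revc[OF X] Y f S ex])
    have "pushout_cone C n X ?Y ?f = revc (Suc n) (cone (opc C) n S Y (revc (Suc n) X) f)"
    proof (rule cpx.equality)
      show "tm (pushout_cone C n X ?Y ?f) = tm (revc (Suc n) (cone (opc C) n S Y (revc (Suc n) X) f))"
        by (auto simp: pushout_cone_def revc_def cone_def shift_revc_def dsum_def S_def fun_eq_iff restrict_def)
      show "df (pushout_cone C n X ?Y ?f) = df (revc (Suc n) (cone (opc C) n S Y (revc (Suc n) X) f))"
      proof
        fix k
        consider "k = 0 \<or> Suc n < k" | "k = Suc n" | "k = Suc 0" | i j where "k = Suc (Suc j)" "n = Suc (Suc j + i)"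
        proof -
          have "k = 0 \<or> Suc n < k \<or> k = Suc n \<or> k = Suc 0 \<or> (\<exists>j i. k = Suc (Suc j) \<and> n = Suc (Suc j + i))"
          proof (rule ccontr)
            assume a: "\<not> ?thesis"
            then obtain j where j: "k = Suc (Suc j)" by (metis not0_implies_Suc)
            then have "Suc j < n" using a by auto
            then show False using a j less_imp_Suc_add by blast
          qed
          then show ?thesis using that by blast
        qed
        then show "df (pushout_cone C n X ?Y ?f) k = df (revc (Suc n) (cone (opc C) n S Y (revc (Suc n) X) f)) k"
        proof cases
          case 1
          then show ?thesis by (auto simp: pushout_cone_def revc_def)
        next
          case 2
          then show ?thesis using n B[of 0]
            by (simp add: pushout_cone_def revc_simps cone_simps shift_revc_def col_def S_def Let_def)
        next
          case 3
          obtain m where m: "n = Suc m" using n by (cases n) auto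
          then show ?thesis using n 3
            by (simp add: pushout_cone_def revc_simps cone_simps shift_revc_def row_def S_def Let_def)
        next
          \<comment> \<open>An inner differential: both sides multiply out to the same matrix
            entries in a different order, whence \<open>add_ac\<close>.\<close>
          case (4 i j)
          have nn: "n - i = Suc (Suc j)" "n - Suc i = Suc j" "i < n" "Suc i < n" "Suc i \<le> n" using 4 by auto
          note [simp] = ft[of "Suc i", OF \<open>Suc i \<le> n\<close>]
          have T: "is_biproduct C (tm X (Suc (Suc j))) (tm Y i) (biprod C (tm X (Suc (Suc j))) (tm Y i))"
            "is_biproduct C (tm X (Suc j)) (tm Y (Suc i)) (biprod C (tm X (Suc j)) (tm Y (Suc i)))"
            using B[of i] B[of "Suc i"] nn by simp_all
          note [simp] = biprodD[OF T(1)] biprodD[OF T(2)]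
          have "f (Suc i) \<in> Arr C" "Cod C (f (Suc i)) = tm Y (Suc i)" "Dom C (f (Suc i)) = tm X (Suc (Suc j))"
            "df X (Suc (Suc j)) \<in> Arr C" "Cod C (df X (Suc (Suc j))) = tm X (Suc j)"
            "Dom C (df X (Suc (Suc j))) = tm X (Suc (Suc j))"
            "df Y (Suc i) \<in> Arr C" "Cod C (df Y (Suc i)) = tm Y (Suc i)" "Dom C (df Y (Suc i)) = tm Y i"
            "tm X (Suc j) \<in> Obj C" "tm Y i \<in> Obj C"
            using nn 4 by simp_all
          note [simp] = this
          show ?thesis using nn(3-) 4
            by (simp add: pushout_cone_def revc_simps cone_simps shift_revc_def mat22_def col_def row_def S_def Let_def
                add_ac)
        qed
      qed
    qed simp
    moreover have "right_n_exact C n (revc (Suc n) (cone (opc C) n S Y (revc (Suc n) X) f))"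
      using left_n_exact_opc[OF left] by simp
    ultimately show ?thesis by simp
  qed
  ultimately show ?thesis by (simp add: is_n_pushout_def)
qed

end

section \<open>Completing pullbacks of deflations to n-pullbacks\<close>

context elementary_structure
begin

text \<open>The second differential of this \<open>Z\<close> will supply both the weak kernel of the
  row and the lowest square of the n-pullback.\<close>

lemma ex_resolution:
  assumes X: "X \<in> \<X>" and g: "g \<in> Arr C" "Cod C g = tm X 0"
    and S: "is_biproduct C (tm X (Suc 0)) (Dom C g) S"
  shows "\<exists>Z\<in>\<X>. tm Z 0 = tm X 0 \<and> tm Z (Suc 0) = vertex S \<and>
    df Z (Suc 0) = Neg C (df X (Suc 0)) \<cdot> pr1 S \<boxplus> g \<cdot> pr2 S"
proof -
  note [simp] = cpxD[OF mem_complex[OF X]] biprodD[OF S] g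
  have "Neg C (df X (Suc 0)) \<cdot> pr1 S \<boxplus> g \<cdot> pr2 S \<in> deflations \<X>"
    by (rule row_deflation[OF neg_deflation[OF deflationI[OF X]]]) (use S in simp_all)
  then obtain Z where Z: "Z \<in> \<X>" "df Z (Suc 0) = Neg C (df X (Suc 0)) \<cdot> pr1 S \<boxplus> g \<cdot> pr2 S"
    by (rule deflationE)
  then show ?thesis using cpxD(3,4)[OF mem_complex[OF Z(1)], of 0] by (intro bexI[of _ Z]) simp_all
qed

text \<open>
  \<open>\<psi> k\<close> is, up to the sign \<open>(-1)^k\<close>, a chain map lifting the square with components \<open>-1\<close> and
  \<open>in1 S\<close> in degrees 0 and 1; the signs turn commuting squares into anticommuting ones.
\<close>

lemma ex_anti_chain_map:
  assumes X: "is_complex C 0 (Suc n) X" and Z: "left_n_exact C n Z"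
    and S: "is_biproduct C (tm X (Suc 0)) B S" and Z0: "tm Z 0 = tm X 0" "tm Z (Suc 0) = vertex S"
    and g: "g \<in> Hom C B (tm X 0)" and dZ: "df Z (Suc 0) = Neg C (df X (Suc 0)) \<cdot> pr1 S \<boxplus> g \<cdot> pr2 S"
  shows "\<exists>\<psi>. (\<forall>k\<le>Suc n. \<psi> k \<in> Hom C (tm X k) (tm Z k)) \<and>
    df Z (Suc (Suc 0)) \<cdot> \<psi> (Suc (Suc 0)) = in1 S \<cdot> df X (Suc (Suc 0)) \<and>
    (\<forall>k. Suc k < n \<longrightarrow> df Z (Suc (Suc (Suc k))) \<cdot> \<psi> (Suc (Suc (Suc k))) =
       Neg C (\<psi> (Suc (Suc k)) \<cdot> df X (Suc (Suc (Suc k)))))"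
proof -
  note Zc = lex_complex[OF Z]
  note [simp] = cpxD[OF X] cpxD[OF Zc] biprodD[OF S] Z0
  have [simp]: "g \<in> Arr C" "Dom C g = B" "Cod C g = tm X 0" using g by auto
  obtain \<phi> where \<phi>: "is_cpx_morphism C 0 (Suc n) X Z \<phi>" "\<phi> 0 = Neg C (Ident C (tm X 0))" "\<phi> (Suc 0) = in1 S"
    using lift_chain[OF X Z, of "Neg C (Ident C (tm X 0))" "in1 S"] dZ by auto
  note [simp] = morD[OF \<phi>(1)]
  define \<psi> where "\<psi> k = (if even k then \<phi> k else Neg C (\<phi> k))" for k
  have 1: "\<forall>k\<le>Suc n. \<psi> k \<in> Hom C (tm X k) (tm Z k)" by (simp add: \<psi>_def)
  have 2: "df Z (Suc (Suc 0)) \<cdot> \<psi> (Suc (Suc 0)) = in1 S \<cdot> df X (Suc (Suc 0))"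
    using mor_comm[OF \<phi>(1), of "Suc 0"] n_pos by (simp add: \<psi>_def \<phi>(3))
  have 3: "df Z (Suc (Suc k)) \<cdot> \<psi> (Suc (Suc k)) = Neg C (\<psi> (Suc k) \<cdot> df X (Suc (Suc k)))" if "k < n" for k
    using mor_comm[OF \<phi>(1), of "Suc k"] that by (simp add: \<psi>_def)
  show ?thesis using 1 2 3 by blast
qed

text \<open>The summand \<open>X\<^sub>k\<close> of \<open>Y\<^sub>k\<close> for
  \<open>k \<ge> 2\<close> serves to cancel \<open>X\<^sub>k\<close> in the mapping cone:
  \<open>f k\<close> is the projection to it, so that up to a change of coordinates the cone is
  \<open>Z\<close> plus contractible complexes on these \<open>X\<^sub>k\<close>. In degree 1
  nothing is added, as \<open>X\<^sub>1\<close> already is a part of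
  \<open>Z\<^sub>1\<close>.\<close>

lemma ex_pullback:
  assumes X: "X \<in> \<X>" and g: "g \<in> Arr C" "Cod C g = tm X 0"
  shows "\<exists>Y f. f 0 = g \<and> is_complex C 0 n Y \<and> is_cpx_morphism C 0 n Y X f \<and>
    pullback_exact C n Y X f \<and> df Y (Suc 0) \<in> deflations \<X>"
proof -
  note Xc = mem_complex[OF X]
  define B where "B = Dom C g"
  obtain S where S: "is_biproduct C (tm X (Suc 0)) B S"
    using obtain_biproduct[of "tm X (Suc 0)" B] cpxD[OF Xc] g by (auto simp: B_def)
  obtain Z where Z: "Z \<in> \<X>" "tm Z 0 = tm X 0" "tm Z (Suc 0) = vertex S"
    and dZ: "df Z (Suc 0) = Neg C (df X (Suc 0)) \<cdot> pr1 S \<boxplus> g \<cdot> pr2 S"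
    using ex_resolution[OF X g, of S] S by (auto simp: B_def)
  note Zl = mem_left[OF Z(1)]
  note Zc = lex_complex[OF Zl]
  have gt [simp]: "g \<in> Arr C" "Dom C g = B" "Cod C g = tm X 0" using g by (simp_all add: B_def)
  obtain \<psi> where \<psi>: "\<And>k. k \<le> Suc n \<Longrightarrow> \<psi> k \<in> Arr C \<and> Dom C (\<psi> k) = tm X k \<and> Cod C (\<psi> k) = tm Z k"
    and \<psi>2: "df Z (Suc (Suc 0)) \<cdot> \<psi> (Suc (Suc 0)) = in1 S \<cdot> df X (Suc (Suc 0))"
    and d\<psi>: "\<And>k. Suc k < n \<Longrightarrow>
      df Z (Suc (Suc (Suc k))) \<cdot> \<psi> (Suc (Suc (Suc k))) = Neg C (\<psi> (Suc (Suc k)) \<cdot> df X (Suc (Suc (Suc k))))"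
    using ex_anti_chain_map[OF Xc Zl S Z(2,3) _ dZ] gt unfolding Hom_iff by blast
  note [simp] = cpxD[OF Xc] cpxD[OF Zc] biprodD[OF S] Z(2,3)
  have [simp]: "Suc 0 \<le> n" "n > 0" "n \<noteq> 0" using n_pos by linarith+
  have [simp]: "\<psi> k \<in> Arr C" "Dom C (\<psi> k) = tm X k" "Cod C (\<psi> k) = tm Z k" if "k \<le> Suc n" for k
    using \<psi>[OF that] by auto
  define Q where "Q j = biprod C (tm Z (Suc (Suc j))) (tm X (Suc j))" for j
  have Q: "is_biproduct C (tm Z (Suc (Suc j))) (tm X (Suc j)) (Q j)" if "j < n" for j
    unfolding Q_def by (rule biprod) (use that in simp_all)
  \<comment> \<open>\<open>V j\<close> is the term of \<open>Y\<close> in degree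
    \<open>Suc j\<close>. The degenerate values at \<open>j = 0\<close>, an identity and zeros, let
    a single formula for \<open>D\<close> cover the degree without an added summand.\<close>
  define V where "V j = (if j = 0 then tm Z (Suc (Suc 0)) else vertex (Q j))" for j
  define \<sigma> where "\<sigma> j = (if j = 0 then Ident C (tm Z (Suc (Suc 0))) else in1 (Q j))" for j
  define \<tau> where "\<tau> j = (if j = 0 then Zero C (tm X (Suc 0)) (tm Z (Suc (Suc 0))) else in2 (Q j))" for j
  define \<rho> where "\<rho> j = (if j = 0 then Ident C (tm Z (Suc (Suc 0))) else pr1 (Q j))" for j
  define \<pi> where "\<pi> j = (if j = 0 then Zero C (tm Z (Suc (Suc 0))) (tm X (Suc 0)) else pr2 (Q j))" for j
  note defs = V_def \<sigma>_def \<tau>_def \<rho>_def \<pi>_def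
  have V [simp]: "V j \<in> Obj C" if "j < n" for j using biprodD[OF Q[OF that]] that by (simp add: defs)
  have t [simp]: "\<sigma> j \<in> Arr C" "Dom C (\<sigma> j) = tm Z (Suc (Suc j))" "Cod C (\<sigma> j) = V j"
    "\<tau> j \<in> Arr C" "Dom C (\<tau> j) = tm X (Suc j)" "Cod C (\<tau> j) = V j"
    "\<rho> j \<in> Arr C" "Dom C (\<rho> j) = V j" "Cod C (\<rho> j) = tm Z (Suc (Suc j))"
    "\<pi> j \<in> Arr C" "Dom C (\<pi> j) = V j" "Cod C (\<pi> j) = tm X (Suc j)" if "j < n" for j
    using biprodD[OF Q[OF that]] that by (simp_all add: defs)
  have e: "\<rho> j \<cdot> \<sigma> j = Ident C (tm Z (Suc (Suc j)))" "\<rho> j \<cdot> \<tau> j = Zero C (tm X (Suc j)) (tm Z (Suc (Suc j)))"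
    "\<pi> j \<cdot> \<sigma> j = Zero C (tm Z (Suc (Suc j))) (tm X (Suc j))"
    "\<sigma> j \<cdot> \<rho> j \<boxplus> \<tau> j \<cdot> \<pi> j = Ident C (V j)" if "j < n" for j
    using biprodD[OF Q[OF that]] that by (simp_all add: defs)
  have \<pi>\<tau>: "\<pi> (Suc j) \<cdot> \<tau> (Suc j) = Ident C (tm X (Suc (Suc j)))" if "Suc j < n" for j
    using biprodD[OF Q[OF that]] by (simp add: defs)
  have ex [simp]: "\<rho> j \<cdot> (\<sigma> j \<cdot> z) = z" "\<pi> j \<cdot> (\<sigma> j \<cdot> z) = Zero C (Dom C z) (tm X (Suc j))"
    if "j < n" "z \<in> Arr C" "Cod C z = tm Z (Suc (Suc j))" for j z
    using comp_eq_reassoc[OF e(1)[OF that(1)], of z] comp_eq_reassoc[OF e(3)[OF that(1)], of z] that by simp_all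
  have ex' [simp]: "\<rho> j \<cdot> (\<tau> j \<cdot> z) = Zero C (Dom C z) (tm Z (Suc (Suc j)))"
    if "j < n" "z \<in> Arr C" "Cod C z = tm X (Suc j)" for j z
    using comp_eq_reassoc[OF e(2)[OF that(1)], of z] that by simp
  have \<pi>\<tau>x [simp]: "\<pi> (Suc j) \<cdot> (\<tau> (Suc j) \<cdot> z) = z"
    if "Suc j < n" "z \<in> Arr C" "Cod C z = tm X (Suc (Suc j))" for j z
    using comp_eq_reassoc[OF \<pi>\<tau>[OF that(1)], of z] that by simp
  have sum: "\<sigma> j \<cdot> (\<rho> j \<cdot> z) \<boxplus> \<tau> j \<cdot> (\<pi> j \<cdot> z) = z" if "j < n" "z \<in> Arr C" "Cod C z = V j" for j z
  proof -
    have "(\<sigma> j \<cdot> \<rho> j \<boxplus> \<tau> j \<cdot> \<pi> j) \<cdot> z = z" unfolding e(4)[OF that(1)] using that by simp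
    then show ?thesis using that by simp
  qed
  have z0: "\<sigma> 0 = Ident C (tm Z (Suc (Suc 0)))" "\<tau> 0 = Zero C (tm X (Suc 0)) (tm Z (Suc (Suc 0)))"
    "V 0 = tm Z (Suc (Suc 0))" by (simp_all add: defs)
  define d2 where "d2 = df Z (Suc (Suc 0))"
  have d2 [simp]: "d2 \<in> Arr C" "Dom C d2 = tm Z (Suc (Suc 0))" "Cod C d2 = vertex S" by (simp_all add: d2_def)
  define a where "a = pr1 S \<cdot> d2"
  define b where "b = pr2 S \<cdot> d2"
  have ab [simp]: "a \<in> Arr C" "Dom C a = tm Z (Suc (Suc 0))" "Cod C a = tm X (Suc 0)"
    "b \<in> Arr C" "Dom C b = tm Z (Suc (Suc 0))" "Cod C b = B" by (simp_all add: a_def b_def)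
  have bdef: "b \<in> deflations \<X>" unfolding b_def d2_def
    by (rule summand_deflation[OF Z(1) deflationI[OF X] g(1) _ _ dZ]) (use S in simp_all)
  have gb: "df X (Suc 0) \<cdot> a = g \<cdot> b"
  proof -
    have "df Z (Suc 0) \<cdot> d2 = Zero C (tm Z (Suc (Suc 0))) (tm X 0)" by (simp add: d2_def)
    then have "Neg C (df X (Suc 0) \<cdot> a) \<boxplus> g \<cdot> b = Zero C (tm Z (Suc (Suc 0))) (tm X 0)"
      by (simp add: dZ a_def b_def)
    then show ?thesis by (rule neg_add_zeroD) simp_all
  qed
  have ad3: "a \<cdot> df Z (Suc (Suc (Suc 0))) = Zero C (tm Z (Suc (Suc (Suc 0)))) (tm X (Suc 0))"
    "b \<cdot> df Z (Suc (Suc (Suc 0))) = Zero C (tm Z (Suc (Suc (Suc 0)))) B" if "Suc 0 < n"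
    using that by (simp_all add: a_def b_def d2_def)
  have a\<psi>: "a \<cdot> \<psi> (Suc (Suc 0)) = df X (Suc (Suc 0))" "b \<cdot> \<psi> (Suc (Suc 0)) = Zero C (tm X (Suc (Suc 0))) B"
    using \<psi>2 by (simp_all add: a_def b_def d2_def)
  have ad3x: "a \<cdot> (df Z (Suc (Suc (Suc 0))) \<cdot> z) = Zero C (Dom C z) (tm X (Suc 0))"
    "b \<cdot> (df Z (Suc (Suc (Suc 0))) \<cdot> z) = Zero C (Dom C z) B"
    if "Suc 0 < n" "z \<in> Arr C" "Cod C z = tm Z (Suc (Suc (Suc 0)))" for z
    using comp_eq_reassoc[OF ad3(1)[OF that(1)], of z] comp_eq_reassoc[OF ad3(2)[OF that(1)], of z] that by simp_all
  have a\<psi>x: "a \<cdot> (\<psi> (Suc (Suc 0)) \<cdot> z) = df X (Suc (Suc 0)) \<cdot> z"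
    "b \<cdot> (\<psi> (Suc (Suc 0)) \<cdot> z) = Zero C (Dom C z) B"
    if "z \<in> Arr C" "Cod C z = tm X (Suc (Suc 0))" for z
    using comp_eq_reassoc[OF a\<psi>(1), of z] comp_eq_reassoc[OF a\<psi>(2), of z] that by simp_all
  have d\<psi>x: "df Z (Suc (Suc (Suc k))) \<cdot> (\<psi> (Suc (Suc (Suc k))) \<cdot> z) =
      Neg C (\<psi> (Suc (Suc k)) \<cdot> (df X (Suc (Suc (Suc k))) \<cdot> z))"
    if "Suc k < n" "z \<in> Arr C" "Cod C z = tm X (Suc (Suc (Suc k)))" for k z
    using comp_eq_reassoc[OF d\<psi>[OF that(1)], of z] that by simp
  \<comment> \<open>The triangular matrix with the differentials of \<open>Z\<close> and
    \<open>X\<close> on the diagonal and \<psi> above it; consecutive ones compose to zero because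
    \<psi> anticommutes with the differentials.\<close>
  define D where "D j = \<sigma> j \<cdot> (df Z (Suc (Suc (Suc j))) \<cdot> \<rho> (Suc j) \<boxplus> \<psi> (Suc (Suc j)) \<cdot> \<pi> (Suc j)) \<boxplus>
     \<tau> j \<cdot> (df X (Suc (Suc j)) \<cdot> \<pi> (Suc j))" for j
  have D [simp]: "D j \<in> Arr C" "Dom C (D j) = V (Suc j)" "Cod C (D j) = V j" if "Suc j < n" for j
    using that by (simp_all add: D_def)
  define Y where "Y = \<lparr>tm = (\<lambda>k\<in>{0..n}. if k = 0 then B else V (k - 1)),
     df = (\<lambda>k\<in>{0<..n}. if k = Suc 0 then b else D (k - 2))\<rparr>"
  have Y_simps: "tm Y 0 = B" "j < n \<Longrightarrow> tm Y (Suc j) = V j" "df Y (Suc 0) = b"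
    "Suc j < n \<Longrightarrow> df Y (Suc (Suc j)) = D j" "k > n \<Longrightarrow> tm Y k = undefined"
    "k = 0 \<or> k > n \<Longrightarrow> df Y k = undefined" for j k
  proof -
    show "tm Y 0 = B" "j < n \<Longrightarrow> tm Y (Suc j) = V j" "df Y (Suc 0) = b" by (simp_all add: Y_def)
    show "Suc j < n \<Longrightarrow> df Y (Suc (Suc j)) = D j" by (simp add: Y_def)
    show "k > n \<Longrightarrow> tm Y k = undefined" by (simp add: Y_def)
    show "k = 0 \<or> k > n \<Longrightarrow> df Y k = undefined" by (auto simp: Y_def)
  qed
  define f where "f k = (if k = 0 then g else if k = Suc 0 then a else \<pi> (k - 1))" for k
  have f_simps: "f 0 = g" "f (Suc 0) = a" "f (Suc (Suc j)) = \<pi> (Suc j)" for j by (simp_all add: f_def)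
  have bD: "b \<cdot> D 0 = Zero C (V (Suc 0)) B" if "Suc 0 < n"
    using that by (simp add: D_def z0 ad3x a\<psi>x)
  have aD: "a \<cdot> D 0 = df X (Suc (Suc 0)) \<cdot> \<pi> (Suc 0)" if "Suc 0 < n"
    using that by (simp add: D_def z0 ad3x a\<psi>x)
  have DD: "D j \<cdot> D (Suc j) = Zero C (V (Suc (Suc j))) (V j)" if "Suc (Suc j) < n" for j
    using that by (simp add: D_def d\<psi>x)
  have \<pi>D: "\<pi> (Suc j) \<cdot> D (Suc j) = df X (Suc (Suc (Suc j))) \<cdot> \<pi> (Suc (Suc j))" if "Suc (Suc j) < n" for j
    using that by (simp add: D_def)
  have cases: "k = 0 \<or> k = Suc 0 \<or> (\<exists>j. k = Suc (Suc j))" for k by (metis not0_implies_Suc)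
  have Yc: "is_complex C 0 n Y"
    unfolding is_complex_iff
  proof (intro conjI allI impI)
    fix k
    show "k \<le> n \<Longrightarrow> tm Y k \<in> Obj C" by (cases k) (simp_all add: Y_simps Suc_le_eq)
    show "n < k \<Longrightarrow> tm Y k = undefined" "k = 0 \<or> n < k \<Longrightarrow> df Y k = undefined" by (simp_all add: Y_simps)
    show "k < n \<Longrightarrow> df Y (Suc k) \<in> Hom C (tm Y (Suc k)) (tm Y k)"
      by (cases k) (simp_all add: Y_simps z0)
    show "df Y (Suc k) \<cdot> df Y (Suc (Suc k)) = Zero C (tm Y (Suc (Suc k))) (tm Y k)" if "Suc k < n"
      using that by (cases k) (simp_all add: Y_simps bD DD)
  qed
  have fm: "is_cpx_morphism C 0 n Y X f"
    unfolding is_cpx_morphism_iff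
  proof (intro conjI allI impI)
    fix k
    show "f k \<in> Hom C (tm Y k) (tm X k)" if "k \<le> n"
      using cases[of k] that by (auto simp: f_simps Y_simps z0 Suc_le_eq)
    show "f k \<cdot> df Y (Suc k) = df X (Suc k) \<cdot> f (Suc k)" if "k < n"
      using cases[of k] that by (auto simp: f_simps Y_simps gb aD \<pi>D)
  qed
  have "pullback_exact C n Y X f"
    unfolding pullback_exact_def
  proof (intro conjI allI ballI impI; (elim conjE)?)
    fix k x y assume k: "k < n" and xy: "x \<in> Arr C" "y \<in> Arr C" "Dom C y = Dom C x"
      "Cod C x = tm X (Suc k)" "Cod C y = tm Y k" "df X (Suc k) \<cdot> x = f k \<cdot> y"
      and dy: "\<forall>j. k = Suc j \<longrightarrow> df Y (Suc j) \<cdot> y = Zero C (Dom C x) (tm Y j)"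
    note [simp] = xy(1-3)
    show "\<exists>u\<in>Arr C. Dom C u = Dom C x \<and> Cod C u = tm Y (Suc k) \<and> f (Suc k) \<cdot> u = x \<and> df Y (Suc k) \<cdot> u = y"
      using cases[of k]
    proof (elim disjE exE)
      assume k0: "k = 0"
      then have y [simp]: "Cod C y = B" "Cod C x = tm X (Suc 0)" using xy(4,5) by (simp_all add: Y_simps)
      have eq: "df X (Suc 0) \<cdot> x = g \<cdot> y" using xy(6) k0 by (simp add: f_simps)
      let ?h = "in1 S \<cdot> x \<boxplus> in2 S \<cdot> y"
      have "df Z (Suc 0) \<cdot> ?h = Zero C (Dom C x) (tm Z 0)" by (simp add: dZ eq)
      then obtain u where u: "u \<in> Arr C" "Dom C u = Dom C x" "Cod C u = tm Z (Suc (Suc 0))" "d2 \<cdot> u = ?h"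
        using lex_lift[OF Zl n_pos, of ?h] by (auto simp: d2_def)
      have "a \<cdot> u = x" "b \<cdot> u = y" using u(1-3) by (simp_all add: a_def b_def u(4))
      then show ?thesis using u(1-3) k0 by (intro bexI[of _ u]) (simp_all add: Y_simps f_simps z0)
    next
      assume k1: "k = Suc 0"
      then have n1: "Suc 0 < n" using k by simp
      have y [simp]: "Cod C y = tm Z (Suc (Suc 0))" "Cod C x = tm X (Suc (Suc 0))"
        using xy(4,5) k1 by (simp_all add: Y_simps z0)
      have eq: "df X (Suc (Suc 0)) \<cdot> x = a \<cdot> y" using xy(6) k1 by (simp add: f_simps)
      have by0: "b \<cdot> y = Zero C (Dom C x) B" using dy k1 by (simp add: Y_simps)
      \<comment> \<open>Subtracting the contribution of \<open>x\<close> from \<open>y\<close>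
        leaves a cycle of \<open>Z\<close>, since both components of its image under
        \<open>d2\<close> vanish. A lift \<open>w\<close> of it, paired with \<open>x\<close>, is
        the arrow sought.\<close>
      let ?e = "y \<boxplus> Neg C (\<psi> (Suc (Suc 0)) \<cdot> x)"
      have e [simp]: "?e \<in> Arr C" "Dom C ?e = Dom C x" "Cod C ?e = tm Z (Suc (Suc 0))" using n1 by simp_all
      have "d2 \<cdot> ?e = Zero C (Dom C x) (vertex S)"
      proof (rule biprod_ext[OF S])
        have "a \<cdot> ?e = Zero C (Dom C x) (tm X (Suc 0))" using n1 by (simp add: a\<psi>x eq)
        then show "pr1 S \<cdot> (d2 \<cdot> ?e) = pr1 S \<cdot> Zero C (Dom C x) (vertex S)"
          using n1 by (simp add: a_def)
        have "b \<cdot> ?e = Zero C (Dom C x) B" using n1 by (simp add: a\<psi>x by0)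
        then show "pr2 S \<cdot> (d2 \<cdot> ?e) = pr2 S \<cdot> Zero C (Dom C x) (vertex S)"
          using n1 by (simp add: b_def)
      qed (use n1 in simp_all)
      then have "df Z (Suc (Suc 0)) \<cdot> ?e = Zero C (Dom C ?e) (tm Z (Suc 0))" unfolding d2_def e Z(3) .
      from lex_lift[OF Zl n1 e(1,3) this]
      obtain w where w: "w \<in> Arr C" "Dom C w = Dom C x" "Cod C w = tm Z (Suc (Suc (Suc 0)))"
        "df Z (Suc (Suc (Suc 0))) \<cdot> w = ?e" unfolding e by auto
      let ?u = "\<sigma> (Suc 0) \<cdot> w \<boxplus> \<tau> (Suc 0) \<cdot> x"
      have "D 0 \<cdot> ?u = df Z (Suc (Suc (Suc 0))) \<cdot> w \<boxplus> \<psi> (Suc (Suc 0)) \<cdot> x"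
        using w(1-3) n1 by (simp add: D_def z0)
      also have "\<dots> = y" unfolding w(4) using n1 by simp
      finally show ?thesis using w(1-3) n1 k1
        by (intro bexI[of _ ?u]) (simp_all add: Y_simps f_simps)
    next
      fix j assume kj: "k = Suc (Suc j)"
      then have n1: "Suc (Suc j) < n" using k by simp
      have y [simp]: "Cod C y = V (Suc j)" "Cod C x = tm X (Suc (Suc (Suc j)))"
        using xy(4,5) n1 kj by (simp_all add: Y_simps)
      have eq: "df X (Suc (Suc (Suc j))) \<cdot> x = \<pi> (Suc j) \<cdot> y" using xy(6) kj by (simp add: f_simps)
      have "D j \<cdot> y = Zero C (Dom C x) (V j)" using dy n1 kj by (simp add: Y_simps)
      then have "\<rho> j \<cdot> (D j \<cdot> y) = Zero C (Dom C x) (tm Z (Suc (Suc j)))" using n1 by simp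
      then have Dy: "df Z (Suc (Suc (Suc j))) \<cdot> (\<rho> (Suc j) \<cdot> y) \<boxplus> \<psi> (Suc (Suc j)) \<cdot> (\<pi> (Suc j) \<cdot> y) =
          Zero C (Dom C x) (tm Z (Suc (Suc j)))"
        using n1 by (simp add: D_def)
      \<comment> \<open>Here anticommutation enters: the subtracted term contributes to the boundary
        with a plus sign, which makes the boundary of \<open>?e\<close> the vanishing left side of
        \<open>Dy\<close>.\<close>
      let ?e = "\<rho> (Suc j) \<cdot> y \<boxplus> Neg C (\<psi> (Suc (Suc (Suc j))) \<cdot> x)"
      have e: "?e \<in> Arr C" "Dom C ?e = Dom C x" "Cod C ?e = tm Z (Suc (Suc (Suc j)))" using n1 by simp_all
      have "df Z (Suc (Suc (Suc j))) \<cdot> ?e = Zero C (Dom C x) (tm Z (Suc (Suc j)))"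
        using n1 Dy by (simp add: d\<psi>x eq)
      then have de: "df Z (Suc (Suc (Suc j))) \<cdot> ?e = Zero C (Dom C ?e) (tm Z (Suc (Suc j)))" unfolding e .
      from lex_lift[OF Zl n1 e(1,3) de]
      obtain w where w: "w \<in> Arr C" "Dom C w = Dom C x" "Cod C w = tm Z (Suc (Suc (Suc (Suc j))))"
        "df Z (Suc (Suc (Suc (Suc j)))) \<cdot> w = ?e" unfolding e by auto
      let ?u = "\<sigma> (Suc (Suc j)) \<cdot> w \<boxplus> \<tau> (Suc (Suc j)) \<cdot> x"
      have "D (Suc j) \<cdot> ?u = \<sigma> (Suc j) \<cdot> (df Z (Suc (Suc (Suc (Suc j)))) \<cdot> w \<boxplus> \<psi> (Suc (Suc (Suc j))) \<cdot> x) \<boxplus>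
          \<tau> (Suc j) \<cdot> (df X (Suc (Suc (Suc j))) \<cdot> x)"
        using w(1-3) n1 by (simp add: D_def)
      also have "df Z (Suc (Suc (Suc (Suc j)))) \<cdot> w \<boxplus> \<psi> (Suc (Suc (Suc j))) \<cdot> x = \<rho> (Suc j) \<cdot> y"
        unfolding w(4) using n1 by simp
      also have "\<sigma> (Suc j) \<cdot> (\<rho> (Suc j) \<cdot> y) \<boxplus> \<tau> (Suc j) \<cdot> (df X (Suc (Suc (Suc j))) \<cdot> x) = y"
        unfolding eq by (rule sum) (use n1 in simp_all)
      finally show ?thesis using w(1-3) n1 kj
        by (intro bexI[of _ ?u]) (simp_all add: Y_simps f_simps)
    qed
  next
    fix y assume y: "y \<in> Arr C" "Cod C y = tm Y n" "f n \<cdot> y = Zero C (Dom C y) (tm X n)"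
      "df Y n \<cdot> y = Zero C (Dom C y) (tm Y (n - 1))"
    note [simp] = y(1)
    \<comment> \<open>For \<open>n = 1\<close> the top term has no added summand, and the vanishing
      of \<open>a\<close> and \<open>b\<close> on \<open>y\<close> means that \<open>d2\<close>
      vanishes on it. Otherwise \<open>f n\<close> kills the added component of \<open>y\<close>,
      and the other component lies in the kernel of the monic top differential of
      \<open>Z\<close>.\<close>
    have "n = Suc 0 \<or> (\<exists>j. n = Suc (Suc j))" using cases[of n] n_pos by auto
    then show "y = Zero C (Dom C y) (tm Y n)"
    proof (elim disjE exE)
      assume n1: "n = Suc 0"
      then have yc [simp]: "Cod C y = tm Z (Suc (Suc 0))" using y(2) Y_simps(2)[of 0] z0 by simp
      have ay: "a \<cdot> y = Zero C (Dom C y) (tm X (Suc 0))" "b \<cdot> y = Zero C (Dom C y) B"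
        using y(3,4) Y_simps(1,3) f_simps(2) unfolding n1 by simp_all
      have d2y: "d2 \<cdot> y = Zero C (Dom C y) (vertex S)"
        by (rule biprod_ext[OF S]) (use ay in \<open>simp_all add: a_def b_def\<close>)
      have "y = Zero C (Dom C y) (tm Z (Suc n))"
        by (rule lex_top[OF Zl]) (use d2y in \<open>simp_all add: n1 d2_def\<close>)
      moreover have "tm Y n = tm Z (Suc n)" using n1 Y_simps(2)[of 0] z0 by simp
      ultimately show ?thesis by metis
    next
      fix j assume nj: "n = Suc (Suc j)"
      then have j: "Suc j < n" by simp
      have Yn: "tm Y n = V (Suc j)" using j Y_simps(2)[of "Suc j"] nj by simp
      then have yc [simp]: "Cod C y = V (Suc j)" using y(2) by simp
      have py: "\<pi> (Suc j) \<cdot> y = Zero C (Dom C y) (tm X (Suc (Suc j)))"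
        using y(3) unfolding nj f_simps .
      have "D j \<cdot> y = Zero C (Dom C y) (V j)"
        using y(4) Y_simps(4)[OF j] Y_simps(2)[of j] j unfolding nj by simp
      then have "\<rho> j \<cdot> (D j \<cdot> y) = Zero C (Dom C y) (tm Z (Suc (Suc j)))" using j by simp
      then have dr: "df Z (Suc n) \<cdot> (\<rho> (Suc j) \<cdot> y) = Zero C (Dom C (\<rho> (Suc j) \<cdot> y)) (tm Z n)"
        using j by (simp add: D_def py) (simp add: nj)
      have "\<rho> (Suc j) \<cdot> y = Zero C (Dom C (\<rho> (Suc j) \<cdot> y)) (tm Z (Suc n))"
        by (rule lex_top[OF Zl _ _ dr]) (use j nj in simp_all)
      moreover have "Dom C (\<rho> (Suc j) \<cdot> y) = Dom C y" using j by simp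
      ultimately have ry: "\<rho> (Suc j) \<cdot> y = Zero C (Dom C y) (tm Z (Suc n))" by metis
      have "y = \<sigma> (Suc j) \<cdot> (\<rho> (Suc j) \<cdot> y) \<boxplus> \<tau> (Suc j) \<cdot> (\<pi> (Suc j) \<cdot> y)"
        by (rule sum[symmetric]) (use j in simp_all)
      also have "\<dots> = Zero C (Dom C y) (V (Suc j))" unfolding ry py using j nj by simp
      finally show ?thesis unfolding Yn .
    qed
  qed
  then show ?thesis using Yc fm bdef f_simps(1) Y_simps(3) by (intro exI[of _ Y] exI[of _ f]) simp
qed

end

section \<open>From the elementary axioms to both definitions\<close>

context elementary_structure
begin

lemma axiom_E2_op: "axiom_E2_op C n \<X>"
  unfolding axiom_E2_op_def
proof (intro ballI impI)
  fix X g assume X: "X \<in> \<X>" and g: "g \<in> Arr C" "Cod C g = tm X 0"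
  note Xc = mem_complex[OF X]
  obtain Y f where Y: "f 0 = g" "is_complex C 0 n Y" "is_cpx_morphism C 0 n Y X f"
    "pullback_exact C n Y X f" "df Y (Suc 0) \<in> deflations \<X>"
    using ex_pullback[OF X g] by blast
  have "left_n_exact C n (cone C n (\<lambda>k. biprod C (tm X k) (tm Y (k - 1))) Y X f)"
    by (rule cone_left_n_exact[OF n_pos Xc Y(2,3) _ Y(4)])
      (use biprod cpxD(1)[OF Xc] cpxD(1)[OF Y(2)] in auto)
  then have "is_n_pullback C n Y X f"
    unfolding is_n_pullback_def pullback_cone_eq[OF n_pos Xc Y(2,3)] using Y by simp
  then show "\<exists>Y f. f 0 = g \<and> is_n_pullback C n Y X f \<and> df Y 1 \<in> deflations \<X>"
    using Y(1,5) by (intro exI[of _ Y] exI[of _ f]) simp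
qed

lemma axiom_E2: "axiom_E2 C n \<X>"
  unfolding axiom_E2_def
proof (intro ballI impI)
  fix X g assume X: "X \<in> \<X>" and g: "g \<in> Arr C" "Dom C g = tm X (n + 1)"
  interpret O: elementary_structure "opc C" n "revc (Suc n) ` \<X>" by (rule elementary_structure_opc)
  have g': "g \<in> Arr (opc C)" "Cod (opc C) g = tm (revc (Suc n) X) 0" using g by (simp_all add: revc_simps)
  obtain Y f where Y: "f 0 = g" "is_complex (opc C) 0 n Y" "is_cpx_morphism (opc C) 0 n Y (revc (Suc n) X) f"
    "pullback_exact (opc C) n Y (revc (Suc n) X) f" "df Y (Suc 0) \<in> inflations n \<X>"
    using O.ex_pullback[OF imageI[OF X] g'] unfolding deflations_revc by blast
  have "is_n_pushout C n X (shift_revc n Y) (\<lambda>k. f (Suc n - k))"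
    by (rule pushout_of_op[OF n_pos mem_complex[OF X] Y(2-4)])
  moreover have "df (shift_revc n Y) (n + 1) = df Y (Suc 0)" using n_pos by (simp add: shift_revc_def)
  ultimately show "\<exists>Y f. f (n + 1) = g \<and> is_n_pushout C n X Y f \<and> df Y (n + 1) \<in> inflations n \<X>"
    using Y(1,5) by (intro exI[of _ "shift_revc n Y"] exI[of _ "\<lambda>k. f (Suc n - k)"]) simp
qed

lemma n_exact_structure_J: "n_exact_structure_J C n \<X>"
  unfolding n_exact_structure_J_def
  using weak_isomorphism_closed zero_mem inflations_comp deflations_comp axiom_E2 axiom_E2_op by simp

text \<open>By exactness the second differential of a conflation ending in the row is a weak kernel
  of it, and \<open>summand_deflation\<close> treats its second component. The biproduct is
  arbitrary because the dual axiom needs a reversed one.\<close>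

lemma deflation_weak_kernel:
  assumes d: "d \<in> deflations \<X>" and g: "g \<in> Arr C" "Cod C g = Cod C d"
    and S: "is_biproduct C (Dom C d) (Dom C g) S"
  shows "Neg C d \<cdot> pr1 S \<boxplus> g \<cdot> pr2 S \<in> deflations \<X>"
    and "\<exists>Y\<in>Obj C. \<exists>p\<in>Hom C Y (Dom C d). \<exists>q\<in>Hom C Y (Dom C g).
      is_weak_kernel C (Neg C d \<cdot> pr1 S \<boxplus> g \<cdot> pr2 S) (in1 S \<cdot> p \<boxplus> in2 S \<cdot> q) \<and> q \<in> deflations \<X>"
proof -
  obtain X where X: "X \<in> \<X>" "df X (Suc 0) = d" using d by (rule deflationE)
  note Xc = mem_complex[OF X(1)]
  have dt [simp]: "d \<in> Arr C" "Dom C d = tm X (Suc 0)" "Cod C d = tm X 0"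
    using cpxD(2-4)[OF Xc, of 0] X(2) by simp_all
  obtain Z where Z: "Z \<in> \<X>" "tm Z 0 = tm X 0" "tm Z (Suc 0) = vertex S"
    and dZ: "df Z (Suc 0) = Neg C d \<cdot> pr1 S \<boxplus> g \<cdot> pr2 S"
    using ex_resolution[OF X(1) g(1), of S] g S X(2) by auto
  show "Neg C d \<cdot> pr1 S \<boxplus> g \<cdot> pr2 S \<in> deflations \<X>"
    using deflationI[OF Z(1)] dZ by simp
  note Zl = mem_left[OF Z(1)]
  note [simp] = cpxD[OF Xc] cpxD[OF lex_complex[OF Zl]] biprodD[OF S] Z(2,3)
  have [simp]: "tm Z (Suc (Suc 0)) \<in> Obj C" "df Z (Suc (Suc 0)) \<in> Arr C"
    "Dom C (df Z (Suc (Suc 0))) = tm Z (Suc (Suc 0))" "Cod C (df Z (Suc (Suc 0))) = vertex S"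
    using n_pos by simp_all
  let ?p = "pr1 S \<cdot> df Z (Suc (Suc 0))" and ?q = "pr2 S \<cdot> df Z (Suc (Suc 0))"
  have q: "?q \<in> deflations \<X>" by (rule summand_deflation[OF Z(1) d g S dZ])
  have pq: "in1 S \<cdot> ?p \<boxplus> in2 S \<cdot> ?q = df Z (Suc (Suc 0))"
    by (rule biprod_expand[OF S, symmetric]) simp_all
  have "is_weak_kernel C (df Z (Suc 0)) (df Z (Suc (Suc 0)))"
    unfolding is_weak_kernel_def
  proof (intro conjI ballI impI; (elim conjE)?)
    show "df Z (Suc 0) \<cdot> df Z (Suc (Suc 0)) =
      Zero C (Dom C (df Z (Suc (Suc 0)))) (Cod C (df Z (Suc 0)))" using n_pos cpxD(5)[OF lex_complex[OF Zl], of 0] by simp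
    fix h assume h: "h \<in> Arr C" "Cod C h = Dom C (df Z (Suc 0))"
      "df Z (Suc 0) \<cdot> h = Zero C (Dom C h) (Cod C (df Z (Suc 0)))"
    have "Cod C h = tm Z (Suc 0)" "df Z (Suc 0) \<cdot> h = Zero C (Dom C h) (tm Z 0)"
      using h(2,3) by simp_all
    from lex_lift[OF Zl n_pos h(1) this]
    show "\<exists>u\<in>Hom C (Dom C h) (Dom C (df Z (Suc (Suc 0)))). df Z (Suc (Suc 0)) \<cdot> u = h"
      by (simp add: Bex_def)
  qed simp_all
  then show "\<exists>Y\<in>Obj C. \<exists>p\<in>Hom C Y (Dom C d). \<exists>q\<in>Hom C Y (Dom C g).
      is_weak_kernel C (Neg C d \<cdot> pr1 S \<boxplus> g \<cdot> pr2 S) (in1 S \<cdot> p \<boxplus> in2 S \<cdot> q) \<and> q \<in> deflations \<X>"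
    unfolding dZ[symmetric]
    by (intro bexI[of _ "tm Z (Suc (Suc 0))"] bexI[of _ ?p] bexI[of _ ?q] conjI)
      (use q in \<open>simp_all only: pq\<close>, simp_all)
qed

lemma axiom_Ex2_op: "axiom_Ex2_op C \<X>"
  unfolding axiom_Ex2_op_def
proof (intro ballI impI)
  fix d g assume d: "d \<in> deflations \<X>" and g: "g \<in> Arr C" "Cod C g = Cod C d"
  note [simp] = deflation_typing[OF d] g(1)
  let ?S = "biprod C (Dom C d) (Dom C g)"
  have S: "is_biproduct C (Dom C d) (Dom C g) ?S" by (rule biprod) simp_all
  have r: "row C (Neg C d) g = Neg C d \<cdot> pr1 ?S \<boxplus> g \<cdot> pr2 ?S" by (simp add: row_def Let_def)
  have c: "col C p q = in1 ?S \<cdot> p \<boxplus> in2 ?S \<cdot> q" if "p \<in> Hom C Y (Dom C d)" "q \<in> Hom C Y (Dom C g)" for p q Y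
    using that by (simp add: col_def Let_def)
  show "row C (Neg C d) g \<in> deflations \<X> \<and> (\<exists>Y1\<in>Obj C. \<exists>f'\<in>Hom C Y1 (Dom C d). \<exists>dY\<in>Hom C Y1 (Dom C g).
    is_weak_kernel C (row C (Neg C d) g) (col C f' dY) \<and> dY \<in> deflations \<X>)"
    unfolding r using deflation_weak_kernel[OF d g S] c by (metis (no_types, lifting))
qed

lemma axiom_Ex2: "axiom_Ex2 C n \<X>"
  unfolding axiom_Ex2_def
proof (intro ballI impI)
  fix d g assume d: "d \<in> inflations n \<X>" and g: "g \<in> Arr C" "Dom C g = Dom C d"
  interpret O: elementary_structure "opc C" n "revc (Suc n) ` \<X>" by (rule elementary_structure_opc)
  have d': "d \<in> deflations (revc (Suc n) ` \<X>)" using d by (simp add: deflations_revc)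
  have [simp]: "d \<in> Arr C" "g \<in> Arr C" using O.deflation_typing[OF d'] g by simp_all
  let ?S = "biprod C (Cod C d) (Cod C g)"
  have S: "is_biproduct C (Cod C d) (Cod C g) ?S" by (rule biprod) simp_all
  have r: "col C (Neg C d) g = in1 ?S \<cdot> Neg C d \<boxplus> in2 ?S \<cdot> g" by (simp add: col_def Let_def)
  have c: "row C p q = p \<cdot> pr1 ?S \<boxplus> q \<cdot> pr2 ?S" if "p \<in> Hom C (Cod C d) Y" "q \<in> Hom C (Cod C g) Y" for p q Y
    using that by (simp add: row_def Let_def)
  have wk: "is_weak_kernel (opc C) r s = is_weak_cokernel C r s" for r s
    by (simp add: is_weak_kernel_def is_weak_cokernel_def Hom_opc)
  \<comment> \<open>The reversed chosen biproduct of \<open>C\<close> makes the row of the opposite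
    category the column in \<open>axiom_Ex2\<close>.\<close>
  note * = O.deflation_weak_kernel[OF d' _ _ is_biproduct_opc[of C "Cod C d" "Cod C g" ?S, folded opc_simps(3)],
      unfolded deflations_revc opc_simps opb_simps Neg_opc wk Hom_opc, OF g S]
  show "col C (Neg C d) g \<in> inflations n \<X> \<and> (\<exists>Yn\<in>Obj C. \<exists>f'\<in>Hom C (Cod C d) Yn. \<exists>dY\<in>Hom C (Cod C g) Yn.
    is_weak_cokernel C (col C (Neg C d) g) (row C f' dY) \<and> dY \<in> inflations n \<X>)"
    unfolding r using * c by (metis (no_types, lifting))
qed

lemma n_exact_structure_H: "n_exact_structure_H C n \<X>"
  unfolding n_exact_structure_H_def
  using homotopy_closed zero_mem inflations_comp deflations_comp axiom_Ex2 axiom_Ex2_op by auto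

end

section \<open>From Definition H to the elementary axioms\<close>

lemma (in icat) elementary_if_H:
  assumes n: "0 < n" and ex: "\<forall>X\<in>\<X>. n_exact C n X" and H: "n_exact_structure_H C n \<X>"
  shows "elementary_structure C n \<X>"
proof (intro elementary_structure.intro elementary_structure_axioms.intro)
  note H' = H[unfolded n_exact_structure_H_def Suc_eq_plus1[symmetric]]
  show "icat C" by unfold_locales
  show "0 < n" by (rule n)
  show "n_exact C n X" if "X \<in> \<X>" for X using ex that by blast
  show "Y \<in> \<X>" if "X \<in> \<X>" "is_complex C 0 (Suc n) Y" "homotopy_equivalent C (Suc n) X Y" for X Y
    using H' that by blast
  show "zero_complex C (Suc n) \<in> \<X>" "closed_under_composition C (deflations \<X>)"
    "closed_under_composition C (inflations n \<X>)" using H' by blast+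
  have Dt: "d \<in> Arr C" if "d \<in> deflations \<X>" for d
    using that ex cpxD(2)[OF n_exact_complex] by (auto simp: deflations_def)
  have It: "d \<in> Arr C" if "d \<in> inflations n \<X>" for d
    using that ex cpxD(2)[OF n_exact_complex] by (auto simp: inflations_def)
  show "pulls_back C (deflations \<X>)"
    unfolding pulls_back_def
  proof (intro ballI impI)
    fix d g assume d: "d \<in> deflations \<X>" and g: "g \<in> Arr C" "Cod C g = Cod C d"
    have "axiom_Ex2_op C \<X>" using H' by blast
    then obtain Y p q where Y [simp]: "Y \<in> Obj C" and pq: "p \<in> Hom C Y (Dom C d)" "q \<in> Hom C Y (Dom C g)"
      "is_weak_kernel C (row C (Neg C d) g) (col C p q)" "q \<in> deflations \<X>"
      unfolding axiom_Ex2_op_def using d g by blast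
    let ?S = "biprod C (Dom C d) (Dom C g)"
    note [simp] = Dt[OF d] g
    have S: "is_biproduct C (Dom C d) (Dom C g) ?S" by (rule biprod) simp_all
    note [simp] = biprodD[OF S]
    have [simp]: "p \<in> Arr C" "Dom C p = Y" "Cod C p = Dom C d" "q \<in> Arr C" "Dom C q = Y" "Cod C q = Dom C g"
      using pq by auto
    \<comment> \<open>That a weak kernel composes to zero is the commutativity of the square, the
      sign being built into the row.\<close>
    have "row C (Neg C d) g \<cdot> col C p q = Zero C (Dom C (col C p q)) (Cod C (row C (Neg C d) g))"
      using pq(3) by (simp add: is_weak_kernel_def)
    then have "Neg C (d \<cdot> p) \<boxplus> g \<cdot> q = Zero C Y (Cod C d)"
      by (simp add: row_def col_def Let_def)
    then have "d \<cdot> p = g \<cdot> q" by (rule neg_add_zeroD) simp_all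
    then show "\<exists>q\<in>deflations \<X>. \<exists>p\<in>Arr C. Dom C p = Dom C q \<and> Cod C p = Dom C d \<and>
        Cod C q = Dom C g \<and> d \<cdot> p = g \<cdot> q"
      using pq(4) by (intro bexI[of _ q] bexI[of _ p]) simp_all
  qed
  show "pulls_back (opc C) (inflations n \<X>)"
    unfolding pulls_back_def opc_simps
  proof (intro ballI impI)
    fix d g assume d: "d \<in> inflations n \<X>" and g: "g \<in> Arr C" "Dom C g = Dom C d"
    have "axiom_Ex2 C n \<X>" using H' by blast
    then obtain Y p q where Y [simp]: "Y \<in> Obj C" and pq: "p \<in> Hom C (Cod C d) Y" "q \<in> Hom C (Cod C g) Y"
      "is_weak_cokernel C (col C (Neg C d) g) (row C p q)" "q \<in> inflations n \<X>"
      unfolding axiom_Ex2_def using d g by blast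
    let ?S = "biprod C (Cod C d) (Cod C g)"
    note [simp] = It[OF d] g
    have S: "is_biproduct C (Cod C d) (Cod C g) ?S" by (rule biprod) simp_all
    note [simp] = biprodD[OF S]
    have [simp]: "p \<in> Arr C" "Cod C p = Y" "Dom C p = Cod C d" "q \<in> Arr C" "Cod C q = Y" "Dom C q = Cod C g"
      using pq by auto
    have "row C p q \<cdot> col C (Neg C d) g = Zero C (Dom C (col C (Neg C d) g)) (Cod C (row C p q))"
      using pq(3) by (simp add: is_weak_cokernel_def)
    then have "Neg C (p \<cdot> d) \<boxplus> q \<cdot> g = Zero C (Dom C d) Y"
      by (simp add: row_def col_def Let_def)
    then have "p \<cdot> d = q \<cdot> g" by (rule neg_add_zeroD) simp_all
    then show "\<exists>q\<in>inflations n \<X>. \<exists>p\<in>Arr C. Cod C p = Cod C q \<and> Dom C p = Cod C d \<and>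
        Dom C q = Cod C g \<and> p \<cdot> d = q \<cdot> g"
      using pq(4) by (intro bexI[of _ q] bexI[of _ p]) simp_all
  qed
qed

section \<open>From Definition J to the elementary axioms\<close>

text \<open>Uniqueness is expressed as triviality of the joint kernel of \<open>p\<close> and
  \<open>q\<close>; commutativity of the square is stated beside it in
  \<open>pulls_back_J\<close>.\<close>

definition strict_pullback :: "('o, 'm) cat \<Rightarrow> 'm \<Rightarrow> 'm \<Rightarrow> 'm \<Rightarrow> 'm \<Rightarrow> bool" where
  "strict_pullback C d g p q \<longleftrightarrow>
    (\<forall>x\<in>Arr C. \<forall>y\<in>Arr C. Dom C y = Dom C x \<and> Cod C x = Dom C d \<and> Cod C y = Dom C g \<and>
       d \<cdot>\<^bsub>C\<^esub> x = g \<cdot>\<^bsub>C\<^esub> y \<longrightarrow>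
       (\<exists>u\<in>Hom C (Dom C x) (Dom C q). p \<cdot>\<^bsub>C\<^esub> u = x \<and> q \<cdot>\<^bsub>C\<^esub> u = y)) \<and>
    (\<forall>u\<in>Arr C. Cod C u = Dom C q \<and> p \<cdot>\<^bsub>C\<^esub> u = Zero C (Dom C u) (Cod C p) \<and>
       q \<cdot>\<^bsub>C\<^esub> u = Zero C (Dom C u) (Cod C q) \<longrightarrow> u = Zero C (Dom C u) (Dom C q))"

text \<open>
  For \<open>n = 1\<close> a weak isomorphism is an isomorphism, so that the pullbacks of Definition J have to
  be used as genuine pullbacks in order to add contractible summands; for \<open>n \<ge> 2\<close> weak pullbacks
  suffice.
\<close>

definition pulls_back_J :: "('o, 'm) cat \<Rightarrow> nat \<Rightarrow> ('o, 'm) cpx set \<Rightarrow> bool" where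
  "pulls_back_J C n \<X> \<longleftrightarrow> (\<forall>X\<in>\<X>. \<forall>g\<in>Arr C. Cod C g = tm X 0 \<longrightarrow>
    (\<exists>q\<in>deflations \<X>. \<exists>p\<in>Arr C. Dom C p = Dom C q \<and> Cod C p = tm X (Suc 0) \<and> Cod C q = Dom C g \<and>
      df X (Suc 0) \<cdot>\<^bsub>C\<^esub> p = g \<cdot>\<^bsub>C\<^esub> q \<and>
      (n = Suc 0 \<longrightarrow> strict_pullback C (df X (Suc 0)) g p q)))"

text \<open>The n-pullbacks and n-pushouts enter as \<open>pulls_back_J\<close> in \<open>C\<close>
  and in its opposite, a form that makes the structure self-dual.\<close>

locale jasso_structure = icat C for C :: "('o, 'm) cat" (structure) +
  fixes n :: nat and \<X> :: "('o, 'm) cpx set"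
  assumes n_pos: "0 < n"
    and exact: "X \<in> \<X> \<Longrightarrow> n_exact C n X"
    and weak_isomorphism_closed: "is_weak_isomorphism C n Y X f \<Longrightarrow> X \<in> \<X> \<longleftrightarrow> Y \<in> \<X>"
    and zero_mem: "zero_complex C (Suc n) \<in> \<X>"
    and deflations_comp: "closed_under_composition C (deflations \<X>)"
    and inflations_comp: "closed_under_composition C (inflations n \<X>)"
    and pull: "pulls_back_J C n \<X>"
    and push: "pulls_back_J (opc C) n (revc (Suc n) ` \<X>)"

section \<open>Strict pullbacks that add or remove a contractible summand\<close>

context pcat
begin

lemma is_iso_ident: "A \<in> Obj C \<Longrightarrow> is_iso C (Ident C A)"
  unfolding is_iso_def by (auto intro!: bexI[of _ "Ident C A"])

text \<open>The universal arrow has the components \<open>x\<close> and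
  \<open>pr2 S \<cdot> y\<close>. For \<open>n = 1\<close> this base change along a projection is
  what adds a contractible summand.\<close>

lemma strict_pullback_contractible_pr:
  assumes d: "d \<in> Hom C A' A" and S: "is_biproduct C A B S" and S': "is_biproduct C A' B S'"
  shows "strict_pullback C d (pr1 S) (pr1 S') (in1 S \<cdot> (d \<cdot> pr1 S') \<boxplus> in2 S \<cdot> pr2 S')"
  unfolding strict_pullback_def
proof (intro conjI ballI impI; (elim conjE)?)
  note [simp] = biprodD[OF S] biprodD[OF S']
  have [simp]: "d \<in> Arr C" "Dom C d = A'" "Cod C d = A" using d by auto
  let ?q = "in1 S \<cdot> (d \<cdot> pr1 S') \<boxplus> in2 S \<cdot> pr2 S'"
  {
    fix x y assume xy: "x \<in> Arr C" "y \<in> Arr C" "Dom C y = Dom C x" "Cod C x = Dom C d"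
      "Cod C y = Dom C (pr1 S)" and eq: "d \<cdot> x = pr1 S \<cdot> y"
    have [simp]: "x \<in> Arr C" "y \<in> Arr C" "Dom C y = Dom C x" "Cod C x = A'" "Cod C y = vertex S"
      using xy by simp_all
    have "in1 S \<cdot> (pr1 S \<cdot> y) \<boxplus> in2 S \<cdot> (pr2 S \<cdot> y) = y" by (rule biprod_expand[OF S, symmetric]) simp_all
    then show "\<exists>u\<in>Hom C (Dom C x) (Dom C ?q). pr1 S' \<cdot> u = x \<and> ?q \<cdot> u = y"
      by (intro bexI[of _ "in1 S' \<cdot> x \<boxplus> in2 S' \<cdot> (pr2 S \<cdot> y)"]) (simp_all add: eq)
  }
  fix u assume u: "u \<in> Arr C" "Cod C u = Dom C ?q" "pr1 S' \<cdot> u = Zero C (Dom C u) (Cod C (pr1 S'))"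
    "?q \<cdot> u = Zero C (Dom C u) (Cod C ?q)"
  have [simp]: "u \<in> Arr C" "Cod C u = vertex S'" using u by simp_all
  have "pr2 S \<cdot> (?q \<cdot> u) = Zero C (Dom C u) B" unfolding u(4) by simp
  then have p2: "pr2 S' \<cdot> u = Zero C (Dom C u) B" by simp
  have q: "Dom C ?q = vertex S'" by simp
  show "u = Zero C (Dom C u) (Dom C ?q)"
    unfolding q by (rule biprod_ext[OF S']) (use u(3) p2 in simp_all)
qed

text \<open>The equation forces the added component of \<open>x\<close> to vanish, so base change
  along an inclusion removes the identity summand again.\<close>

lemma strict_pullback_contractible_in:
  assumes d: "d \<in> Hom C A' A" and S: "is_biproduct C A B S" and S': "is_biproduct C A' B S'"
  shows "strict_pullback C (in1 S \<cdot> (d \<cdot> pr1 S') \<boxplus> in2 S \<cdot> pr2 S') (in1 S) (in1 S') d"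
  unfolding strict_pullback_def
proof (intro conjI ballI impI; (elim conjE)?)
  note [simp] = biprodD[OF S] biprodD[OF S']
  have [simp]: "d \<in> Arr C" "Dom C d = A'" "Cod C d = A" using d by auto
  let ?q = "in1 S \<cdot> (d \<cdot> pr1 S') \<boxplus> in2 S \<cdot> pr2 S'"
  {
    fix x y assume xy: "x \<in> Arr C" "y \<in> Arr C" "Dom C y = Dom C x" "Cod C x = Dom C ?q"
      "Cod C y = Dom C (in1 S)" and eq: "?q \<cdot> x = in1 S \<cdot> y"
    have [simp]: "x \<in> Arr C" "y \<in> Arr C" "Dom C y = Dom C x" "Cod C x = vertex S'" "Cod C y = A"
      using xy by simp_all
    have "pr2 S \<cdot> (?q \<cdot> x) = Zero C (Dom C x) B" unfolding eq by simp
    then have 1: "pr2 S' \<cdot> x = Zero C (Dom C x) B" by simp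
    have "pr1 S \<cdot> (?q \<cdot> x) = y" unfolding eq by simp
    then have 2: "d \<cdot> (pr1 S' \<cdot> x) = y" by simp
    have "in1 S' \<cdot> (pr1 S' \<cdot> x) \<boxplus> in2 S' \<cdot> (pr2 S' \<cdot> x) = x" by (rule biprod_expand[OF S', symmetric]) simp_all
    then have "in1 S' \<cdot> (pr1 S' \<cdot> x) = x" unfolding 1 by simp
    then show "\<exists>u\<in>Hom C (Dom C x) (Dom C d). in1 S' \<cdot> u = x \<and> d \<cdot> u = y"
      using 2 by (intro bexI[of _ "pr1 S' \<cdot> x"]) simp_all
  }
  fix u assume u: "u \<in> Arr C" "Cod C u = Dom C d" "in1 S' \<cdot> u = Zero C (Dom C u) (Cod C (in1 S'))"
  have [simp]: "u \<in> Arr C" "Cod C u = A'" using u by simp_all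
  have "pr1 S' \<cdot> (in1 S' \<cdot> u) = Zero C (Dom C u) A'" unfolding u(3) by simp
  moreover have "pr1 S' \<cdot> (in1 S' \<cdot> u) = u" "Dom C d = A'" by simp_all
  ultimately show "u = Zero C (Dom C u) (Dom C d)" by metis
qed

text \<open>For \<open>n = 1\<close> the cone has just two arrows, and left exactness makes the
  first a genuine kernel of the row.\<close>

lemma strict_pullback_if_left_exact:
  assumes K: "left_n_exact C (Suc 0) K" and d: "d \<in> Arr C" and g: "g \<in> Arr C" "Cod C g = Cod C d"
    and S: "is_biproduct C (Dom C d) (Dom C g) S"
    and p: "p \<in> Arr C" "Cod C p = Dom C d" and q: "q \<in> Arr C" "Cod C q = Dom C g" "Dom C q = Dom C p"
    and d1: "df K (Suc 0) = Neg C d \<cdot> pr1 S \<boxplus> g \<cdot> pr2 S"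
    and d2: "df K (Suc (Suc 0)) = in1 S \<cdot> p \<boxplus> in2 S \<cdot> q"
  shows "strict_pullback C d g p q"
  unfolding strict_pullback_def
proof (intro conjI ballI impI; (elim conjE)?)
  note [simp] = biprodD[OF S] d g p q
  note Kc = lex_complex[OF K]
  have tmK: "tm K 0 = Cod C d" "tm K (Suc 0) = vertex S" "tm K (Suc (Suc 0)) = Dom C p"
    using cpxD(3,4)[OF Kc, of 0] cpxD(3)[OF Kc, of "Suc 0"] d1 d2 by simp_all
  {
    fix x y assume xy: "x \<in> Arr C" "y \<in> Arr C" "Dom C y = Dom C x" "Cod C x = Dom C d" "Cod C y = Dom C g"
      and eq: "d \<cdot> x = g \<cdot> y"
    note [simp] = xy
    let ?h = "in1 S \<cdot> x \<boxplus> in2 S \<cdot> y"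
    have h: "?h \<in> Arr C" "Dom C ?h = Dom C x" "Cod C ?h = vertex S" by simp_all
    have "df K (Suc 0) \<cdot> ?h = Zero C (Dom C ?h) (tm K 0)" by (simp add: d1 eq tmK)
    from lex_lift[OF K _ h(1) _ this] obtain u where u: "u \<in> Arr C" "Dom C u = Dom C x"
      "Cod C u = Dom C p" "df K (Suc (Suc 0)) \<cdot> u = ?h" by (auto simp: tmK)
    note [simp] = u(1-3)
    have "pr1 S \<cdot> (df K (Suc (Suc 0)) \<cdot> u) = x" unfolding u(4) by simp
    moreover have "pr2 S \<cdot> (df K (Suc (Suc 0)) \<cdot> u) = y" unfolding u(4) by simp
    ultimately show "\<exists>u\<in>Hom C (Dom C x) (Dom C q). p \<cdot> u = x \<and> q \<cdot> u = y"
      by (intro bexI[of _ u]) (simp_all add: d2)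
  }
  fix u assume u: "u \<in> Arr C" "Cod C u = Dom C q" "p \<cdot> u = Zero C (Dom C u) (Cod C p)"
    "q \<cdot> u = Zero C (Dom C u) (Cod C q)"
  have [simp]: "u \<in> Arr C" "Cod C u = Dom C p" using u by simp_all
  have "df K (Suc (Suc 0)) \<cdot> u = Zero C (Dom C u) (tm K (Suc 0))"
    using u(3,4) by (simp add: d2 tmK)
  then have "u = Zero C (Dom C u) (tm K (Suc (Suc 0)))"
    by (intro lex_top[OF K]) (simp_all add: tmK)
  then show "u = Zero C (Dom C u) (Dom C q)" unfolding tmK q(3) .
qed

end

section \<open>Membership under weak isomorphisms and contractible summands\<close>

context jasso_structure
begin

lemma mem_complex: "X \<in> \<X> \<Longrightarrow> is_complex C 0 (Suc n) X"
  using exact n_exact_complex by blast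

lemma weak_isoI:
  assumes "n_exact C n Y" "n_exact C n X" "is_cpx_morphism C 0 (Suc n) Y X f"
    "(\<exists>k\<le>n. is_iso C (f k) \<and> is_iso C (f (Suc k))) \<or> is_iso C (f 0) \<and> is_iso C (f (Suc n))"
  shows "X \<in> \<X> \<longleftrightarrow> Y \<in> \<X>"
  by (rule weak_isomorphism_closed) (use assms in \<open>simp add: is_weak_isomorphism_def\<close>)

lemma jasso_structure_opc: "jasso_structure (opc C) n (revc (Suc n) ` \<X>)"
proof (intro jasso_structure.intro jasso_structure_axioms.intro icat_opc n_pos)
  show "n_exact (opc C) n X" if "X \<in> revc (Suc n) ` \<X>" for X
    using that exact n_exact_opc by blast
  show "X \<in> revc (Suc n) ` \<X> \<longleftrightarrow> Y \<in> revc (Suc n) ` \<X>"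
    if a: "is_weak_isomorphism (opc C) n Y X f" for X Y f
  proof -
    have ex: "n_exact (opc C) n X" "n_exact (opc C) n Y" "is_cpx_morphism (opc C) 0 (Suc n) Y X f"
      and iso: "(\<exists>k\<le>n. is_iso (opc C) (f k) \<and> is_iso (opc C) (f (Suc k))) \<or>
        is_iso (opc C) (f 0) \<and> is_iso (opc C) (f (Suc n))"
      using a by (simp_all add: is_weak_isomorphism_def)
    have iso_opc: "is_iso (opc C) h \<longleftrightarrow> is_iso C h" for h
      by (auto simp: is_iso_def Hom_opc)
    have "revc (Suc n) Y \<in> \<X> \<longleftrightarrow> revc (Suc n) X \<in> \<X>"
    proof (rule weak_isoI)
      show "n_exact C n (revc (Suc n) X)" "n_exact C n (revc (Suc n) Y)"
        using n_exact_opc[OF ex(1)] n_exact_opc[OF ex(2)] by simp_all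
      show "is_cpx_morphism C 0 (Suc n) (revc (Suc n) X) (revc (Suc n) Y) (\<lambda>k. f (Suc n - k))"
        using is_cpx_morphism_opc[OF ex(3)] by simp
      show "(\<exists>k\<le>n. is_iso C (f (Suc n - k)) \<and> is_iso C (f (Suc n - Suc k))) \<or>
        is_iso C (f (Suc n - 0)) \<and> is_iso C (f (Suc n - Suc n))"
        using iso
      proof (elim disjE exE conjE)
        fix k assume "k \<le> n" "is_iso (opc C) (f k)" "is_iso (opc C) (f (Suc k))"
        then show ?thesis by (intro disjI1 exI[of _ "n - k"]) (simp add: iso_opc Suc_diff_le)
      qed (simp add: iso_opc)
    qed
    moreover have "Z \<in> revc (Suc n) ` \<X> \<longleftrightarrow> revc (Suc n) Z \<in> \<X>" if Z: "n_exact (opc C) n Z" for Z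
      using revc_mem_iff[of \<X> C "Suc n" "revc (Suc n) Z", OF mem_complex] is_complex_revc[OF n_exact_complex[OF Z]]
        revc_revc[OF n_exact_complex[OF Z]] by simp
    ultimately show ?thesis using ex(1,2) by blast
  qed
  show "zero_complex (opc C) (Suc n) \<in> revc (Suc n) ` \<X>"
    using zero_mem by (simp add: zero_complex_opc)
  show "pulls_back_J (opc (opc C)) n (revc (Suc n) ` revc (Suc n) ` \<X>)"
  proof -
    have "revc (Suc n) (revc (Suc n) X) = X" if "X \<in> \<X>" for X
      by (rule revc_revc[OF mem_complex[OF that]])
    then have "revc (Suc n) ` revc (Suc n) ` \<X> = \<X>" by (force simp: image_image)
    then show ?thesis using pull by simp
  qed
qed (use deflations_comp inflations_comp push in
    \<open>simp_all add: deflations_revc inflations_revc closed_under_composition_opc\<close>)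

text \<open>The square extends to a chain map by lifting, and isomorphisms in the adjacent degrees 0
  and 1 make it a weak isomorphism.\<close>

lemma mem_if_square_01:
  assumes V: "V \<in> \<X>" and Y: "n_exact C n Y"
    and a: "a0 \<in> Hom C (tm V 0) (tm Y 0)" "a1 \<in> Hom C (tm V (Suc 0)) (tm Y (Suc 0))"
      "a0 \<cdot> df V (Suc 0) = df Y (Suc 0) \<cdot> a1" and iso: "is_iso C a0" "is_iso C a1"
  shows "Y \<in> \<X>"
proof -
  obtain f where f: "is_cpx_morphism C 0 (Suc n) V Y f" "f 0 = a0" "f (Suc 0) = a1"
    using lift_chain[OF mem_complex[OF V] _ a] Y by (auto simp: n_exact_def)
  have "Y \<in> \<X> \<longleftrightarrow> V \<in> \<X>"
    by (rule weak_isoI[OF exact[OF V] Y f(1)]) (use f iso in auto)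
  then show ?thesis using V by simp
qed

lemma mem_if_deflation:
  assumes Y: "n_exact C n Y" and d: "df Y (Suc 0) \<in> deflations \<X>"
  shows "Y \<in> \<X>"
proof -
  obtain V where V: "V \<in> \<X>" "df V (Suc 0) = df Y (Suc 0)" using d by (auto simp: deflations_def)
  note [simp] = cpxD[OF n_exact_complex[OF Y]]
  have t: "tm V 0 = tm Y 0" "tm V (Suc 0) = tm Y (Suc 0)"
    using cpxD(3,4)[OF mem_complex[OF V(1)], of 0] V(2) by simp_all
  show ?thesis
    by (rule mem_if_square_01[OF V(1) Y, of "Ident C (tm Y 0)" "Ident C (tm Y (Suc 0))"])
      (simp_all add: t V(2) is_iso_ident)
qed

text \<open>Pullbacks are unique up to isomorphism: comparison with the square given by
  \<open>pull\<close> yields inverse arrows in degree 1 over the identity in degree 0.\<close>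

lemma mem_if_strict_pullback:
  assumes n: "n = Suc 0" and X: "X \<in> \<X>" and Y: "n_exact C n Y"
    and a: "a0 \<in> Hom C (tm Y 0) (tm X 0)" "a1 \<in> Hom C (tm Y (Suc 0)) (tm X (Suc 0))"
      "a0 \<cdot> df Y (Suc 0) = df X (Suc 0) \<cdot> a1"
    and sp: "strict_pullback C (df X (Suc 0)) a0 a1 (df Y (Suc 0))"
  shows "Y \<in> \<X>"
proof -
  note [simp] = cpxD[OF mem_complex[OF X]] cpxD[OF n_exact_complex[OF Y]]
  have [simp]: "a0 \<in> Arr C" "Dom C a0 = tm Y 0" "Cod C a0 = tm X 0"
    "a1 \<in> Arr C" "Dom C a1 = tm Y (Suc 0)" "Cod C a1 = tm X (Suc 0)" using a by auto
  obtain q p where q: "q \<in> deflations \<X>" and p [simp]: "p \<in> Arr C" "Dom C p = Dom C q" "Cod C p = tm X (Suc 0)"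
      "Cod C q = tm Y 0" and eq: "df X (Suc 0) \<cdot> p = a0 \<cdot> q"
    and sq: "strict_pullback C (df X (Suc 0)) a0 p q"
    using pull[unfolded pulls_back_J_def, rule_format, OF X, of a0] n by auto
  obtain V where V: "V \<in> \<X>" "df V (Suc 0) = q" using q by (auto simp: deflations_def)
  note Vc = mem_complex[OF V(1)]
  have [simp]: "q \<in> Arr C" "Dom C q = tm V (Suc 0)" "tm V 0 = tm Y 0" "tm V (Suc 0) \<in> Obj C"
    using cpxD(1)[OF Vc, of "Suc 0"] cpxD(2-4)[OF Vc, of 0] V(2) p(4) by simp_all
  obtain u where u [simp]: "u \<in> Arr C" "Dom C u = tm V (Suc 0)" "Cod C u = tm Y (Suc 0)"
    and u1: "a1 \<cdot> u = p" "df Y (Suc 0) \<cdot> u = q"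
    using sp[unfolded strict_pullback_def, THEN conjunct1, rule_format, of p q] eq by auto
  obtain w where w [simp]: "w \<in> Arr C" "Cod C w = tm V (Suc 0)" "Dom C w = tm Y (Suc 0)"
    and w1: "p \<cdot> w = a1" "q \<cdot> w = df Y (Suc 0)"
    using sq[unfolded strict_pullback_def, THEN conjunct1, rule_format, of a1 "df Y (Suc 0)"] a(3) by auto
  have r: "a1 \<cdot> (u \<cdot> x) = p \<cdot> x" "df Y (Suc 0) \<cdot> (u \<cdot> x) = q \<cdot> x"
    if "x \<in> Arr C" "Cod C x = tm V (Suc 0)" for x
    using comp_eq_reassoc[OF u1(1), of x] comp_eq_reassoc[OF u1(2), of x] that by simp_all
  have r': "p \<cdot> (w \<cdot> x) = a1 \<cdot> x" "q \<cdot> (w \<cdot> x) = df Y (Suc 0) \<cdot> x"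
    if "x \<in> Arr C" "Cod C x = tm Y (Suc 0)" for x
    using comp_eq_reassoc[OF w1(1), of x] comp_eq_reassoc[OF w1(2), of x] that by simp_all
  \<comment> \<open>The difference between the composite and the identity is killed by both legs of
    the pullback.\<close>
  have "u \<cdot> w \<boxplus> Neg C (Ident C (tm Y (Suc 0))) =
      Zero C (Dom C (u \<cdot> w \<boxplus> Neg C (Ident C (tm Y (Suc 0))))) (Dom C (df Y (Suc 0)))"
    by (rule sp[unfolded strict_pullback_def, THEN conjunct2, rule_format]) (simp_all add: r w1)
  then have "u \<cdot> w \<boxplus> Neg C (Ident C (tm Y (Suc 0))) = Zero C (tm Y (Suc 0)) (tm Y (Suc 0))" by simp
  then have uw: "u \<cdot> w = Ident C (tm Y (Suc 0))" by (rule diff_zeroD) simp_all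
  have "w \<cdot> u \<boxplus> Neg C (Ident C (tm V (Suc 0))) =
      Zero C (Dom C (w \<cdot> u \<boxplus> Neg C (Ident C (tm V (Suc 0))))) (Dom C q)"
    by (rule sq[unfolded strict_pullback_def, THEN conjunct2, rule_format]) (simp_all add: r' u1)
  then have "w \<cdot> u \<boxplus> Neg C (Ident C (tm V (Suc 0))) = Zero C (tm V (Suc 0)) (tm V (Suc 0))" by simp
  then have wu: "w \<cdot> u = Ident C (tm V (Suc 0))" by (rule diff_zeroD) simp_all
  show ?thesis
  proof (rule mem_if_square_01[OF V(1) Y, of "Ident C (tm Y 0)" u])
    show "is_iso C u" unfolding is_iso_def using uw wu by (auto intro!: bexI[of _ w])
  qed (simp_all add: V(2) u1 is_iso_ident)
qed

lemma n_exact_add_contractible: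
  assumes V: "n_exact C n V" and k: "k \<le> n"
    and S: "is_biproduct C (tm V k) A S" and S': "is_biproduct C (tm V (Suc k)) A S'"
  shows "n_exact C n (add_contractible C (Suc n) V k S S')"
  using add_contractible(1,4)[OF n_exact_complex[OF V] _ S S'] k
  by (intro n_exact_homotopy_equivalent[OF V]) auto

text \<open>For \<open>n \<ge> 2\<close> the inclusion is the identity in degrees \<open>n\<close>
  and \<open>n + 1\<close>, above the added summand, hence a weak isomorphism. For
  \<open>n = 1\<close> degree 1 itself changes, and base change along the projection takes
  over.\<close>

lemma contractible_0:
  assumes V: "V \<in> \<X>" and S: "is_biproduct C (tm V 0) A S" and S': "is_biproduct C (tm V (Suc 0)) A S'"
  shows "add_contractible C (Suc n) V 0 S S' \<in> \<X>" (is "?W \<in> _")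
proof (cases "n = Suc 0")
  case True
  note Vc = mem_complex[OF V]
  note [simp] = cpxD[OF Vc]
  have W: "n_exact C n ?W" by (rule n_exact_add_contractible[OF exact[OF V] _ S S']) simp
  have m: "is_cpx_morphism C 0 (Suc n) ?W V (contractible_pr C V 0 S S')"
    by (rule contractible_pr_morphism[OF Vc _ S S']) simp
  show ?thesis
  proof (rule mem_if_strict_pullback[OF True V W])
    show "pr1 S \<in> Hom C (tm ?W 0) (tm V 0)" "pr1 S' \<in> Hom C (tm ?W (Suc 0)) (tm V (Suc 0))"
      using biprodD[OF S] biprodD[OF S'] True by (simp_all add: add_contractible_simps contractible_tm_def)
    show "pr1 S \<cdot> df ?W (Suc 0) = df V (Suc 0) \<cdot> pr1 S'"
      using mor_comm[OF m, of 0] by (simp add: contractible_pr_def)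
    show "strict_pullback C (df V (Suc 0)) (pr1 S) (pr1 S') (df ?W (Suc 0))"
      unfolding add_contractible_df1(1)[OF Vc zero_less_Suc S S']
      by (rule strict_pullback_contractible_pr[OF _ S S']) simp
  qed
next
  case False
  then have n2: "2 \<le> n" using n_pos by simp
  note Vc = mem_complex[OF V]
  have "?W \<in> \<X> \<longleftrightarrow> V \<in> \<X>"
  proof (rule weak_isoI[OF exact[OF V]])
    show "n_exact C n ?W" by (rule n_exact_add_contractible[OF exact[OF V] _ S S']) simp
    show "is_cpx_morphism C 0 (Suc n) V ?W (contractible_in C V 0 S S')"
      by (rule contractible_in_morphism[OF Vc _ S S']) simp
    have "is_iso C (contractible_in C V 0 S S' n)" "is_iso C (contractible_in C V 0 S S' (Suc n))"
      using n2 cpxD(1)[OF Vc, of n] cpxD(1)[OF Vc, of "Suc n"]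
      by (auto simp: contractible_in_def is_iso_ident)
    then show "(\<exists>k\<le>n. is_iso C (contractible_in C V 0 S S' k) \<and> is_iso C (contractible_in C V 0 S S' (Suc k))) \<or>
      is_iso C (contractible_in C V 0 S S' 0) \<and> is_iso C (contractible_in C V 0 S S' (Suc n))" by blast
  qed
  then show ?thesis using V by simp
qed

text \<open>For \<open>n \<ge> 2\<close> both ends are left alone. For \<open>n = 1\<close> the
  summand sits at the upper end; in the opposite category adding it is base change along a
  projection, and removing it is base change along an inclusion.\<close>

lemma contractible_1_iff:
  assumes V: "n_exact C n V" and S: "is_biproduct C (tm V (Suc 0)) A S"
    and S': "is_biproduct C (tm V (Suc (Suc 0))) A S'"
  shows "add_contractible C (Suc n) V (Suc 0) S S' \<in> \<X> \<longleftrightarrow> V \<in> \<X>" (is "?W \<in> _ \<longleftrightarrow> _")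
proof -
  note Vc = n_exact_complex[OF V]
  have n1: "Suc 0 \<le> n" "Suc 0 < Suc n" using n_pos by simp_all
  have W: "n_exact C n ?W" by (rule n_exact_add_contractible[OF V n1(1) S S'])
  note Wc = n_exact_complex[OF W]
  have i: "is_cpx_morphism C 0 (Suc n) V ?W (contractible_in C V (Suc 0) S S')"
    by (rule contractible_in_morphism[OF Vc n1(2) S S'])
  have p: "is_cpx_morphism C 0 (Suc n) ?W V (contractible_pr C V (Suc 0) S S')"
    by (rule contractible_pr_morphism[OF Vc n1(2) S S'])
  show ?thesis
  proof (cases "n = Suc 0")
    case False
    then have n2: "2 \<le> n" using n_pos by simp
    show ?thesis
    proof (rule weak_isoI[OF V W i])
      have "is_iso C (contractible_in C V (Suc 0) S S' 0)" "is_iso C (contractible_in C V (Suc 0) S S' (Suc n))"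
        using n2 cpxD(1)[OF Vc, of 0] cpxD(1)[OF Vc, of "Suc n"]
        by (auto simp: contractible_in_def is_iso_ident)
      then show "(\<exists>k\<le>n. is_iso C (contractible_in C V (Suc 0) S S' k) \<and> is_iso C (contractible_in C V (Suc 0) S S' (Suc k))) \<or>
        is_iso C (contractible_in C V (Suc 0) S S' 0) \<and> is_iso C (contractible_in C V (Suc 0) S S' (Suc n))" by blast
    qed
  next
    case True
    interpret O: jasso_structure "opc C" n "revc (Suc n) ` \<X>" by (rule jasso_structure_opc)
    note [simp] = cpxD[OF Vc] biprodD[OF S] biprodD[OF S']
    have tW: "tm ?W (Suc 0) = vertex S" "tm ?W (Suc (Suc 0)) = vertex S'"
      "df ?W (Suc (Suc 0)) = in1 S \<cdot> (df V (Suc (Suc 0)) \<cdot> pr1 S') \<boxplus> in2 S \<cdot> pr2 S'"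
    proof -
      show "tm ?W (Suc 0) = vertex S" "tm ?W (Suc (Suc 0)) = vertex S'"
        using True by (simp_all add: add_contractible_simps contractible_tm_def)
      have "df ?W (Suc (Suc 0)) = contractible_in C V (Suc 0) S S' (Suc 0) \<cdot>
          (df V (Suc (Suc 0)) \<cdot> contractible_pr C V (Suc 0) S S' (Suc (Suc 0))) \<boxplus> in2 S \<cdot> pr2 S'"
        by (subst add_contractible_simps(2)) (use True in simp_all)
      then show "df ?W (Suc (Suc 0)) = in1 S \<cdot> (df V (Suc (Suc 0)) \<cdot> pr1 S') \<boxplus> in2 S \<cdot> pr2 S'"
        by (simp add: contractible_in_def contractible_pr_def)
    qed
    note tW = tW tW[unfolded True]
    have d: "df V (Suc (Suc 0)) \<in> Hom (opc C) (tm V (Suc 0)) (tm V (Suc (Suc 0)))" using True by (simp add: Hom_opc)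
    have dW: "df ?W (Suc (Suc 0)) = in1 (opb S') \<cdot>\<^bsub>opc C\<^esub> (df V (Suc (Suc 0)) \<cdot>\<^bsub>opc C\<^esub> pr1 (opb S)) \<boxplus>\<^bsub>opc C\<^esub>
      in2 (opb S') \<cdot>\<^bsub>opc C\<^esub> pr2 (opb S)"
      using True by (simp add: tW)
    have "revc (Suc n) ?W \<in> revc (Suc n) ` \<X>" if "V \<in> \<X>"
    proof (rule O.mem_if_strict_pullback[OF True imageI[OF that] n_exact_opc[OF W], of "in1 S'" "in1 S"])
      show "strict_pullback (opc C) (df (revc (Suc n) V) (Suc 0)) (in1 S') (in1 S) (df (revc (Suc n) ?W) (Suc 0))"
        using O.strict_pullback_contractible_pr[OF d is_biproduct_opc[OF S'] is_biproduct_opc[OF S]] True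
        unfolding dW[symmetric] by (simp add: revc_simps)
      show "in1 S' \<cdot>\<^bsub>opc C\<^esub> df (revc (Suc n) ?W) (Suc 0) = df (revc (Suc n) V) (Suc 0) \<cdot>\<^bsub>opc C\<^esub> in1 S"
        using True by (simp add: revc_simps tW)
    qed (use True tW in \<open>simp_all add: revc_simps\<close>)
    moreover have "revc (Suc n) V \<in> revc (Suc n) ` \<X>" if "?W \<in> \<X>"
    proof (rule O.mem_if_strict_pullback[OF True imageI[OF that] n_exact_opc[OF V], of "pr1 S'" "pr1 S"])
      show "strict_pullback (opc C) (df (revc (Suc n) ?W) (Suc 0)) (pr1 S') (pr1 S) (df (revc (Suc n) V) (Suc 0))"
        using O.strict_pullback_contractible_in[OF d is_biproduct_opc[OF S'] is_biproduct_opc[OF S]] True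
        unfolding dW[symmetric] by (simp add: revc_simps)
      show "pr1 S' \<cdot>\<^bsub>opc C\<^esub> df (revc (Suc n) V) (Suc 0) = df (revc (Suc n) ?W) (Suc 0) \<cdot>\<^bsub>opc C\<^esub> pr1 S"
        using True by (simp add: revc_simps tW)
    qed (use True tW in \<open>simp_all add: revc_simps\<close>)
    ultimately show ?thesis using revc_mem_iff[of \<X>, OF mem_complex Vc] revc_mem_iff[of \<X>, OF mem_complex Wc] by blast
  qed
qed

text \<open>Homotopy invariance is not yet available, so instead of splitting a summand off one adds
  it to the given \<open>Y\<close>: the enlarged sequence ends in \<open>[p 0]\<close>, in other
  coordinates in \<open>[p q p]\<close>, hence is a conflation, and the summand is removed
  again.\<close>

lemma weak_obscure:
  assumes Y: "n_exact C n Y" and q: "q \<in> Arr C" "Cod C q = tm Y (Suc 0)"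
    and pq: "df Y (Suc 0) \<cdot> q \<in> deflations \<X>"
  shows "Y \<in> \<X>"
proof -
  note Yc = n_exact_complex[OF Y]
  note [simp] = cpxD[OF Yc] q
  define p where "p = df Y (Suc 0)"
  have [simp]: "p \<in> Arr C" "Dom C p = tm Y (Suc 0)" "Cod C p = tm Y 0" by (simp_all add: p_def)
  obtain S where S: "is_biproduct C (Dom C q) (tm Y (Suc 0)) S"
    using obtain_biproduct[of "Dom C q" "tm Y (Suc 0)"] by auto
  note [simp] = biprodD[OF S]
  have "(p \<cdot> q) \<cdot> pr1 S \<boxplus> p \<cdot> pr2 S \<in> deflations \<X>"
  proof (rule deflation_row[OF n_pos mem_complex zero_mem deflations_comp])
    show "closed_under_contractible C (Suc n) 0 \<X>" "closed_under_contractible C (Suc n) (Suc 0) \<X>"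
      unfolding closed_under_contractible_def using contractible_0 contractible_1_iff exact by blast+
  qed (use pq S in \<open>simp_all add: p_def\<close>)
  then have row: "p \<cdot> pr2 S \<boxplus> p \<cdot> (q \<cdot> pr1 S) \<in> deflations \<X>" by (simp add: add_comm)
  \<comment> \<open>Its first projection is \<open>pr2 S\<close> plus
    \<open>q \<cdot> pr1 S\<close>, so that following it by \<open>p\<close> gives
    \<open>row\<close>.\<close>
  let ?S = "shear (swap_biproduct S) q"
  have S': "is_biproduct C (tm Y (Suc 0)) (Dom C q) ?S"
    by (rule is_biproduct_shear[OF is_biproduct_swap[OF S]]) simp
  have "tm Y (Suc (Suc 0)) \<in> Obj C" using n_pos by simp
  then obtain T where T: "is_biproduct C (tm Y (Suc (Suc 0))) (Dom C q) T"
    using obtain_biproduct[of "tm Y (Suc (Suc 0))" "Dom C q"] by auto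
  let ?W = "add_contractible C (Suc n) Y (Suc 0) ?S T"
  have "?W \<in> \<X>"
  proof (rule mem_if_deflation)
    show "n_exact C n ?W" by (rule n_exact_add_contractible[OF Y _ S' T]) (use n_pos in simp)
    have "df ?W (Suc 0) = p \<cdot> pr2 S \<boxplus> p \<cdot> (q \<cdot> pr1 S)"
      using add_contractible_df1(2)[OF Yc _ S' T] n_pos by (simp add: swap_biproduct_def p_def)
    then show "df ?W (Suc 0) \<in> deflations \<X>" using row by simp
  qed
  then show ?thesis using contractible_1_iff[OF Y S' T] by simp
qed

lemma homotopy_closed:
  assumes X: "X \<in> \<X>" and Yc: "is_complex C 0 (Suc n) Y" and e: "homotopy_equivalent C (Suc n) X Y"
  shows "Y \<in> \<X>"
proof -
  note Xc = mem_complex[OF X]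
  note [simp] = cpxD[OF Xc] cpxD[OF Yc]
  obtain f g where f: "is_cpx_morphism C 0 (Suc n) X Y f" and g: "is_cpx_morphism C 0 (Suc n) Y X g"
    and hom: "homotopic C (Suc n) Y Y (\<lambda>k. f k \<cdot> g k) (\<lambda>k. Ident C (tm Y k))"
    using e unfolding homotopy_equivalent_def by blast
  note [simp] = morD[OF f] morD[OF g]
  obtain s where s: "\<forall>k\<le>n. s k \<in> Hom C (tm Y k) (tm Y (Suc k))"
    "f 0 \<cdot> g 0 = Ident C (tm Y 0) \<boxplus> df Y (Suc 0) \<cdot> s 0"
    using hom[unfolded homotopic_iff[OF Yc Yc mor_ident[OF Yc, unfolded is_cpx_morphism_iff, THEN conjunct1]]]
    by (elim exE conjE) (rule that)
  define h where "h = s 0"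
  have h: "h \<in> Hom C (tm Y 0) (tm Y (Suc 0))" "f 0 \<cdot> g 0 = Ident C (tm Y 0) \<boxplus> df Y (Suc 0) \<cdot> h"
    using s by (auto simp: h_def)
  have [simp]: "h \<in> Arr C" "Dom C (h) = tm Y 0" "Cod C (h) = tm Y (Suc 0)" using h(1) by auto
  obtain q p where q: "q \<in> deflations \<X>" and p [simp]: "p \<in> Arr C" "Dom C p = Dom C q" "Cod C p = tm X (Suc 0)"
      "Cod C q = tm Y 0" and eq: "df X (Suc 0) \<cdot> p = g 0 \<cdot> q"
    using pull[unfolded pulls_back_J_def, rule_format, OF X, of "g 0"] by auto
  have [simp]: "q \<in> Arr C" using q mem_complex cpxD(2) by (auto simp: deflations_def)
  \<comment> \<open>The homotopy in degree 0 and the square write \<open>q\<close> as the last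
    morphism of \<open>Y\<close> after \<open>f 1 \<cdot> p - h \<cdot> q\<close>, the factorization
    that \<open>weak_obscure\<close> asks for.\<close>
  have "f 0 \<cdot> (g 0 \<cdot> q) = (Ident C (tm Y 0) \<boxplus> df Y (Suc 0) \<cdot> h) \<cdot> q"
    by (rule comp_eq_reassoc[OF h(2)]) simp_all
  then have "f 0 \<cdot> (g 0 \<cdot> q) = q \<boxplus> df Y (Suc 0) \<cdot> (h \<cdot> q)" by simp
  moreover have "f 0 \<cdot> (g 0 \<cdot> q) = df Y (Suc 0) \<cdot> (f (Suc 0) \<cdot> p)"
    unfolding eq[symmetric] by (rule mor_comm_comp[OF Xc Yc f]) simp_all
  ultimately have "df Y (Suc 0) \<cdot> (f (Suc 0) \<cdot> p) = q \<boxplus> df Y (Suc 0) \<cdot> (h \<cdot> q)" by metis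
  then have "df Y (Suc 0) \<cdot> (f (Suc 0) \<cdot> p) \<boxplus> Neg C (df Y (Suc 0) \<cdot> (h \<cdot> q)) = q"
    by (rule diff_eqI) simp_all
  then have "df Y (Suc 0) \<cdot> (f (Suc 0) \<cdot> p \<boxplus> Neg C (h \<cdot> q)) = q" by simp
  then have "df Y (Suc 0) \<cdot> (f (Suc 0) \<cdot> p \<boxplus> Neg C (h \<cdot> q)) \<in> deflations \<X>" using q by simp
  from weak_obscure[OF n_exact_homotopy_equivalent[OF exact[OF X] Yc e] _ _ this] show ?thesis by simp
qed

lemma elementary_structure: "elementary_structure C n \<X>"
proof (intro elementary_structure.intro elementary_structure_axioms.intro)
  show "icat C" by unfold_locales
  \<comment> \<open>Stated for an unspecified category \<open>B\<close> because it is applied to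
    \<open>C\<close> and to its opposite.\<close>
  have pb: "pulls_back B (deflations \<Y>)" if J: "pulls_back_J B n \<Y>"
    and c: "\<And>X. X \<in> \<Y> \<Longrightarrow> Dom B (df X (Suc 0)) = tm X (Suc 0) \<and> Cod B (df X (Suc 0)) = tm X 0"
    for B :: "('o, 'm) cat" and \<Y>
    unfolding pulls_back_def
  proof (intro ballI impI)
    fix d g assume d: "d \<in> deflations \<Y>" and g: "g \<in> Arr B" "Cod B g = Cod B d"
    obtain X where X: "X \<in> \<Y>" "d = df X (Suc 0)" using d by (auto simp: deflations_def)
    have "Cod B g = tm X 0" using g X c by simp
    from J[unfolded pulls_back_J_def, rule_format, OF X(1) g(1) this]
    show "\<exists>q\<in>deflations \<Y>. \<exists>p\<in>Arr B. Dom B p = Dom B q \<and> Cod B p = Dom B d \<and>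
        Cod B q = Dom B g \<and> d \<cdot>\<^bsub>B\<^esub> p = g \<cdot>\<^bsub>B\<^esub> q"
      using X c by auto
  qed
  show "pulls_back C (deflations \<X>)"
    by (rule pb[OF pull]) (use cpxD(3,4)[OF mem_complex] in auto)
  have "pulls_back (opc C) (deflations (revc (Suc n) ` \<X>))"
  proof (rule pb[OF push])
    fix X assume "X \<in> revc (Suc n) ` \<X>"
    then obtain X' where X': "X' \<in> \<X>" "X = revc (Suc n) X'" by (rule imageE)
    then show "Dom (opc C) (df X (Suc 0)) = tm X (Suc 0) \<and> Cod (opc C) (df X (Suc 0)) = tm X 0"
      using cpxD(3,4)[OF mem_complex[OF X'(1)]] by (simp add: revc_simps)
  qed
  then show "pulls_back (opc C) (inflations n \<X>)" by (simp add: deflations_revc)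
qed (use n_pos exact homotopy_closed zero_mem deflations_comp inflations_comp in blast)+

end

section \<open>n-pullbacks and n-pushouts as squares\<close>

context icat
begin

text \<open>The square is the lowest one of the n-pullback diagram. For \<open>n = 1\<close> it
  determines the whole cone, whose left exactness is strictness of the pullback.\<close>

lemma pulls_back_J_if_E2_op:
  assumes n: "0 < n" and ex: "\<forall>X\<in>\<X>. n_exact C n X" and E: "axiom_E2_op C n \<X>"
  shows "pulls_back_J C n \<X>"
  unfolding pulls_back_J_def
proof (intro ballI impI)
  fix X g assume X: "X \<in> \<X>" and g: "g \<in> Arr C" "Cod C g = tm X 0"
  have Xc: "is_complex C 0 (Suc n) X" using ex X n_exact_complex by blast
  obtain Y f where Y: "f 0 = g" "is_n_pullback C n Y X f" "df Y (Suc 0) \<in> deflations \<X>"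
    using E[unfolded axiom_E2_op_def, rule_format, OF X g] by auto
  have Yc: "is_complex C 0 n Y" and f: "is_cpx_morphism C 0 n Y X f"
    and L': "left_n_exact C n (pullback_cone C n Y X f)"
    using Y(2) by (simp_all add: is_n_pullback_def)
  note L = L'[unfolded pullback_cone_eq[OF n Xc Yc f]]
  have n1: "Suc 0 \<le> n" using n by simp
  note [simp] = cpxD[OF Xc] cpxD[OF Yc] morD[OF f] n n1
  have g1: "Dom C g = tm Y 0" using Y(1) morD(2)[OF f, of 0] by simp
  have S: "is_biproduct C (tm X (Suc 0)) (tm Y 0) (biprod C (tm X (Suc 0)) (tm Y 0))"
    by (rule biprod) simp_all
  have sp: "strict_pullback C (df X (Suc 0)) g (f (Suc 0)) (df Y (Suc 0))" if n1: "n = Suc 0"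
  proof (rule strict_pullback_if_left_exact)
    show "left_n_exact C (Suc 0) (cone C n (\<lambda>k. biprod C (tm X k) (tm Y (k - 1))) Y X f)"
      using L n1 by simp
    show "is_biproduct C (Dom C (df X (Suc 0))) (Dom C g) (biprod C (tm X (Suc 0)) (tm Y 0))"
      using S by (simp add: g1)
  qed (use n1 g g1 Y(1) in \<open>simp_all add: cone_simps\<close>)
  show "\<exists>q\<in>deflations \<X>. \<exists>p\<in>Arr C. Dom C p = Dom C q \<and> Cod C p = tm X (Suc 0) \<and> Cod C q = Dom C g \<and>
      df X (Suc 0) \<cdot> p = g \<cdot> q \<and> (n = Suc 0 \<longrightarrow> strict_pullback C (df X (Suc 0)) g p q)"
    using Y(1,3) g1 sp mor_comm[OF f, of 0]
    by (intro bexI[of _ "df Y (Suc 0)"] bexI[of _ "f (Suc 0)"]) auto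
qed

text \<open>Reversal makes the top square of the n-pushout diagram the lowest one. For
  \<open>n = 1\<close> the reversed cone is the kernel sequence of the row formed with the reversed
  chosen biproduct.\<close>

lemma pulls_back_J_if_E2:
  assumes n: "0 < n" and ex: "\<forall>X\<in>\<X>. n_exact C n X" and E: "axiom_E2 C n \<X>"
  shows "pulls_back_J (opc C) n (revc (Suc n) ` \<X>)"
  unfolding pulls_back_J_def
proof (intro ballI impI)
  interpret O: icat "opc C" by (rule icat_opc)
  fix X' g assume "X' \<in> revc (Suc n) ` \<X>" and g: "g \<in> Arr (opc C)" "Cod (opc C) g = tm X' 0"
  then obtain X where X: "X \<in> \<X>" "X' = revc (Suc n) X" by blast
  have Xc: "is_complex C 0 (Suc n) X" using ex X n_exact_complex by blast
  have g': "g \<in> Arr C" "Dom C g = tm X (n + 1)" using g X(2) by (simp_all add: revc_simps)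
  obtain Y f where Y: "f (Suc n) = g" "is_n_pushout C n X Y f" "df Y (Suc n) \<in> inflations n \<X>"
    using E[unfolded axiom_E2_def, rule_format, OF X(1) g'] by auto
  have Yc: "is_complex C 1 (n + 1) Y" and f: "is_cpx_morphism C 1 (n + 1) X Y f"
    and R: "right_n_exact C n (pushout_cone C n X Y f)"
    using Y(2) by (simp_all add: is_n_pushout_def)
  have n1: "Suc 0 \<le> n" using n by simp
  note [simp] = cpxD[OF Xc] n n1
  have "Suc n \<in> {1<..n + 1}" "Suc n \<in> {1..n + 1}" "n \<in> {1..n + 1}" using n by auto
  then have dY: "df Y (Suc n) \<in> Hom C (tm Y (Suc n)) (tm Y (Suc n - 1))"
    and fn: "f (Suc n) \<in> Hom C (tm X (Suc n)) (tm Y (Suc n))" "f n \<in> Hom C (tm X n) (tm Y n)"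
    and comm: "f (Suc n - 1) \<cdot> df X (Suc n) = df Y (Suc n) \<cdot> f (Suc n)"
    using Yc f unfolding is_complex_def is_cpx_morphism_def PiE_iff by blast+
  have [simp]: "df Y (Suc n) \<in> Arr C" "Dom C (df Y (Suc n)) = tm Y (Suc n)" "Cod C (df Y (Suc n)) = tm Y n"
    "g \<in> Arr C" "Dom C g = tm X (Suc n)" "Cod C g = tm Y (Suc n)"
    "f n \<in> Arr C" "Dom C (f n) = tm X n" "Cod C (f n) = tm Y n"
    using dY fn Y(1) by auto
  let ?S = "biprod C (tm X n) (tm Y (Suc n))"
  have S: "is_biproduct C (tm X n) (tm Y (Suc n)) ?S"
    by (rule biprod) (use cod_obj[of g] in auto)
  note [simp] = biprodD[OF S]
  have sp: "strict_pullback (opc C) (df X (Suc n)) g (f n) (df Y (Suc n))" if n1: "n = Suc 0"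
  proof (rule O.strict_pullback_if_left_exact)
    show "left_n_exact (opc C) (Suc 0) (revc (Suc n) (pushout_cone C n X Y f))"
      using right_n_exact_opc[OF R] n1 by simp
    show "is_biproduct (opc C) (Dom (opc C) (df X (Suc n))) (Dom (opc C) g) (opb ?S)"
      using is_biproduct_opc[OF S] by simp
    show "df (revc (Suc n) (pushout_cone C n X Y f)) (Suc 0) =
      Neg (opc C) (df X (Suc n)) \<cdot>\<^bsub>opc C\<^esub> pr1 (opb ?S) \<boxplus>\<^bsub>opc C\<^esub> g \<cdot>\<^bsub>opc C\<^esub> pr2 (opb ?S)"
      using Y(1) by (simp add: revc_simps pushout_cone_def col_def Let_def)
    show "df (revc (Suc n) (pushout_cone C n X Y f)) (Suc (Suc 0)) =
      in1 (opb ?S) \<cdot>\<^bsub>opc C\<^esub> f n \<boxplus>\<^bsub>opc C\<^esub> in2 (opb ?S) \<cdot>\<^bsub>opc C\<^esub> df Y (Suc n)"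
    proof -
      \<comment> \<open>For \<open>n = 1\<close> the degree 2 in the last row of the cone is the top
        degree \<open>Suc n\<close> of \<open>Y\<close>.\<close>
      have "tm X n = Dom C (f (Suc 0))" "tm Y (Suc n) = Dom C (df Y 2)" "f n = f (Suc 0)" "df Y (Suc n) = df Y 2"
        using n1 \<open>Dom C (f n) = tm X n\<close> \<open>Dom C (df Y (Suc n)) = tm Y (Suc n)\<close> by (simp_all add: numeral_2_eq_2)
      then show ?thesis using n1 by (simp add: revc_simps pushout_cone_def row_def Let_def)
    qed
  qed simp_all
  have "df X' (Suc 0) = df X (Suc n)" "tm X' (Suc 0) = tm X n" using X(2) by (simp_all add: revc_simps)
  then show "\<exists>q\<in>deflations (revc (Suc n) ` \<X>). \<exists>p\<in>Arr (opc C). Dom (opc C) p = Dom (opc C) q \<and>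
      Cod (opc C) p = tm X' (Suc 0) \<and> Cod (opc C) q = Dom (opc C) g \<and>
      df X' (Suc 0) \<cdot>\<^bsub>opc C\<^esub> p = g \<cdot>\<^bsub>opc C\<^esub> q \<and>
      (n = Suc 0 \<longrightarrow> strict_pullback (opc C) (df X' (Suc 0)) g p q)"
    using sp comm Y(1,3)
    by (intro bexI[of _ "df Y (Suc n)"] bexI[of _ "f n"]) (simp_all add: deflations_revc)
qed

lemma elementary_if_J:
  assumes n: "0 < n" and ex: "\<forall>X\<in>\<X>. n_exact C n X" and J: "n_exact_structure_J C n \<X>"
  shows "elementary_structure C n \<X>"
proof -
  note J' = J[unfolded n_exact_structure_J_def Suc_eq_plus1[symmetric]]
  have "jasso_structure C n \<X>"
  proof (intro jasso_structure.intro jasso_structure_axioms.intro)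
    show "icat C" by unfold_locales
    show "pulls_back_J C n \<X>" using pulls_back_J_if_E2_op[OF n ex] J' by blast
    show "pulls_back_J (opc C) n (revc (Suc n) ` \<X>)" using pulls_back_J_if_E2[OF n ex] J' by blast
  qed (use n ex J' in blast)+
  then show ?thesis by (rule jasso_structure.elementary_structure)
qed

end

theorem theorem3p7:
  fixes C :: "('o, 'm) cat" and n :: nat and \<X> :: "('o, 'm) cpx set"
  assumes "n \<ge> 1"
    and "idempotent_complete_additive_category C"
    and "\<forall>X\<in>\<X>. n_exact C n X"
  shows "n_exact_structure_J C n \<X> \<longleftrightarrow> n_exact_structure_H C n \<X>"
proof -
  interpret icat C using assms(2) by (rule icat.intro)
  have n: "0 < n" using assms(1) by simp
  show ?thesis
    using elementary_if_J[OF n assms(3)] elementary_if_H[OF n assms(3)]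
      elementary_structure.n_exact_structure_H elementary_structure.n_exact_structure_J by blast
qed

end
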